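(* Let $m\ge1$, let $d=m$ or $d=11m$, and let $\Gamma=R_{12m}(3d+2,9d+1)$ be the Rose Window graph (with $3d+2$ and $9d+1$ reduced modulo $12m$). Then (i) if $m\not\equiv2\pmod4$, $\Gamma$ is the underlying graph of exactly three pairwise nonisomorphic maps of class $2_{\{0,1\}}$; (ii) if $m\equiv2\pmod4$, $\Gamma$ is the underlying graph of exactly two pairwise nonisomorphic maps of class $2_{\{0,1\}}$.
   Context: For $n\ge3$, $1\le r\le n-1$ with $r\ne n/2$, and $0\le a\le n-1$, the Rose Window graph $R_n(a,r)$ has vertex set $\{x_i,y_i: i\in\mathbb Z_n\}$ and edges $x_ix_{i+1}$, $y_iy_{i+r}$, $x_iy_i$, $x_iy_{i-a}$ for $i\in\mathbb Z_n$ (indices mod $n$). A map is a $2$-cell embedding of a connected simple graph (its underlying graph) in a closed surface; the components of the complement are the faces. All maps considered are polytopal: flags correspond bijectively to incident triples (vertex, edge, face). For a flag $\Phi$ and $i\in\{0,1,2\}$, $\Phi^i$ is the unique flag differing from $\Phi$ exactly in its vertex ($i=0$), edge ($i=1$) or face ($i=2$). $\mathrm{Aut}(\mathcal M)$ is the group of automorphisms of the underlying graph preserving the set of faces. A map is in class $2_{\{0,1\}}$ if $\mathrm{Aut}(\mathcal M)$ has exactly two orbits on flags and for every flag $\Phi$, the flags $\Phi^0,\Phi^1$ lie in the orbit of $\Phi$ while $\Phi^2$ does not. *)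

theory Defs
  imports Main
begin

definition simple_graph :: "'v set \<Rightarrow> 'v set set \<Rightarrow> bool" where
  "simple_graph V E \<longleftrightarrow> finite V \<and> V \<noteq> {} \<and>
     E \<subseteq> {{u, w} | u w. u \<in> V \<and> w \<in> V \<and> u \<noteq> w}"

definition connected_graph :: "'v set \<Rightarrow> 'v set set \<Rightarrow> bool" where
  "connected_graph V E \<longleftrightarrow>
     (\<forall>u\<in>V. \<forall>w\<in>V. (\<lambda>a b. {a, b} \<in> E)\<^sup>*\<^sup>* u w)"

definition graph_aut :: "'v set \<Rightarrow> 'v set set \<Rightarrow> ('v \<Rightarrow> 'v) \<Rightarrow> bool" where
  "graph_aut V E \<sigma> \<longleftrightarrow> bij_betw \<sigma> V V \<and> (\<lambda>e. \<sigma> ` e) ` E = E"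

text \<open>A face is represented by its boundary, which for a polytopal map is the edge set
  of a simple cycle of the graph.\<close>

definition cycle_edges :: "'v list \<Rightarrow> 'v set set" where
  "cycle_edges vs = {{vs ! i, vs ! (Suc i mod length vs)} | i. i < length vs}"

definition is_face_cycle :: "'v set set \<Rightarrow> 'v set set \<Rightarrow> bool" where
  "is_face_cycle E f \<longleftrightarrow>
     (\<exists>vs. distinct vs \<and> length vs \<ge> 3 \<and> f = cycle_edges vs \<and> f \<subseteq> E)"

text \<open>The faces around a vertex v form a single disc: the edges at v and the faces at v
  alternate in one cyclic sequence.\<close>

definition vertex_disc :: "'v set set \<Rightarrow> 'v set set set \<Rightarrow> 'v \<Rightarrow> bool" where
  "vertex_disc E F v \<longleftrightarrow>
     (\<exists>es fs. distinct es \<and> distinct fs \<and> length fs = length es \<and>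
        set es = {e \<in> E. v \<in> e} \<and> set fs = {f \<in> F. \<exists>e\<in>f. v \<in> e} \<and>
        (\<forall>j < length es. es ! j \<in> fs ! j \<and> es ! (Suc j mod length es) \<in> fs ! j))"

text \<open>A polytopal map with underlying graph (V,E): a set F of faces (given by their
  boundary cycles) such that every edge lies in exactly two faces and the faces around
  every vertex close up to a disc; gluing discs along the face boundaries yields a
  closed surface in which (V,E) is 2-cell embedded.\<close>

definition polytopal_map :: "'v set \<Rightarrow> 'v set set \<Rightarrow> 'v set set set \<Rightarrow> bool" where
  "polytopal_map V E F \<longleftrightarrow>
     simple_graph V E \<and> connected_graph V E \<and>
     (\<forall>f\<in>F. is_face_cycle E f) \<and>
     (\<forall>e\<in>E. card {f \<in> F. e \<in> f} = 2) \<and>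
     (\<forall>v\<in>V. vertex_disc E F v)"

definition face_img :: "('v \<Rightarrow> 'v) \<Rightarrow> 'v set set \<Rightarrow> 'v set set" where
  "face_img \<sigma> f = (\<lambda>e. \<sigma> ` e) ` f"

definition map_aut :: "'v set \<Rightarrow> 'v set set \<Rightarrow> 'v set set set \<Rightarrow> ('v \<Rightarrow> 'v) \<Rightarrow> bool" where
  "map_aut V E F \<sigma> \<longleftrightarrow> graph_aut V E \<sigma> \<and> face_img \<sigma> ` F = F"

definition maps_iso :: "'v set \<Rightarrow> 'v set set \<Rightarrow> 'v set set set \<Rightarrow> 'v set set set \<Rightarrow> bool" where
  "maps_iso V E F1 F2 \<longleftrightarrow> (\<exists>\<sigma>. graph_aut V E \<sigma> \<and> face_img \<sigma> ` F1 = F2)"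

type_synonym 'v flag = "'v \<times> 'v set \<times> 'v set set"

definition flags :: "'v set set set \<Rightarrow> 'v flag set" where
  "flags F = {(v, e, f). f \<in> F \<and> e \<in> f \<and> v \<in> e}"

definition flag_img :: "('v \<Rightarrow> 'v) \<Rightarrow> 'v flag \<Rightarrow> 'v flag" where
  "flag_img \<sigma> \<Phi> = (case \<Phi> of (v, e, f) \<Rightarrow> (\<sigma> v, \<sigma> ` e, face_img \<sigma> f))"

definition flag_orbit :: "'v set \<Rightarrow> 'v set set \<Rightarrow> 'v set set set \<Rightarrow> 'v flag \<Rightarrow> 'v flag set" where
  "flag_orbit V E F \<Phi> = {flag_img \<sigma> \<Phi> | \<sigma>. map_aut V E F \<sigma>}"

text \<open>Psi is the i-adjacent flag of Phi (i = 0, 1, 2): it differs from Phi exactly in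
  its vertex, edge or face respectively.  In a polytopal map it is unique.\<close>

definition adj_flag :: "nat \<Rightarrow> 'v flag \<Rightarrow> 'v flag \<Rightarrow> bool" where
  "adj_flag i \<Phi> \<Psi> \<longleftrightarrow>
     (case (\<Phi>, \<Psi>) of ((v, e, f), (v', e', f')) \<Rightarrow>
        (i = 0 \<and> v \<noteq> v' \<and> e = e' \<and> f = f') \<or>
        (i = 1 \<and> v = v' \<and> e \<noteq> e' \<and> f = f') \<or>
        (i = 2 \<and> v = v' \<and> e = e' \<and> f \<noteq> f'))"

definition class_2_01 :: "'v set \<Rightarrow> 'v set set \<Rightarrow> 'v set set set \<Rightarrow> bool" where
  "class_2_01 V E F \<longleftrightarrow>
     card (flag_orbit V E F ` flags F) = 2 \<and>
     (\<forall>\<Phi>\<in>flags F. \<forall>\<Psi>\<in>flags F.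
        (adj_flag 0 \<Phi> \<Psi> \<longrightarrow> \<Psi> \<in> flag_orbit V E F \<Phi>) \<and>
        (adj_flag 1 \<Phi> \<Psi> \<longrightarrow> \<Psi> \<in> flag_orbit V E F \<Phi>) \<and>
        (adj_flag 2 \<Phi> \<Psi> \<longrightarrow> \<Psi> \<notin> flag_orbit V E F \<Phi>))"

definition exactly_k_class_2_01_maps :: "'v set \<Rightarrow> 'v set set \<Rightarrow> nat \<Rightarrow> bool" where
  "exactly_k_class_2_01_maps V E k \<longleftrightarrow>
     (\<exists>S. finite S \<and> card S = k \<and>
        (\<forall>F\<in>S. polytopal_map V E F \<and> class_2_01 V E F) \<and>
        (\<forall>F1\<in>S. \<forall>F2\<in>S. F1 \<noteq> F2 \<longrightarrow> \<not> maps_iso V E F1 F2) \<and>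
        (\<forall>F. polytopal_map V E F \<and> class_2_01 V E F \<longrightarrow> (\<exists>F'\<in>S. maps_iso V E F F')))"

text \<open>Vertex x_i is (False, i), vertex y_i is (True, i), for i < n.\<close>

definition rose_vertices :: "nat \<Rightarrow> (bool \<times> nat) set" where
  "rose_vertices n = {(b, i). i < n}"

definition rose_edges :: "nat \<Rightarrow> nat \<Rightarrow> nat \<Rightarrow> (bool \<times> nat) set set" where
  "rose_edges n a r =
     {{(False, i), (False, (i + 1) mod n)} | i. i < n} \<union>
     {{(True, i), (True, (i + r) mod n)} | i. i < n} \<union>
     {{(False, i), (True, i)} | i. i < n} \<union>
     {{(False, i), (True, (i + n - a mod n) mod n)} | i. i < n}"

end

(*
  The vertices lie on 3m cyclically ordered levels of eight, every edge joins consecutive levels,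
  and every vertex has two upper and two lower neighbours. Of the three perfect matchings of these
  four neighbours one is flat (upper with upper, lower with lower) and two are monotone. Choosing
  a matching at each vertex yields a family of closed walks through all edges, and two choices
  that differ at every vertex make up a map once all these walks are cycles.

  Closed walks of length 6 and 8 show that every automorphism preserves the flat matchings and
  either preserves or interchanges the two monotone matchings simultaneously at all vertices;
  interchanging automorphisms exist exactly if m mod 4 = 2. In a map of class 2_{0,1} the two
  matchings used by the faces are then either the flat one together with a monotone one, or both
  monotone ones, and transitivity forces the choice of monotone matchings to be constant or, if
  m mod 4 = 2, alternating with the level. If m mod 4 is not 2, the three pairs of constant
  matchings give three maps that no automorphism relates. If m mod 4 = 2, the purely monotone maps
  are regular, and an interchanging automorphism identifies the remaining four maps in pairs.
*)
theory Submission
  imports Defs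
begin

text \<open>Modulo 12m the number \<open>t\<close> = 3d is 3m or -3m, an element of order four, and
  the parameters of the graph become a = t + 2 and r = 1 - t. Hence both values of d are treated
  alike, and an index splits into a position and a multiple of \<open>t\<close> that counts modulo
  4. The obstacle is uniformity in m: for m = 1 there are only three levels, so local computations
  compare only vertices whose positions are equal or differ modulo 3. The three matchings are the
  nonzero elements of the Klein four-group, acting by translation on the pairs of flags of the
  neighbours. Automorphisms act there by affine maps, and once the flat element is known to be
  fixed, the linear part is the identity or one shear. The condition m mod 4 = 2 comes from
  monodromy: an interchanging automorphism that fixes an arc is determined by it and gains a shift
  by t after every three levels, hence by d times t on the way to x_t. A short walk to x_t gives the
  shift -2t, and the two agree exactly if 4 divides d + 2.\<close>

type_synonym vertex = "bool \<times> nat"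
type_synonym kind = "bool \<times> bool"

section \<open>Coordinates modulo n, neighbours and levels\<close>

locale rose_window =
  fixes m d :: nat
  assumes m_pos: "m \<ge> 1" and d_cases: "d = m \<or> d = 11 * m"
begin

definition n :: int where "n = 12 * int m"
definition t :: int where "t = 3 * int d"

definition X :: "int \<Rightarrow> vertex" where "X k = (False, nat (k mod n))"
definition Y :: "int \<Rightarrow> vertex" where "Y k = (True, nat (k mod n))"

definition V :: "vertex set" where "V = rose_vertices (12 * m)"
definition E :: "vertex set set" where
  "E = rose_edges (12 * m) ((3 * d + 2) mod (12 * m)) ((9 * d + 1) mod (12 * m))"

lemma n_pos: "n > 0"
  using m_pos by (simp add: n_def)

text \<open>\<open>t\<close> is 3m or 33m, and 33m is -3m modulo 12m, so its residue has order four.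
  Cancelling 3m leaves divisibility of b or 11b by 4.\<close>

lemma n_dvd_t_iff: "n dvd b * t \<longleftrightarrow> 4 dvd b"
proof -
  have "n dvd b * t \<longleftrightarrow> (3 * int m) * 4 dvd (3 * int m) * (b * int (d div m))"
    using d_cases m_pos by (auto simp: n_def t_def algebra_simps)
  also have "\<dots> \<longleftrightarrow> 4 dvd b * int (d div m)"
    using m_pos by (simp only: dvd_mult_cancel_left) simp
  also have "\<dots> \<longleftrightarrow> 4 dvd b"
  proof -
    have "d div m = 1 \<or> d div m = 11" using d_cases m_pos by auto
    then show ?thesis
    proof
      assume "d div m = 11"
      then have e: "int (d div m) = 11" by simp
      show ?thesis unfolding e by presburger
    qed simp
  qed
  finally show ?thesis .
qed

lemma three_dvd: "3 dvd n"
  by (simp add: n_def)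

text \<open>\<open>t\<close> is a multiple of 3m, so reduction modulo 3m forgets the multiples of
  \<open>t\<close> and retains the level.\<close>

lemma level_dvd: "n dvd a + b * t \<Longrightarrow> 3 * int m dvd a"
proof -
  assume "n dvd a + b * t"
  moreover have "3 * int m dvd n" by (simp add: n_def)
  ultimately have "3 * int m dvd a + b * t" by (rule dvd_trans[rotated])
  moreover have "3 * int m dvd b * t" using d_cases by (auto simp: t_def)
  ultimately show ?thesis by (simp add: dvd_add_left_iff)
qed

lemma X_eq_iff: "X a = X b \<longleftrightarrow> n dvd a - b"
  using n_pos by (simp add: X_def eq_nat_nat_iff mod_eq_dvd_iff)

lemma Y_eq_iff: "Y a = Y b \<longleftrightarrow> n dvd a - b"
  using n_pos by (simp add: Y_def eq_nat_nat_iff mod_eq_dvd_iff)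

lemma XY_distinct [simp]: "X a \<noteq> Y b" "Y b \<noteq> X a"
  by (simp_all add: X_def Y_def)

lemma X_in [simp]: "X k \<in> V" and Y_in [simp]: "Y k \<in> V"
  using n_pos m_pos
  by (auto simp: X_def Y_def V_def rose_vertices_def n_def nat_less_iff)

lemma V_cases:
  assumes "v \<in> V"
  obtains k where "v = X k" | k where "v = Y k"
proof -
  obtain b i where v: "v = (b, i)" "i < 12 * m"
    using assms by (auto simp: V_def rose_vertices_def)
  then have "i = nat (int i mod n)" by (simp add: n_def)
  then have "v = (if b then Y (int i) else X (int i))" using v by (simp add: X_def Y_def)
  then show ?thesis using that by (cases b) auto
qed

lemma finite_V: "finite V"
proof -
  have "V \<subseteq> UNIV \<times> {..<12 * m}" by (auto simp: V_def rose_vertices_def)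
  then show ?thesis by (rule finite_subset) simp
qed

text \<open>The first flag tells upper from lower neighbours. The second is chosen so that automorphisms
  act affinely on the pairs of flags.\<close>

definition nbr :: "vertex \<Rightarrow> bool \<Rightarrow> bool \<Rightarrow> vertex" where
  "nbr v D l = (let k = int (snd v) in
     if fst v
     then (if D then (if l then X (k + 2 + t) else Y (k + 1 - t))
           else (if l then Y (k - 1 + t) else X k))
     else (if D then (if l then Y k else X (k + 1))
           else (if l then Y (k - 2 - t) else X (k - 1))))"

lemma fst_snd_XY [simp]:
  "fst (X k) = False" "fst (Y k) = True" "int (snd (X k)) = k mod n" "int (snd (Y k)) = k mod n"
  using n_pos by (simp_all add: X_def Y_def)

lemma mod_shift [simp]:
  "X (k mod n + c) = X (k + c)" "Y (k mod n + c) = Y (k + c)"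
  "X (k mod n - c) = X (k - c)" "Y (k mod n - c) = Y (k - c)"
  "X (k mod n) = X k" "Y (k mod n) = Y k"
  by (simp_all add: X_def Y_def mod_simps)

lemma nbr_X:
  "nbr (X k) True False = X (k + 1)" "nbr (X k) True True = Y k"
  "nbr (X k) False False = X (k - 1)" "nbr (X k) False True = Y (k - 2 - t)"
proof -
  have "Y (k mod n - 2 - t) = Y (k - 2 - t)"
    using mod_shift(4)[of k "2 + t"] by (simp add: algebra_simps)
  then show "nbr (X k) False True = Y (k - 2 - t)" by (simp add: nbr_def Let_def)
qed (simp_all add: nbr_def Let_def)

lemma nbr_Y:
  "nbr (Y k) True False = Y (k + 1 - t)" "nbr (Y k) True True = X (k + 2 + t)"
  "nbr (Y k) False False = X k" "nbr (Y k) False True = Y (k - 1 + t)"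
  using mod_shift(2)[of k "1 - t"] mod_shift(1)[of k "2 + t"] mod_shift(2)[of k "t - 1"]
  by (simp_all add: nbr_def Let_def algebra_simps)

lemmas nbr_simps = nbr_X nbr_Y

lemma nbr_in [simp]: "nbr v D l \<in> V"
  by (simp add: nbr_def Let_def)

lemma X_eqI: "a - b = 4 * c * t \<Longrightarrow> X a = X b"
  and Y_eqI: "a - b = 4 * c * t \<Longrightarrow> Y a = Y b"
  by (simp_all add: X_eq_iff Y_eq_iff n_dvd_t_iff)

text \<open>All edges join consecutive levels modulo 3m.\<close>

definition lev :: "vertex \<Rightarrow> int" where
  "lev v = (int (snd v) + of_bool (fst v)) mod (3 * int m)"

lemma lev_simps [simp]: "lev (X k) = k mod (3 * int m)" "lev (Y k) = (k + 1) mod (3 * int m)"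
proof -
  have "3 * int m dvd n" by (simp add: n_def)
  then have "k mod n mod (3 * int m) = k mod (3 * int m)" for k by (rule mod_mod_cancel)
  then show "lev (X k) = k mod (3 * int m)" "lev (Y k) = (k + 1) mod (3 * int m)"
    by (simp_all add: lev_def) (metis mod_add_left_eq)
qed

lemma lev_nbr:
  assumes "v \<in> V"
  shows "lev (nbr v D l) = (lev v + (if D then 1 else -1)) mod (3 * int m)"
proof -
  have t: "3 * int m dvd t" "3 * int m dvd - t"
    using d_cases by (auto simp: t_def)
  have *: "a mod M = (b mod M + c) mod M \<longleftrightarrow> M dvd a - b - c" for a b c M :: int
    by (metis mod_add_left_eq mod_eq_dvd_iff diff_diff_eq)
  show ?thesis using assms
    by (cases D; cases l; elim V_cases; simp only: nbr_simps lev_simps * if_True if_False; simp add: t)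
qed

text \<open>Upper and lower neighbours lie on levels that differ by 2, which is not a multiple of
  3m, and the two neighbours on one side are one x and one y.\<close>

lemma nbr_eq_iff:
  assumes "v \<in> V"
  shows "nbr v D l = nbr v D' l' \<longleftrightarrow> D = D' \<and> l = l'"
proof
  assume eq: "nbr v D l = nbr v D' l'"
  have "\<not> 3 * int m dvd 2"
    using m_pos by (auto dest!: zdvd_imp_le)
  moreover have "3 * int m dvd (if D then 1 else -1) - (if D' then 1 else -1)"
    using arg_cong[OF eq, of lev] assms by (simp add: lev_nbr mod_eq_dvd_iff)
  ultimately have "D = D'"
    by (cases D; cases D') auto
  moreover have "l = l'"
    using eq assms \<open>D = D'\<close>
    by (cases D'; cases l; cases l'; elim V_cases) (simp_all add: nbr_simps)
  ultimately show "D = D' \<and> l = l'" ..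
qed simp

lemma nbr_back:
  assumes "v \<in> V"
  obtains l' where "nbr (nbr v D l) (\<not> D) l' = v"
proof -
  have "\<exists>l'. nbr (nbr v D l) (\<not> D) l' = v"
    using assms
    by (cases D; cases l; elim V_cases)
      (auto simp: nbr_simps ex_bool_eq algebra_simps intro!: X_eqI Y_eqI)
  then show ?thesis using that by blast
qed

lemma E_eq: "E = {{v, nbr v D l} | v D l. v \<in> V}"
proof -
  let ?a = "(3 * d + 2) mod (12 * m)" and ?r = "(9 * d + 1) mod (12 * m)"
  have n: "int (12 * m) = n" by (simp add: n_def)
  have x: "(False, i) = X (int i)" "(True, i) = Y (int i)" if "i < 12 * m" for i
    using that by (auto simp: X_def Y_def n_def)
  have m0: "12 * m > 0" using m_pos by simp
  have x1: "(False, (i + 1) mod (12 * m)) = X (int i + 1)" for i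
    unfolding X_def n[symmetric] by (simp add: nat_mod_distrib nat_add_distrib nat_mult_distrib)
  \<comment> \<open>9d + 1 is 1 - 3d plus 12d, and 12d = 4t vanishes modulo n, so the edges among
    the y have step 1 - t.\<close>
  have "int ((i + ?r) mod (12 * m)) = (int i + 1 - t) mod n" for i
  proof -
    have "int ((i + ?r) mod (12 * m)) = (int i + (9 * int d + 1)) mod n"
      by (simp add: zmod_int n[symmetric] mod_simps ac_simps)
    also have "\<dots> = (int i + 1 - t) mod n"
      using n_dvd_t_iff[of 4] by (auto simp: mod_eq_dvd_iff t_def algebra_simps)
    finally show ?thesis .
  qed
  then have x2: "(True, (i + ?r) mod (12 * m)) = Y (int i + 1 - t)" for i
    unfolding Y_def by (metis nat_int)
  have "int ((i + 12 * m - ?a mod (12 * m)) mod (12 * m)) = (int i - 2 - t) mod n" for i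
  proof -
    have "?a < 12 * m" using m0 by simp
    then have "int (i + 12 * m - ?a mod (12 * m)) = int i + n - int ?a"
      using n by (simp add: of_nat_diff)
    also have "int ?a = (3 * int d + 2) mod n" by (simp add: zmod_int n[symmetric] ac_simps)
    finally have "int (i + 12 * m - ?a mod (12 * m)) mod n = (int i - (3 * int d + 2)) mod n"
      by (simp add: mod_diff_right_eq) (simp add: mod_eq_dvd_iff)
    then show ?thesis by (simp only: zmod_int n t_def diff_diff_eq add.commute)
  qed
  then have x3: "(True, (i + 12 * m - ?a mod (12 * m)) mod (12 * m)) = Y (int i - 2 - t)" for i
    unfolding Y_def by (metis nat_int)
  \<comment> \<open>Passage from the indices below n to all integers; the integer description has to
    be n-periodic.\<close>
  have idx: "{f i | i. i < 12 * m} = {h k | k. True}"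
    if f: "\<And>i. i < 12 * m \<Longrightarrow> f i = h (int i)" and h: "\<And>k. h (k mod n) = h k"
    for f :: "nat \<Rightarrow> vertex set" and h
  proof
    show "{f i | i. i < 12 * m} \<subseteq> {h k | k. True}" using f by auto
    have "h k = f (nat (k mod n)) \<and> nat (k mod n) < 12 * m" for k
    proof -
      have lt: "nat (k mod n) < 12 * m" using n_pos by (simp add: nat_less_iff n_def)
      then show ?thesis using f[OF lt] h[of k] n_pos by simp
    qed
    then show "{h k | k. True} \<subseteq> {f i | i. i < 12 * m}" by blast
  qed
  have sh: "Y (k mod n + 1 - t) = Y (k + 1 - t)" "Y (k mod n - 2 - t) = Y (k - 2 - t)" for k
    using mod_shift(2)[of k "1 - t"] mod_shift(4)[of k "2 + t"] by (simp_all add: algebra_simps)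
  have "E = {{X k, X (k + 1)} | k. True} \<union> {{Y k, Y (k + 1 - t)} | k. True} \<union>
      {{X k, Y k} | k. True} \<union> {{X k, Y (k - 2 - t)} | k. True}"
    unfolding E_def rose_edges_def
    by (intro arg_cong2[of _ _ _ _ "(\<union>)"] idx; simp only: x x1 x2 x3 sh mod_shift)
  also have "\<dots> = {{v, nbr v D l} | v D l. v \<in> V}" (is "?A = ?B")
  proof
    have B: "{v, nbr v D l} \<in> ?B" if "v \<in> V" for v D l
      using that by blast
    show "?A \<subseteq> ?B"
    proof (intro Un_least subsetI)
      fix e assume "e \<in> {{X k, X (k + 1)} | k. True}"
      then obtain k where "e = {X k, X (k + 1)}" by blast
      then show "e \<in> ?B" using B[OF X_in, of k True False] by (simp only: nbr_simps)
    next
      fix e assume "e \<in> {{Y k, Y (k + 1 - t)} | k. True}"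
      then obtain k where "e = {Y k, Y (k + 1 - t)}" by blast
      then show "e \<in> ?B" using B[OF Y_in, of k True False] by (simp only: nbr_simps)
    next
      fix e assume "e \<in> {{X k, Y k} | k. True}"
      then obtain k where "e = {X k, Y k}" by blast
      then show "e \<in> ?B" using B[OF X_in, of k True True] by (simp only: nbr_simps)
    next
      fix e assume "e \<in> {{X k, Y (k - 2 - t)} | k. True}"
      then obtain k where "e = {X k, Y (k - 2 - t)}" by blast
      then show "e \<in> ?B" using B[OF X_in, of k False True] by (simp only: nbr_simps)
    qed
    have A: "{X k, X (k + 1)} \<in> ?A" "{Y k, Y (k + 1 - t)} \<in> ?A" "{X k, Y k} \<in> ?A"
      "{X k, Y (k - 2 - t)} \<in> ?A" for k
      by blast+
    \<comment> \<open>Only upward edges need a case distinction: a downward edge is an upward edge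
      of its other end, by \<open>nbr_back\<close>.\<close>
    have up: "{v, nbr v True l} \<in> ?A" if v: "v \<in> V" for v l
      using v
    proof (cases rule: V_cases)
      case (1 k) then show ?thesis using A(1,3)[of k] by (cases l) (simp_all only: nbr_simps)
    next
      case (2 k)
      have "{X (k + 2 + t), Y (k + 2 + t - 2 - t)} \<in> ?A" by (rule A(4))
      moreover have "k + 2 + t - 2 - t = k" by simp
      ultimately have "{Y k, X (k + 2 + t)} \<in> ?A" by (simp only: insert_commute)
      then show ?thesis using 2 A(2)[of k] by (cases l) (simp_all only: nbr_simps)
    qed
    show "?B \<subseteq> ?A"
    proof
      fix e assume "e \<in> ?B"
      then obtain v D l where v: "v \<in> V" and e: "e = {v, nbr v D l}" by blast
      show "e \<in> ?A"
      proof (cases D)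
        case False
        obtain l' where "nbr (nbr v D l) (\<not> D) l' = v" using nbr_back[OF v] .
        then show ?thesis using up[of "nbr v D l" l'] False e by (simp only: nbr_in insert_commute not_False_eq_True)
      qed (use up[OF v] e in simp)
    qed
  qed
  finally show ?thesis .
qed

end


section \<open>Face cycles\<close>

lemma cycle_edges_walk:
  assumes "length vs > 0"
  shows "cycle_edges vs = range (\<lambda>i. {vs ! (i mod length vs), vs ! (Suc i mod length vs)})"
proof
  show "cycle_edges vs \<subseteq> range (\<lambda>i. {vs ! (i mod length vs), vs ! (Suc i mod length vs)})"
    unfolding cycle_edges_def
    by (smt (verit) mem_Collect_eq mod_less rangeI subsetI)
  have "{vs ! (i mod length vs), vs ! (Suc i mod length vs)} \<in> cycle_edges vs" for i
    unfolding cycle_edges_def using assms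
    by (intro CollectI exI[of _ "i mod length vs"]) (simp add: mod_Suc_eq)
  then show "range (\<lambda>i. {vs ! (i mod length vs), vs ! (Suc i mod length vs)}) \<subseteq> cycle_edges vs"
    by blast
qed

text \<open>The cycle is unrolled over all naturals, with no coincidences but those forced by the
  period L. Consecutive vertices are then \<open>w i\<close> and \<open>w (Suc i)\<close>
  everywhere, without a wrap-around case.\<close>

definition closed_walk :: "(nat \<Rightarrow> 'v) \<Rightarrow> nat \<Rightarrow> 'v set set \<Rightarrow> bool" where
  "closed_walk w L f \<longleftrightarrow> L \<ge> 3 \<and> f = range (\<lambda>i. {w i, w (Suc i)}) \<and>
     (\<forall>i j. w i = w j \<longleftrightarrow> i mod L = j mod L)"

lemma face_cycle_walk:
  assumes "is_face_cycle E f"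
  obtains w L where "closed_walk w L f"
proof -
  obtain vs where vs: "distinct vs" "length vs \<ge> 3" "f = cycle_edges vs" "f \<subseteq> E"
    using assms unfolding is_face_cycle_def by blast
  show ?thesis
  proof (rule that[of "\<lambda>i. vs ! (i mod length vs)" "length vs"], unfold closed_walk_def, intro conjI allI)
    show "f = range (\<lambda>i. {vs ! (i mod length vs), vs ! (Suc i mod length vs)})"
      unfolding vs(3) using vs(2) by (intro cycle_edges_walk) linarith
    show "vs ! (i mod length vs) = vs ! (j mod length vs) \<longleftrightarrow> i mod length vs = j mod length vs" for i j
      using vs(1,2) by (subst nth_eq_iff_index_eq) (auto intro: mod_less_divisor)
  qed (use vs in auto)
qed

lemma face_cycleI:
  assumes "closed_walk w L f" "f \<subseteq> E"
  shows "is_face_cycle E f"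
proof -
  have L: "L \<ge> 3" and f: "f = range (\<lambda>i. {w i, w (Suc i)})" "f \<subseteq> E"
    and w: "\<And>i j. w i = w j \<longleftrightarrow> i mod L = j mod L"
    using assms by (auto simp: closed_walk_def)
  let ?vs = "map w [0..<L]"
  have nth: "?vs ! (i mod L) = w i" for i
    using L w[of "i mod L" i] by simp
  have "cycle_edges ?vs = range (\<lambda>i. {?vs ! (i mod length ?vs), ?vs ! (Suc i mod length ?vs)})"
    using L by (intro cycle_edges_walk) simp
  also have "\<dots> = f" unfolding f(1) using nth by (intro image_cong refl) (simp only: length_map length_upt diff_zero)
  finally have "f = cycle_edges ?vs" ..
  moreover have "distinct ?vs"
    using w by (auto simp: distinct_map inj_on_def)
  ultimately show ?thesis
    unfolding is_face_cycle_def using L f(2) by (intro exI[of _ ?vs]) simp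
qed

lemma walk_star:
  assumes "closed_walk w L f" "v \<in> e" "e \<in> f"
  obtains i where "v = w (Suc i)" "w i \<noteq> w (Suc (Suc i))" "w i \<noteq> w (Suc i)"
    "w (Suc i) \<noteq> w (Suc (Suc i))"
    "{e \<in> f. v \<in> e} = {{v, w i}, {v, w (Suc (Suc i))}}"
proof -
  have L: "L \<ge> 3" and f: "f = range (\<lambda>i. {w i, w (Suc i)})"
    and w: "\<And>i j. w i = w j \<longleftrightarrow> i mod L = j mod L"
    using assms by (auto simp: closed_walk_def)
  have *: "Suc i mod L = Suc j mod L \<longleftrightarrow> i mod L = j mod L" for i j
    using L by (simp add: nat_mod_eq_iff)
  obtain i where v: "v = w (Suc i)"
  proof -
    obtain j where "e = {w j, w (Suc j)}" using assms(3) f by blast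
    with assms(2) have "v = w j \<or> v = w (Suc j)" by simp
    \<comment> \<open>Index 0 has no predecessor, so the index is first increased by one full
      period.\<close>
    moreover have "w j = w (Suc (j + (L - 1)))" using L w by simp
    ultimately show ?thesis using that by metis
  qed
  have ne1: "w i \<noteq> w (Suc i)" for i
  proof
    assume "w i = w (Suc i)"
    then have "i mod L = (i + 1) mod L" using w by simp
    then have "L dvd 1" by (metis add_diff_cancel_left' le_add1 mod_eq_dvd_iff_nat)
    then show False using L by simp
  qed
  have ne2: "w i \<noteq> w (Suc (Suc i))"
  proof
    assume "w i = w (Suc (Suc i))"
    then have "i mod L = (i + 2) mod L" using w by simp
    then have "L dvd 2" by (metis add_diff_cancel_left' le_add1 mod_eq_dvd_iff_nat)
    then show False using L by (auto dest: dvd_imp_le)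
  qed
  have "{e \<in> f. v \<in> e} = {{v, w i}, {v, w (Suc (Suc i))}}" (is "?A = ?B")
  proof
    show "?B \<subseteq> ?A" using f v by auto
    show "?A \<subseteq> ?B"
    proof
      fix e' assume "e' \<in> ?A"
      then obtain j where j: "e' = {w j, w (Suc j)}" "v \<in> e'" using f by blast
      then have "w (Suc i) = w j \<or> w (Suc i) = w (Suc j)" using v by simp
      then show "e' \<in> ?B"
      proof
        assume e: "w (Suc i) = w j"
        then have "w (Suc (Suc i)) = w (Suc j)" using w * by metis
        then show ?thesis using e j v by auto
      next
        assume e: "w (Suc i) = w (Suc j)"
        then have "w i = w j" using w * by metis
        then show ?thesis using e j v by auto
      qed
    qed
  qed
  then show ?thesis using that v ne1 ne2 by blast
qed

lemma face_star:
  assumes "is_face_cycle E f" "v \<in> e" "e \<in> f"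
  obtains a b where "a \<noteq> b" "a \<noteq> v" "b \<noteq> v" "{e \<in> f. v \<in> e} = {{v, a}, {v, b}}"
proof -
  obtain w L where "closed_walk w L f" using face_cycle_walk[OF assms(1)] .
  then show ?thesis using assms(2,3)
    by (rule walk_star) (rule that, simp_all)
qed

text \<open>Induction along a cycle: its edges form one chain in which consecutive edges share a
  vertex.\<close>

lemma face_connected:
  assumes "is_face_cycle E f" "e \<in> f" "e \<in> g"
    and step: "\<And>v e e'. e \<in> g \<Longrightarrow> e \<in> f \<Longrightarrow> e' \<in> f \<Longrightarrow> v \<in> e \<Longrightarrow> v \<in> e' \<Longrightarrow> e \<noteq> e' \<Longrightarrow> e' \<in> g"
  shows "f \<subseteq> g"
proof -
  obtain w L where "closed_walk w L f" using face_cycle_walk[OF assms(1)] .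
  then have w: "L \<ge> 3" "f = range (\<lambda>i. {w i, w (Suc i)})"
    "\<And>i j. w i = w j \<longleftrightarrow> i mod L = j mod L"
    by (auto simp: closed_walk_def)
  obtain j where j: "e = {w j, w (Suc j)}" using assms(2) w(2) by blast
  have up: "{w (j + k), w (Suc (j + k))} \<in> g" for k
  proof (induction k)
    case 0 then show ?case using j assms(3) by simp
  next
    case (Suc k)
    let ?e = "{w (j + k), w (Suc (j + k))}" and ?e' = "{w (Suc (j + k)), w (Suc (Suc (j + k)))}"
    have "?e \<in> f" "?e' \<in> f" unfolding w(2) by blast+
    then have "?e' \<in> g"
      by (cases "?e = ?e'") (use Suc step[of ?e ?e' "w (Suc (j + k))"] in auto)
    then show ?case by simp
  qed
  show ?thesis
  proof
    fix e' assume "e' \<in> f"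
    then obtain i where i: "e' = {w i, w (Suc i)}" using w(2) by blast
    \<comment> \<open>The induction moves only forwards from j. This many steps end at i + j * L,
      which is i up to full periods.\<close>
    let ?k = "i + j * (L - 1)"
    have "j + ?k = i + j * L" using w(1) by (cases L) auto
    then have "w (j + ?k) = w i" "w (Suc (j + ?k)) = w (Suc i)"
      unfolding w(3) by (simp_all only: add_Suc[symmetric] mod_mult_self1)
    then show "e' \<in> g" using up[of ?k] i by simp
  qed
qed

context rose_window
begin

section \<open>Matchings at a vertex and automorphisms\<close>

text \<open>Each nonzero j is a perfect matching of the four neighbours of v: (False, True) pairs
  neighbours on the same level, (True, False) and (True, True) pair upper with lower ones.\<close>

definition S :: "kind \<Rightarrow> vertex \<Rightarrow> vertex \<Rightarrow> vertex \<Rightarrow> bool" where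
  "S j v a b \<longleftrightarrow> (\<exists>D l. a = nbr v D l \<and> b = nbr v (D \<noteq> fst j) (l \<noteq> snd j))"

lemma S_sym: "S j v a b \<Longrightarrow> S j v b a"
proof -
  assume "S j v a b"
  then obtain D l where "a = nbr v D l" "b = nbr v (D \<noteq> fst j) (l \<noteq> snd j)" unfolding S_def by blast
  then have "b = nbr v (D \<noteq> fst j) (l \<noteq> snd j) \<and>
    a = nbr v ((D \<noteq> fst j) \<noteq> fst j) ((l \<noteq> snd j) \<noteq> snd j)" by (cases "fst j"; cases "snd j") auto
  then show ?thesis unfolding S_def by blast
qed

lemma S_nbr: "v \<in> V \<Longrightarrow> S j v (nbr v D l) b \<longleftrightarrow> b = nbr v (D \<noteq> fst j) (l \<noteq> snd j)"
  by (auto simp: S_def nbr_eq_iff)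

lemma S_ex: "\<exists>b. S j v (nbr v D l) b"
  unfolding S_def by blast

lemma S_unique: "v \<in> V \<Longrightarrow> S j v a b \<Longrightarrow> S j v a b' \<Longrightarrow> b = b'"
  by (auto simp: S_def nbr_eq_iff)

lemma S_type_unique: "v \<in> V \<Longrightarrow> S j v a b \<Longrightarrow> S j' v a b \<Longrightarrow> j = j'"
  by (cases j; cases j') (auto simp: S_def nbr_eq_iff)

lemma S_nbr_nbr: "v \<in> V \<Longrightarrow> S j v (nbr v D l) (nbr v D' l') \<longleftrightarrow> j = (D \<noteq> D', l \<noteq> l')"
  by (cases j) (auto simp: S_nbr nbr_eq_iff)

lemma S_irrefl: "v \<in> V \<Longrightarrow> S j v a a \<Longrightarrow> j = (False, False)"
  by (cases j) (auto simp: S_def nbr_eq_iff)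

lemma edge_iff: "{v, w} \<in> E \<longleftrightarrow> v \<in> V \<and> (\<exists>D l. w = nbr v D l)"
proof
  assume "{v, w} \<in> E"
  then obtain u D l where u: "u \<in> V" "{v, w} = {u, nbr u D l}" unfolding E_eq by blast
  show "v \<in> V \<and> (\<exists>D l. w = nbr v D l)"
    using u nbr_back[OF u(1), of D l] by (metis doubleton_eq_iff nbr_in)
next
  assume "v \<in> V \<and> (\<exists>D l. w = nbr v D l)"
  then show "{v, w} \<in> E" unfolding E_eq by blast
qed

lemma S_edges: "v \<in> V \<Longrightarrow> S j v a b \<Longrightarrow> {v, a} \<in> E \<and> {v, b} \<in> E"
  by (auto simp: S_def edge_iff)

lemma nbr_neq: "v \<in> V \<Longrightarrow> nbr v D l \<noteq> v"
proof
  assume v: "v \<in> V" "nbr v D l = v"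
  have "lev v = lev v mod (3 * int m)" by (simp add: lev_def)
  then have "3 * int m dvd (if D then 1 else -1)"
    using lev_nbr[OF v(1), of D l] v(2)
    by (metis add_diff_cancel_left' mod_eq_dvd_iff dvd_minus_iff minus_diff_eq)
  then show False using m_pos by (auto split: if_splits dest: zdvd_imp_le)
qed

lemma E_cases:
  assumes "e \<in> E" "v \<in> e"
  obtains D l where "v \<in> V" "e = {v, nbr v D l}"
proof -
  obtain u D l where u: "u \<in> V" "e = {u, nbr u D l}" using assms(1) unfolding E_eq by blast
  show ?thesis
  proof (cases "v = u")
    case True then show ?thesis using that u by blast
  next
    case False
    then have v: "v = nbr u D l" using u(2) assms(2) by simp
    obtain l' where "nbr v (\<not> D) l' = u" using nbr_back[OF u(1), of D l] v by metis
    then show ?thesis using that[of "\<not> D" l'] u(2) v by (simp add: insert_commute)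
  qed
qed

lemma edge_nbr: "v \<in> V \<Longrightarrow> {v, nbr v D l} \<in> E"
  unfolding E_eq by blast

lemma edge_01: "{X 0, X 1} \<in> E"
  using edge_nbr[OF X_in, of 0 True False] by (simp add: nbr_simps)

lemma star_eq:
  assumes v: "v \<in> V"
  shows "{e \<in> E. v \<in> e} = range (\<lambda>(D, l). {v, nbr v D l})"
proof
  show "{e \<in> E. v \<in> e} \<subseteq> range (\<lambda>(D, l). {v, nbr v D l})"
  proof clarify
    fix e assume "e \<in> E" "v \<in> e"
    then obtain D l where "e = {v, nbr v D l}" by (rule E_cases)
    then have "e = (\<lambda>(D, l). {v, nbr v D l}) (D, l)" by simp
    then show "e \<in> range (\<lambda>(D, l). {v, nbr v D l})" by blast
  qed
qed (use edge_nbr[OF v] in auto)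

lemma nbr_edge_eq_iff: "v \<in> V \<Longrightarrow> {v, nbr v D l} = {v, nbr v D' l'} \<longleftrightarrow> D = D' \<and> l = l'"
  by (metis doubleton_eq_iff nbr_eq_iff)

lemma simple_V_E: "simple_graph V E"
  unfolding simple_graph_def
proof (intro conjI finite_V)
  show "V \<noteq> {}" using X_in by blast
  show "E \<subseteq> {{u, w} |u w. u \<in> V \<and> w \<in> V \<and> u \<noteq> w}"
    unfolding E_eq using nbr_neq nbr_in by blast
qed

text \<open>Upper neighbours with flag \<open>False\<close> run through all x, and each y is an
  upper neighbour of an x. Indices are reduced modulo n so that the inner induction can be on
  naturals.\<close>

lemma connected_induct:
  assumes "P (X 0)" and "\<And>v D l. v \<in> V \<Longrightarrow> P v \<Longrightarrow> P (nbr v D l)" and "v \<in> V"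
  shows "P v"
proof -
  have x: "P (X k)" for k
  proof -
    have "P (X (int i))" for i
    proof (induction i)
      case (Suc i)
      show ?case using assms(2)[of "X (int i)" True False] Suc by (simp add: nbr_simps add.commute)
    qed (use assms in simp)
    moreover have "X k = X (int (nat (k mod n)))" using n_pos by simp
    ultimately show ?thesis by metis
  qed
  have "P (Y k)" for k
    using assms(2)[of "X k" True True] x by (simp add: nbr_simps)
  then show ?thesis using x assms(3) by (elim V_cases) auto
qed

lemma connected_V_E: "connected_graph V E"
proof -
  let ?r = "(\<lambda>a b. {a, b} \<in> E)\<^sup>*\<^sup>*"
  have 0: "?r (X 0) v" if "v \<in> V" for v
  proof (rule connected_induct[of "?r (X 0)", OF _ _ that])
    fix u D l assume u: "u \<in> V" "?r (X 0) u"
    have "{u, nbr u D l} \<in> E" using u(1) unfolding E_eq by blast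
    with u(2) show "?r (X 0) (nbr u D l)" by (rule rtranclp.rtrancl_into_rtrancl)
  qed simp
  have sym: "symp ?r" by (rule symp_rtranclp) (simp add: symp_def insert_commute)
  show ?thesis
    unfolding connected_graph_def
    by (intro ballI rtranclp_trans[OF sympD[OF sym 0] 0])
qed

text \<open>The shear of the Klein four-group that fixes the flat matching
  \<open>(False, True)\<close> and, if k holds, exchanges the two monotone ones; it is the linear
  part of an automorphism.\<close>

definition twist :: "bool \<Rightarrow> kind \<Rightarrow> kind" where
  "twist k j = (fst j, snd j \<noteq> (k \<and> fst j))"

text \<open>k records whether the two monotone matchings are interchanged.\<close>

definition T :: "bool \<Rightarrow> (vertex \<Rightarrow> vertex) \<Rightarrow> bool" where
  "T k \<sigma> \<longleftrightarrow> bij_betw \<sigma> V V \<and>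
     (\<forall>v\<in>V. \<exists>s1 s2. \<forall>D l. \<sigma> (nbr v D l) = nbr (\<sigma> v) (D \<noteq> s1) (l \<noteq> (s2 \<noteq> (k \<and> D))))"

lemma TD:
  assumes "T k \<sigma>" "v \<in> V"
  obtains s1 s2 where "\<And>D l. \<sigma> (nbr v D l) = nbr (\<sigma> v) (D \<noteq> s1) (l \<noteq> (s2 \<noteq> (k \<and> D)))"
  using assms unfolding T_def by blast

lemma T_bij: "T k \<sigma> \<Longrightarrow> bij_betw \<sigma> V V"
  by (simp add: T_def)

lemma T_in: "T k \<sigma> \<Longrightarrow> v \<in> V \<Longrightarrow> \<sigma> v \<in> V"
  using T_bij bij_betwE by blast

text \<open>These shears form a group of order two, so the parameters add modulo 2.\<close>

lemma T_comp:
  assumes "T k \<sigma>" "T k' \<tau>"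
  shows "T (k \<noteq> k') (\<tau> \<circ> \<sigma>)"
  unfolding T_def
proof (intro conjI ballI)
  show "bij_betw (\<tau> \<circ> \<sigma>) V V" using assms T_bij bij_betw_trans by blast
  fix v assume v: "v \<in> V"
  obtain s1 s2 where s: "\<And>D l. \<sigma> (nbr v D l) = nbr (\<sigma> v) (D \<noteq> s1) (l \<noteq> (s2 \<noteq> (k \<and> D)))"
    using TD[OF assms(1) v] by blast
  obtain r1 r2 where r: "\<And>D l. \<tau> (nbr (\<sigma> v) D l) = nbr (\<tau> (\<sigma> v)) (D \<noteq> r1) (l \<noteq> (r2 \<noteq> (k' \<and> D)))"
    using TD[OF assms(2) T_in[OF assms(1) v]] by blast
  show "\<exists>s1 s2. \<forall>D l. (\<tau> \<circ> \<sigma>) (nbr v D l) =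
      nbr ((\<tau> \<circ> \<sigma>) v) (D \<noteq> s1) (l \<noteq> (s2 \<noteq> ((k \<noteq> k') \<and> D)))"
    \<comment> \<open>The second map sees the first flag already shifted by \<open>s1\<close>, so
      its shear contributes the constant \<open>k' \<and> s1\<close>.\<close>
    by (rule exI[of _ "s1 \<noteq> r1"], rule exI[of _ "s2 \<noteq> (r2 \<noteq> (k' \<and> s1))"])
      (simp add: s r, intro allI arg_cong2[of _ _ _ _ "nbr _"], blast+)
qed

lemma T_inv:
  assumes "T k \<sigma>"
  shows "T k (inv_into V \<sigma>)"
  unfolding T_def
proof (intro conjI ballI)
  let ?\<tau> = "inv_into V \<sigma>"
  note bij = T_bij[OF assms]
  show "bij_betw ?\<tau> V V" using bij by (rule bij_betw_inv_into)
  fix v assume "v \<in> V"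
  then obtain u where u: "u \<in> V" "\<sigma> u = v" using bij by (metis bij_betw_iff_bijections)
  then have uv: "?\<tau> v = u" using bij by (metis bij_betw_inv_into_left)
  obtain s1 s2 where s: "\<And>D l. \<sigma> (nbr u D l) = nbr v (D \<noteq> s1) (l \<noteq> (s2 \<noteq> (k \<and> D)))"
    using TD[OF assms u(1)] u(2) by blast
  \<comment> \<open>Solving the affine equation for the flags of the preimage puts the shear of
    \<open>s1\<close> into the constant.\<close>
  have "?\<tau> (nbr v D l) = nbr u (D \<noteq> s1) (l \<noteq> ((s2 \<noteq> (k \<and> s1)) \<noteq> (k \<and> D)))" for D l
  proof -
    have "\<sigma> (nbr u (D \<noteq> s1) (l \<noteq> ((s2 \<noteq> (k \<and> s1)) \<noteq> (k \<and> D)))) = nbr v D l"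
      unfolding s by (intro arg_cong2[of _ _ _ _ "nbr _"]) blast+
    then show ?thesis using bij by (metis bij_betw_inv_into_left nbr_in)
  qed
  then show "\<exists>s1 s2. \<forall>D l. ?\<tau> (nbr v D l) = nbr (?\<tau> v) (D \<noteq> s1) (l \<noteq> (s2 \<noteq> (k \<and> D)))"
    unfolding uv by blast
qed

lemma T_S:
  assumes "T k \<sigma>" "v \<in> V" "S j v a b"
  shows "S (twist k j) (\<sigma> v) (\<sigma> a) (\<sigma> b)"
proof -
  obtain s1 s2 where s: "\<And>D l. \<sigma> (nbr v D l) = nbr (\<sigma> v) (D \<noteq> s1) (l \<noteq> (s2 \<noteq> (k \<and> D)))"
    using TD[OF assms(1,2)] by blast
  obtain D l where "a = nbr v D l" "b = nbr v (D \<noteq> fst j) (l \<noteq> snd j)" using assms(3) unfolding S_def by blast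
  then show ?thesis
    using S_nbr_nbr[OF T_in[OF assms(1,2)]] by (auto simp: s twist_def)
qed

lemma T_graph_aut:
  assumes "T k \<sigma>"
  shows "graph_aut V E \<sigma>"
proof -
  have sub: "(\<lambda>e. \<tau> ` e) ` E \<subseteq> E" if \<tau>: "T k \<tau>" for \<tau>
  proof clarify
    fix e assume "e \<in> E"
    then obtain v D l where e: "v \<in> V" "e = {v, nbr v D l}" unfolding E_eq by blast
    obtain s1 s2 where "\<And>D l. \<tau> (nbr v D l) = nbr (\<tau> v) (D \<noteq> s1) (l \<noteq> (s2 \<noteq> (k \<and> D)))"
      using TD[OF \<tau> e(1)] by blast
    then have "\<tau> ` e = {\<tau> v, nbr (\<tau> v) (D \<noteq> s1) (l \<noteq> (s2 \<noteq> (k \<and> D)))}"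
      unfolding e(2) by simp
    then show "\<tau> ` e \<in> E" using T_in[OF \<tau> e(1)] unfolding E_eq by blast
  qed
  have "e \<in> (\<lambda>e. \<sigma> ` e) ` E" if e: "e \<in> E" for e
  proof -
    let ?\<tau> = "inv_into V \<sigma>"
    have "e \<subseteq> V" using e unfolding E_eq by auto
    then have "\<sigma> ` ?\<tau> ` e = e"
      using T_bij[OF assms] by (force simp: image_image bij_betw_inv_into_right subset_iff)
    moreover have "?\<tau> ` e \<in> E" using sub[OF T_inv[OF assms]] e by blast
    ultimately show ?thesis by (metis imageI)
  qed
  then show ?thesis unfolding graph_aut_def using T_bij[OF assms] sub[OF assms] by blast
qed


section \<open>Families of faces\<close>

text \<open>A choice c of a matching at every vertex determines the faces of Fam c: an edge of a face
  continues, at each of its ends, to the edge matched with it there.\<close>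

definition link :: "(vertex \<Rightarrow> kind) \<Rightarrow> vertex set \<Rightarrow> vertex set \<Rightarrow> bool" where
  "link c e e' \<longleftrightarrow> (\<exists>v a b. v \<in> V \<and> S (c v) v a b \<and> e = {v, a} \<and> e' = {v, b})"

definition comp :: "(vertex \<Rightarrow> kind) \<Rightarrow> vertex set \<Rightarrow> vertex set set" where
  "comp c e = {e'. (link c)\<^sup>*\<^sup>* e e'}"

definition Fam :: "(vertex \<Rightarrow> kind) \<Rightarrow> vertex set set set" where
  "Fam c = comp c ` E"

definition pres :: "bool \<Rightarrow> (vertex \<Rightarrow> vertex) \<Rightarrow> (vertex \<Rightarrow> kind) \<Rightarrow>
    (vertex \<Rightarrow> kind) \<Rightarrow> bool" where
  "pres k \<sigma> c c' \<longleftrightarrow> T k \<sigma> \<and> (\<forall>v\<in>V. c' (\<sigma> v) = twist k (c v))"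

lemma twist_tw [simp]: "twist k (twist k j) = j"
  by (cases j) (auto simp: twist_def)

lemma link_sym: "link c e e' \<Longrightarrow> link c e' e"
  unfolding link_def using S_sym by blast

lemma link_edge: "link c e e' \<Longrightarrow> e' \<in> E"
  unfolding link_def using S_edges by blast

lemma comp_refl [simp]: "e \<in> comp c e"
  by (simp add: comp_def)

lemma comp_subset: "e \<in> E \<Longrightarrow> comp c e \<subseteq> E"
proof
  fix x assume e: "e \<in> E" "x \<in> comp c e"
  from e(2) have "(link c)\<^sup>*\<^sup>* e x" by (simp add: comp_def)
  then show "x \<in> E" by (induction rule: rtranclp_induct) (use e link_edge in auto)
qed

lemma comp_eq:
  assumes "e' \<in> comp c e"
  shows "comp c e' = comp c e"
proof -
  have sym: "symp (link c)\<^sup>*\<^sup>*" by (rule symp_rtranclp) (auto simp: symp_def intro: link_sym)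
  have 1: "(link c)\<^sup>*\<^sup>* e e'" using assms by (simp add: comp_def)
  have 2: "(link c)\<^sup>*\<^sup>* e' e" using sympD[OF sym 1] .
  show ?thesis
    using rtranclp_trans[OF 1] rtranclp_trans[OF 2] by (auto simp: comp_def)
qed

lemma comp_step:
  assumes "{v, a} \<in> comp c e" "v \<in> V" "S (c v) v a b"
  shows "{v, b} \<in> comp c e"
proof -
  have "link c {v, a} {v, b}" unfolding link_def using assms by blast
  then show ?thesis using assms(1) unfolding comp_def
    by (auto intro: rtranclp.rtrancl_into_rtrancl)
qed

lemma pres_inv:
  assumes "pres k \<sigma> c c'"
  shows "pres k (inv_into V \<sigma>) c' c"
  unfolding pres_def
proof (intro conjI ballI)
  have T: "T k \<sigma>" and c: "\<And>v. v \<in> V \<Longrightarrow> c' (\<sigma> v) = twist k (c v)" using assms by (auto simp: pres_def)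
  show "T k (inv_into V \<sigma>)" using T_inv[OF T] .
  fix v assume v: "v \<in> V"
  have "inv_into V \<sigma> v \<in> V" using T_in[OF T_inv[OF T] v] .
  moreover have "\<sigma> (inv_into V \<sigma> v) = v" using T_bij[OF T] v by (simp add: bij_betw_inv_into_right)
  ultimately have "c' v = twist k (c (inv_into V \<sigma> v))" using c[of "inv_into V \<sigma> v"] by simp
  then show "c (inv_into V \<sigma> v) = twist k (c' v)" by simp
qed

lemma pres_comp:
  assumes "pres k \<sigma> c c'" "pres k' \<tau> c' c''"
  shows "pres (k \<noteq> k') (\<tau> \<circ> \<sigma>) c c''"
  using assms T_comp T_in unfolding pres_def by (auto simp: twist_def)

lemma pres_link:
  assumes "pres k \<sigma> c c'" "link c e e'"
  shows "link c' (\<sigma> ` e) (\<sigma> ` e')"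
proof -
  have T: "T k \<sigma>" and c: "\<And>v. v \<in> V \<Longrightarrow> c' (\<sigma> v) = twist k (c v)" using assms by (auto simp: pres_def)
  obtain v a b where v: "v \<in> V" "S (c v) v a b" "e = {v, a}" "e' = {v, b}"
    using assms(2) unfolding link_def by blast
  show ?thesis unfolding link_def
    by (rule exI[of _ "\<sigma> v"], rule exI[of _ "\<sigma> a"], rule exI[of _ "\<sigma> b"])
      (use T_in[OF T v(1)] T_S[OF T v(1,2)] c[OF v(1)] v in simp)
qed

lemma pres_comp_subset:
  assumes "pres k \<sigma> c c'" "x \<in> comp c e"
  shows "\<sigma> ` x \<in> comp c' (\<sigma> ` e)"
proof -
  have "(link c)\<^sup>*\<^sup>* e x" using assms(2) by (simp add: comp_def)
  then have "(link c')\<^sup>*\<^sup>* (\<sigma> ` e) (\<sigma> ` x)"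
    by (induction rule: rtranclp_induct)
      (auto intro: rtranclp.rtrancl_into_rtrancl pres_link[OF assms(1)])
  then show ?thesis by (simp add: comp_def)
qed

lemma edge_subset: "e \<in> E \<Longrightarrow> e \<subseteq> V"
  unfolding E_eq by auto

lemma image_inv:
  assumes "T k \<sigma>" "e \<subseteq> V"
  shows "\<sigma> ` inv_into V \<sigma> ` e = e" "inv_into V \<sigma> ` \<sigma> ` e = e"
proof -
  note b = T_bij[OF assms(1)]
  show "\<sigma> ` inv_into V \<sigma> ` e = e"
    using bij_betw_inv_into_right[OF b] assms(2) by (force simp: image_image subset_iff)
  show "inv_into V \<sigma> ` \<sigma> ` e = e"
    using bij_betw_inv_into_left[OF b] assms(2) by (force simp: image_image subset_iff)
qed

lemma T_edge: "T k \<sigma> \<Longrightarrow> e \<in> E \<Longrightarrow> \<sigma> ` e \<in> E"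
  using T_graph_aut unfolding graph_aut_def by blast

text \<open>One inclusion carries links forward along \<open>\<sigma>\<close>; the other does the
  same with the inverse, which transports the choices back.\<close>

lemma face_img_comp:
  assumes "pres k \<sigma> c c'" "e \<in> E"
  shows "face_img \<sigma> (comp c e) = comp c' (\<sigma> ` e)"
proof
  have T: "T k \<sigma>" using assms by (auto simp: pres_def)
  show "face_img \<sigma> (comp c e) \<subseteq> comp c' (\<sigma> ` e)"
    unfolding face_img_def using pres_comp_subset[OF assms(1)] by blast
  show "comp c' (\<sigma> ` e) \<subseteq> face_img \<sigma> (comp c e)"
  proof
    fix x assume x: "x \<in> comp c' (\<sigma> ` e)"
    then have "x \<in> E" using comp_subset T_edge[OF T assms(2)] by blast
    then have "x = \<sigma> ` inv_into V \<sigma> ` x" using image_inv(1)[OF T] edge_subset by simp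
    moreover have "inv_into V \<sigma> ` x \<in> comp c e"
      using pres_comp_subset[OF pres_inv[OF assms(1)] x] image_inv(2)[OF T] edge_subset[OF assms(2)]
      by simp
    ultimately show "x \<in> face_img \<sigma> (comp c e)" unfolding face_img_def by blast
  qed
qed

lemma T_image_E: "T k \<sigma> \<Longrightarrow> (`) \<sigma> ` E = E"
  using T_graph_aut unfolding graph_aut_def by blast

lemma face_img_Fam:
  assumes "pres k \<sigma> c c'"
  shows "face_img \<sigma> ` Fam c = Fam c'"
proof -
  have "face_img \<sigma> ` Fam c = (\<lambda>e. comp c' (\<sigma> ` e)) ` E"
    unfolding Fam_def image_image using face_img_comp[OF assms] by (intro image_cong) auto
  also have "\<dots> = comp c' ` ((`) \<sigma> ` E)" by (simp add: image_image)
  also have "\<dots> = Fam c'" using T_image_E[of k \<sigma>] assms by (simp add: pres_def Fam_def)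
  finally show ?thesis .
qed

section \<open>Choices whose walks are cycles, and the maps they form\<close>

definition valid :: "(vertex \<Rightarrow> kind) \<Rightarrow> bool" where
  "valid c \<longleftrightarrow> (\<forall>v\<in>V. c v \<noteq> (False, False))"

definition cyclic :: "(vertex \<Rightarrow> kind) \<Rightarrow> bool" where
  "cyclic c \<longleftrightarrow> valid c \<and> (\<forall>e\<in>E. is_face_cycle E (comp c e))"

lemma is_face_cycle_img:
  assumes "T k \<sigma>" "is_face_cycle E f"
  shows "is_face_cycle E (face_img \<sigma> f)"
proof -
  obtain w L where w: "closed_walk w L f" using face_cycle_walk[OF assms(2)] .
  have f: "f \<subseteq> E" using assms(2) by (auto simp: is_face_cycle_def)
  have range: "w i \<in> V" for i
    using w f edge_subset unfolding closed_walk_def by blast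
  have inj: "inj_on \<sigma> V" using T_bij[OF assms(1)] by (simp add: bij_betw_def)
  show ?thesis
  proof (rule face_cycleI)
    have "\<sigma> (w i) = \<sigma> (w j) \<longleftrightarrow> w i = w j" for i j
      using inj range by (auto simp: inj_on_def)
    then show "closed_walk (\<sigma> \<circ> w) L (face_img \<sigma> f)"
      using w unfolding closed_walk_def by (simp add: face_img_def image_image)
    show "face_img \<sigma> f \<subseteq> E" using f T_edge[OF assms(1)] by (auto simp: face_img_def)
  qed
qed

text \<open>A cycle has just two edges at a vertex, and the given edge and its partner are two
  different ones.\<close>

lemma comp_corner:
  assumes "cyclic c" "v \<in> V"
  shows "{e \<in> comp c {v, nbr v D l}. v \<in> e} =
    {{v, nbr v D l}, {v, nbr v (D \<noteq> fst (c v)) (l \<noteq> snd (c v))}}"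
proof -
  let ?e = "{v, nbr v D l}" and ?e' = "{v, nbr v (D \<noteq> fst (c v)) (l \<noteq> snd (c v))}"
  have e: "?e \<in> E" using assms(2) unfolding E_eq by blast
  then have f: "is_face_cycle E (comp c ?e)" using assms(1) by (simp add: cyclic_def)
  obtain a b where ab: "{x \<in> comp c ?e. v \<in> x} = {{v, a}, {v, b}}"
    by (rule face_star[OF f, of v ?e]) simp_all
  have "?e' \<in> comp c ?e"
    by (rule comp_step[OF comp_refl assms(2)]) (use S_nbr[OF assms(2)] in simp)
  then have mem: "?e \<in> {x \<in> comp c ?e. v \<in> x}" "?e' \<in> {x \<in> comp c ?e. v \<in> x}"
    by simp_all
  \<comment> \<open>Validity enters here: \<open>(False, False)\<close> is the identity element,
    which would pair an edge with itself.\<close>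
  have ne: "?e \<noteq> ?e'"
  proof
    assume "?e = ?e'"
    then have "\<not> fst (c v)" "\<not> snd (c v)" unfolding nbr_edge_eq_iff[OF assms(2)] by auto
    then have "c v = (False, False)" by (simp add: prod_eq_iff)
    then show False using assms unfolding cyclic_def valid_def by blast
  qed
  have "A = {p, q}" if "A = {x, y}" "p \<in> A" "q \<in> A" "p \<noteq> q" for A :: "vertex set set" and p q x y
    using that by auto
  from this[OF ab mem ne] show ?thesis .
qed

lemma corner_type:
  assumes "cyclic c" "e \<in> E" "{v, a} \<in> comp c e" "{v, b} \<in> comp c e" "a \<noteq> b"
  shows "v \<in> V \<and> S (c v) v a b"
proof -
  have "{v, a} \<in> E" using assms comp_subset by blast
  then obtain D l where v: "v \<in> V" "a = nbr v D l" using edge_iff by blast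
  have "comp c {v, a} = comp c e" using comp_eq[OF assms(3)] .
  then have "{v, b} \<in> {x \<in> comp c {v, nbr v D l}. v \<in> x}" using assms(4) v by simp
  then have "{v, b} = {v, nbr v D l} \<or> {v, b} = {v, nbr v (D \<noteq> fst (c v)) (l \<noteq> snd (c v))}"
    unfolding comp_corner[OF assms(1) v(1)] by blast
  then have "b = nbr v (D \<noteq> fst (c v)) (l \<noteq> snd (c v))"
    using assms(5) v(2) nbr_neq[OF v(1)] by (auto simp: doubleton_eq_iff)
  then show ?thesis using v S_nbr by simp
qed

text \<open>One corner of a common face would have to obey both matchings at its vertex.\<close>

lemma comp_neq:
  assumes "cyclic c1" "cyclic c2" "\<And>v. v \<in> V \<Longrightarrow> c1 v \<noteq> c2 v" "e1 \<in> E" "e2 \<in> E"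
  shows "comp c1 e1 \<noteq> comp c2 e2"
proof
  assume eq: "comp c1 e1 = comp c2 e2"
  obtain v D l where v: "v \<in> V" "e1 = {v, nbr v D l}" using assms(4) unfolding E_eq by blast
  let ?a = "nbr v D l" and ?b = "nbr v (D \<noteq> fst (c1 v)) (l \<noteq> snd (c1 v))"
  have s: "S (c1 v) v ?a ?b" using S_nbr[OF v(1)] by simp
  have "?a \<noteq> ?b" using assms(1) v(1) S_irrefl[OF v(1)] s unfolding cyclic_def valid_def by metis
  moreover have "{v, ?a} \<in> comp c1 e1" using v(2) by simp
  moreover have "{v, ?b} \<in> comp c1 e1" using comp_step[OF \<open>{v, ?a} \<in> comp c1 e1\<close> v(1) s] .
  ultimately have "S (c2 v) v ?a ?b" using corner_type[OF assms(2,5)] eq by simp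
  then show False using S_type_unique[OF v(1) s] assms(3) v(1) by blast
qed

text \<open>Each edge lies in one face of either family, and these are never equal. At a vertex,
  applying the two matchings alternately runs through all four edges in one cycle, because two
  different nonzero elements generate the Klein four-group; this gives the disc.\<close>

lemma polytopal_Fam:
  assumes "cyclic c1" "cyclic c2" "\<And>v. v \<in> V \<Longrightarrow> c1 v \<noteq> c2 v"
  shows "polytopal_map V E (Fam c1 \<union> Fam c2)"
  unfolding polytopal_map_def
proof (intro conjI ballI simple_V_E connected_V_E)
  show "is_face_cycle E f" if "f \<in> Fam c1 \<union> Fam c2" for f
    using that assms(1,2) unfolding Fam_def cyclic_def by auto
  have at: "{f \<in> Fam c. e \<in> f} = {comp c e}" if "e \<in> E" for c e
    using that comp_eq unfolding Fam_def by auto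
  show "card {f \<in> Fam c1 \<union> Fam c2. e \<in> f} = 2" if "e \<in> E" for e
  proof -
    have "{f \<in> Fam c1 \<union> Fam c2. e \<in> f} = {f \<in> Fam c1. e \<in> f} \<union> {f \<in> Fam c2. e \<in> f}" by blast
    also have "\<dots> = {comp c1 e, comp c2 e}" unfolding at[OF that] by blast
    finally show ?thesis using comp_neq[OF assms that that] by simp
  qed
  fix v assume v: "v \<in> V"
  obtain p1 q1 where c1: "c1 v = (p1, q1)" by fastforce
  obtain p2 q2 where c2: "c2 v = (p2, q2)" by fastforce
  have pq: "p1 \<or> q1" "p2 \<or> q2" "p1 \<noteq> p2 \<or> q1 \<noteq> q2"
  proof -
    have "c1 v \<noteq> (False, False)" "c2 v \<noteq> (False, False)" "c1 v \<noteq> c2 v"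
      using assms v unfolding cyclic_def valid_def by blast+
    then show "p1 \<or> q1" "p2 \<or> q2" "p1 \<noteq> p2 \<or> q1 \<noteq> q2" unfolding c1 c2 by blast+
  qed
  define ed where "ed D l = {v, nbr v D l}" for D l
  have ed_eq: "ed D l = ed D' l' \<longleftrightarrow> D = D' \<and> l = l'" for D l D' l'
    unfolding ed_def using nbr_edge_eq_iff[OF v] .
  have edE: "ed D l \<in> E" for D l unfolding ed_def E_eq using v by blast
  have star: "{e \<in> E. v \<in> e} = range (\<lambda>(D, l). ed D l)"
    unfolding ed_def by (rule star_eq[OF v])
  have cor1: "{e \<in> comp c1 (ed D l). v \<in> e} = {ed D l, ed (D \<noteq> p1) (l \<noteq> q1)}" for D l
    using comp_corner[OF assms(1) v, of D l] c1 by (simp add: ed_def)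
  have cor2: "{e \<in> comp c2 (ed D l). v \<in> e} = {ed D l, ed (D \<noteq> p2) (l \<noteq> q2)}" for D l
    using comp_corner[OF assms(2) v, of D l] c2 by (simp add: ed_def)
  \<comment> \<open>Translation by \<open>c1 v\<close>, \<open>c2 v\<close>, \<open>c1 v\<close>,
    \<open>c2 v\<close> in turn visits these four edges and returns to the start.\<close>
  let ?e0 = "ed False False" and ?e1 = "ed p1 q1" and ?e2 = "ed (p1 \<noteq> p2) (q1 \<noteq> q2)"
    and ?e3 = "ed p2 q2"
  have c01: "{e \<in> comp c1 ?e0. v \<in> e} = {?e0, ?e1}" using cor1[of False False] by simp
  have c12: "{e \<in> comp c2 ?e1. v \<in> e} = {?e1, ?e2}" using cor2[of p1 q1] by simp
  have c23: "{e \<in> comp c1 ?e2. v \<in> e} = {?e2, ?e3}" using cor1[of "p1 \<noteq> p2" "q1 \<noteq> q2"]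
    by (cases p1; cases q1; cases p2; cases q2) simp_all
  have c30: "{e \<in> comp c2 ?e3. v \<in> e} = {?e3, ?e0}" using cor2[of p2 q2] by simp
  have dist: "distinct [?e0, ?e1, ?e2, ?e3]" using pq by (auto simp: ed_eq)
  let ?fs = "[comp c1 ?e0, comp c2 ?e1, comp c1 ?e2, comp c2 ?e3]"
  have mem: "?e0 \<in> comp c1 ?e0" "?e1 \<in> comp c1 ?e0" "?e1 \<in> comp c2 ?e1" "?e2 \<in> comp c2 ?e1"
    "?e2 \<in> comp c1 ?e2" "?e3 \<in> comp c1 ?e2" "?e3 \<in> comp c2 ?e3" "?e0 \<in> comp c2 ?e3"
    using c01 c12 c23 c30 by blast+
  have v_in: "v \<in> ed D l" for D l by (simp add: ed_def)
  \<comment> \<open>Otherwise one face would occur twice in the sequence around v and have more than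
    two edges there.\<close>
  have "?e2 \<notin> comp c1 ?e0"
  proof
    assume "?e2 \<in> comp c1 ?e0"
    then have "?e2 \<in> {e \<in> comp c1 ?e0. v \<in> e}" using v_in by blast
    then show False unfolding c01 using dist by auto
  qed
  moreover have "?e3 \<notin> comp c2 ?e1"
  proof
    assume "?e3 \<in> comp c2 ?e1"
    then have "?e3 \<in> {e \<in> comp c2 ?e1. v \<in> e}" using v_in by blast
    then show False unfolding c12 using dist by auto
  qed
  ultimately have n: "comp c1 ?e0 \<noteq> comp c1 ?e2" "comp c2 ?e1 \<noteq> comp c2 ?e3"
    using mem by metis+
  have UNIV4: "UNIV = {(False, False), (p1, q1), (p1 \<noteq> p2, q1 \<noteq> q2), (p2, q2)}"
    using pq by (cases p1; cases q1; cases p2; cases q2) (auto simp: UNIV_bool)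
  have es: "{?e0, ?e1, ?e2, ?e3} = {e \<in> E. v \<in> e}"
    unfolding star UNIV4 by simp
  have fs: "set ?fs = {f \<in> Fam c1 \<union> Fam c2. \<exists>e\<in>f. v \<in> e}"
  proof
    have "comp c (ed D l) \<in> {f \<in> Fam c1 \<union> Fam c2. \<exists>e\<in>f. v \<in> e}" if "c = c1 \<or> c = c2" for c D l
    proof -
      have "comp c (ed D l) \<in> Fam c" using edE unfolding Fam_def by (rule imageI)
      then have "comp c (ed D l) \<in> Fam c1 \<union> Fam c2" using that by auto
      moreover have "\<exists>e\<in>comp c (ed D l). v \<in> e" using v_in[of D l] comp_refl by (rule bexI)
      ultimately show ?thesis by blast
    qed
    then show "set ?fs \<subseteq> {f \<in> Fam c1 \<union> Fam c2. \<exists>e\<in>f. v \<in> e}" by simp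
    show "{f \<in> Fam c1 \<union> Fam c2. \<exists>e\<in>f. v \<in> e} \<subseteq> set ?fs"
    proof clarify
      fix f e assume f: "f \<in> Fam c1 \<union> Fam c2" "e \<in> f" "v \<in> e"
      obtain c e0 where c: "c = c1 \<or> c = c2" "e0 \<in> E" "f = comp c e0"
        using f(1) unfolding Fam_def by blast
      have "e \<in> E" using comp_subset[OF c(2)] f(2) c(3) by blast
      then have "e \<in> {?e0, ?e1, ?e2, ?e3}" using es f(3) by simp
      then have e: "e = ?e0 \<or> e = ?e1 \<or> e = ?e2 \<or> e = ?e3" by simp
      have "f = comp c e" using f(2) c(3) comp_eq by simp
      moreover have "comp c1 e \<in> set ?fs"
        using e comp_eq[OF mem(2)] comp_eq[OF mem(6)] by (elim disjE) simp_all
      moreover have "comp c2 e \<in> set ?fs"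
        using e comp_eq[OF mem(4)] comp_eq[OF mem(8)] by (elim disjE) simp_all
      ultimately show "f \<in> set ?fs" using c(1) by (elim disjE) simp_all
    qed
  qed
  show "vertex_disc E (Fam c1 \<union> Fam c2) v"
    unfolding vertex_disc_def
  proof (intro exI conjI)
    show "distinct [?e0, ?e1, ?e2, ?e3]" by (rule dist)
    have "comp c1 (ed D l) \<noteq> comp c2 (ed D' l')" for D l D' l'
      using comp_neq[OF assms edE edE] .
    note ne = this
    have "distinct [f0, f1, f2, f3]"
      if "f0 \<noteq> f1" "f2 \<noteq> f1" "f0 \<noteq> f2" "f1 \<noteq> f3" "f0 \<noteq> f3" "f2 \<noteq> f3"
      for f0 f1 f2 f3 :: "vertex set set"
      using that by auto
    from this[OF ne ne n ne ne] show "distinct ?fs" .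
    show "set [?e0, ?e1, ?e2, ?e3] = {e \<in> E. v \<in> e}" using es by simp
    show "set ?fs = {f \<in> Fam c1 \<union> Fam c2. \<exists>e\<in>f. v \<in> e}" by (rule fs)
    show "\<forall>j<length [?e0, ?e1, ?e2, ?e3]. [?e0, ?e1, ?e2, ?e3] ! j \<in> ?fs ! j \<and>
       [?e0, ?e1, ?e2, ?e3] ! (Suc j mod length [?e0, ?e1, ?e2, ?e3]) \<in> ?fs ! j"
      using mem by (simp add: All_less_Suc)
  qed simp
qed

section \<open>Symmetry of a pair of families\<close>

definition arc_transitive :: "(vertex \<Rightarrow> kind) \<Rightarrow> (vertex \<Rightarrow> kind) \<Rightarrow> bool" where
  "arc_transitive c1 c2 \<longleftrightarrow> (\<forall>v\<in>V. \<forall>D l. \<exists>k \<sigma>. pres k \<sigma> c1 c1 \<and> pres k \<sigma> c2 c2 \<and>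
     \<sigma> (X 0) = v \<and> \<sigma> (X 1) = nbr v D l)"

text \<open>Two automorphisms that start at the base arc are combined, the first one
  inverted.\<close>

lemma arc_transitiveD:
  assumes "arc_transitive c1 c2" "v \<in> e" "e \<in> E" "v' \<in> e'" "e' \<in> E"
  obtains k \<sigma> where "pres k \<sigma> c1 c1" "pres k \<sigma> c2 c2" "\<sigma> v = v'" "\<sigma> ` e = e'"
proof -
  obtain D l where v: "v \<in> V" "e = {v, nbr v D l}" using E_cases assms(2,3) by metis
  obtain D' l' where v': "v' \<in> V" "e' = {v', nbr v' D' l'}" using E_cases assms(4,5) by metis
  obtain k \<sigma> where s: "pres k \<sigma> c1 c1" "pres k \<sigma> c2 c2" "\<sigma> (X 0) = v" "\<sigma> (X 1) = nbr v D l"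
    using assms(1) v unfolding arc_transitive_def by blast
  obtain k' \<tau> where t: "pres k' \<tau> c1 c1" "pres k' \<tau> c2 c2" "\<tau> (X 0) = v'" "\<tau> (X 1) = nbr v' D' l'"
    using assms(1) v' unfolding arc_transitive_def by blast
  have b: "bij_betw \<sigma> V V" using s(1) by (simp add: pres_def T_def)
  let ?\<rho> = "\<tau> \<circ> inv_into V \<sigma>"
  have "inv_into V \<sigma> v = X 0" "inv_into V \<sigma> (nbr v D l) = X 1"
    using b s(3,4) by (metis X_in bij_betw_inv_into_left)+
  then have "?\<rho> v = v'" "?\<rho> ` e = e'" using t v v' by auto
  then show ?thesis
    using that pres_comp[OF pres_inv[OF s(1)] t(1)] pres_comp[OF pres_inv[OF s(2)] t(2)] by blast
qed

text \<open>A flag of the map amounts to an arc together with one of the two families.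
  Arc-transitivity joins all flags of one family, and by \<open>mix\<close> no automorphism turns a
  matching of the first family into one of the second. So the orbits are the two families; adjacency
  0 and 1 stay in a face, adjacency 2 changes the family.\<close>

lemma class_Fam:
  assumes "cyclic c1" "cyclic c2" and neq: "\<And>v. v \<in> V \<Longrightarrow> c1 v \<noteq> c2 v"
    and trans: "arc_transitive c1 c2"
    and aut: "\<And>\<sigma>. graph_aut V E \<sigma> \<Longrightarrow> \<exists>k. T k \<sigma>"
    and mix: "\<And>k \<sigma> v w. T k \<sigma> \<Longrightarrow> v \<in> V \<Longrightarrow> w \<in> V \<Longrightarrow> twist k (c1 v) \<noteq> c2 w"
  shows "class_2_01 V E (Fam c1 \<union> Fam c2)"
proof -
  let ?F = "Fam c1 \<union> Fam c2"
  define Fl where "Fl c = {(v, e, f). e \<in> E \<and> v \<in> e \<and> f = comp c e}" for c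
  have flags: "flags ?F = Fl c1 \<union> Fl c2"
  proof
    show "flags ?F \<subseteq> Fl c1 \<union> Fl c2"
    proof
      fix \<Phi> assume "\<Phi> \<in> flags ?F"
      then obtain v e f where p: "\<Phi> = (v, e, f)" "f \<in> ?F" "e \<in> f" "v \<in> e" unfolding flags_def by blast
      then obtain e0 where "e0 \<in> E" "f = comp c1 e0 \<or> f = comp c2 e0" unfolding Fam_def by blast
      then have "e \<in> E" "f = comp c1 e \<or> f = comp c2 e"
        using p(3) comp_eq comp_subset by blast+
      then show "\<Phi> \<in> Fl c1 \<union> Fl c2" using p unfolding Fl_def by blast
    qed
    show "Fl c1 \<union> Fl c2 \<subseteq> flags ?F" unfolding Fl_def flags_def Fam_def by auto
  qed
  have A: "\<Psi> \<in> flag_orbit V E ?F \<Phi>" if h: "\<Phi> \<in> Fl c" "\<Psi> \<in> Fl c" "c = c1 \<or> c = c2" for c \<Phi> \<Psi>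
  proof -
    obtain v e v' e' where p: "\<Phi> = (v, e, comp c e)" "v \<in> e" "e \<in> E"
      "\<Psi> = (v', e', comp c e')" "v' \<in> e'" "e' \<in> E"
      using h unfolding Fl_def by blast
    obtain k \<sigma> where s: "pres k \<sigma> c1 c1" "pres k \<sigma> c2 c2" "\<sigma> v = v'" "\<sigma> ` e = e'"
      using arc_transitiveD[OF trans p(2,3,5,6)] .
    have "map_aut V E ?F \<sigma>"
      unfolding map_aut_def image_Un face_img_Fam[OF s(1)] face_img_Fam[OF s(2)]
      using s(1) T_graph_aut by (auto simp: pres_def)
    moreover have "flag_img \<sigma> \<Phi> = \<Psi>"
      using p s h(3) face_img_comp[OF s(1) p(3)] face_img_comp[OF s(2) p(3)]
      by (auto simp: flag_img_def)
    ultimately show ?thesis unfolding flag_orbit_def by blast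
  qed
  \<comment> \<open>An automorphism that moves a flag to the other family carries the corner of its
    face at v along, so its twist would relate the matchings of the two families.\<close>
  have M: False
    if c: "cyclic c" "cyclic c'" and m: "\<And>k v w. T k \<sigma> \<Longrightarrow> v \<in> V \<Longrightarrow> w \<in> V \<Longrightarrow> twist k (c v) \<noteq> c' w"
      and h: "map_aut V E ?F \<sigma>" "\<Phi> \<in> Fl c" "flag_img \<sigma> \<Phi> \<in> Fl c'" for c c' \<sigma> \<Phi>
  proof -
    have "graph_aut V E \<sigma>" using h(1) by (simp add: map_aut_def)
    from aut[OF this] obtain k where T: "T k \<sigma>" ..
    obtain v e where p: "\<Phi> = (v, e, comp c e)" "v \<in> e" "e \<in> E"
      using h(2) unfolding Fl_def by blast
    have f: "face_img \<sigma> (comp c e) = comp c' (\<sigma> ` e)" "\<sigma> ` e \<in> E"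
      using h(3) p unfolding Fl_def flag_img_def by auto
    obtain D l where v: "v \<in> V" "e = {v, nbr v D l}" using E_cases p by metis
    let ?a = "nbr v D l" and ?b = "nbr v (D \<noteq> fst (c v)) (l \<noteq> snd (c v))"
    have s: "S (c v) v ?a ?b" using S_nbr[OF v(1)] by simp
    have va: "{v, ?a} \<in> comp c e" using v(2) by simp
    have "{v, ?b} \<in> comp c e" using comp_step[OF va v(1) s] .
    with va have "\<sigma> ` {v, ?a} \<in> comp c' (\<sigma> ` e)" "\<sigma> ` {v, ?b} \<in> comp c' (\<sigma> ` e)"
      unfolding f(1)[symmetric] face_img_def by blast+
    then have i: "{\<sigma> v, \<sigma> ?a} \<in> comp c' (\<sigma> ` e)" "{\<sigma> v, \<sigma> ?b} \<in> comp c' (\<sigma> ` e)" by auto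
    have "?a \<noteq> ?b" using c(1) v(1) S_irrefl[OF v(1)] s unfolding cyclic_def valid_def by metis
    then have "\<sigma> ?a \<noteq> \<sigma> ?b" using T_bij[OF T] by (metis bij_betw_inv_into_left nbr_in)
    then have "S (c' (\<sigma> v)) (\<sigma> v) (\<sigma> ?a) (\<sigma> ?b)" using corner_type[OF c(2) f(2) i] by simp
    moreover have "S (twist k (c v)) (\<sigma> v) (\<sigma> ?a) (\<sigma> ?b)" using T_S[OF T v(1) s] .
    ultimately show False using S_type_unique T_in[OF T v(1)] m[OF T v(1)] by blast
  qed
  have M12: False if "map_aut V E ?F \<sigma>" "\<Phi> \<in> Fl c1" "flag_img \<sigma> \<Phi> \<in> Fl c2" for \<sigma> \<Phi>
    using M[OF assms(1,2) mix that] .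
  \<comment> \<open>\<open>twist\<close> is an involution, so \<open>mix\<close> is symmetric in the
    two families.\<close>
  have mix': "twist k (c2 v) \<noteq> c1 w" if "T k \<sigma>" "v \<in> V" "w \<in> V" for k \<sigma> v w
    using mix[OF that(1,3,2)] by (metis twist_tw)
  have M21: False if "map_aut V E ?F \<sigma>" "\<Phi> \<in> Fl c2" "flag_img \<sigma> \<Phi> \<in> Fl c1" for \<sigma> \<Phi>
    using M[OF assms(2,1) mix' that] .
  have orb_flags: "flag_img \<sigma> \<Phi> \<in> flags ?F" if h: "map_aut V E ?F \<sigma>" "\<Phi> \<in> flags ?F" for \<sigma> \<Phi>
  proof -
    obtain v e f where p: "\<Phi> = (v, e, f)" "f \<in> ?F" "e \<in> f" "v \<in> e"
      using h(2) unfolding flags_def by blast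
    have "face_img \<sigma> f \<in> ?F" using h(1) p(2) unfolding map_aut_def by blast
    then show ?thesis using p by (simp add: flags_def flag_img_def face_img_def)
  qed
  have orb1: "flag_orbit V E ?F \<Phi> = Fl c1" if "\<Phi> \<in> Fl c1" for \<Phi>
  proof
    show "flag_orbit V E ?F \<Phi> \<subseteq> Fl c1"
      using orb_flags M12 that unfolding flag_orbit_def flags by blast
    show "Fl c1 \<subseteq> flag_orbit V E ?F \<Phi>" using A that by blast
  qed
  have orb2: "flag_orbit V E ?F \<Phi> = Fl c2" if "\<Phi> \<in> Fl c2" for \<Phi>
  proof
    show "flag_orbit V E ?F \<Phi> \<subseteq> Fl c2"
      using orb_flags M21 that unfolding flag_orbit_def flags by blast
    show "Fl c2 \<subseteq> flag_orbit V E ?F \<Phi>" using A that by blast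
  qed
  have disj: "Fl c1 \<inter> Fl c2 = {}"
    unfolding Fl_def using comp_neq[OF assms(1,2) neq] by blast
  have ne: "Fl c \<noteq> {}" for c
  proof -
    have "(X 0, {X 0, nbr (X 0) True True}, comp c {X 0, nbr (X 0) True True}) \<in> Fl c"
      unfolding Fl_def E_eq using X_in by blast
    then show ?thesis by blast
  qed
  have "flag_orbit V E ?F ` flags ?F = {Fl c1, Fl c2}"
  proof -
    have "flag_orbit V E ?F ` Fl c1 = (\<lambda>_. Fl c1) ` Fl c1" "flag_orbit V E ?F ` Fl c2 = (\<lambda>_. Fl c2) ` Fl c2"
      using orb1 orb2 by (intro image_cong refl, simp)+
    then show ?thesis unfolding flags image_Un using ne by (simp add: image_constant_conv insert_commute)
  qed
  moreover have "Fl c1 \<noteq> Fl c2" using disj ne by blast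
  ultimately have card: "card (flag_orbit V E ?F ` flags ?F) = 2" by simp
  have same: "\<Psi> \<in> flag_orbit V E ?F \<Phi>"
    if h: "\<Phi> \<in> flags ?F" "\<Psi> \<in> flags ?F" "snd (snd \<Phi>) = snd (snd \<Psi>)" for \<Phi> \<Psi>
  proof -
    have "\<Phi> \<in> Fl c1 \<and> \<Psi> \<in> Fl c1 \<or> \<Phi> \<in> Fl c2 \<and> \<Psi> \<in> Fl c2"
    proof -
      have "snd (snd \<Phi>) \<noteq> snd (snd \<Psi>)" if "\<Phi> \<in> Fl c1" "\<Psi> \<in> Fl c2" for \<Phi> \<Psi>
        using that comp_neq[OF assms(1,2) neq] unfolding Fl_def by auto
      then show ?thesis using h unfolding flags by (metis UnE)
    qed
    then show ?thesis using A by blast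
  qed
  have diff: "\<Psi> \<notin> flag_orbit V E ?F \<Phi>"
    if "\<Phi> \<in> flags ?F" "\<Psi> \<in> flags ?F" "adj_flag 2 \<Phi> \<Psi>" for \<Phi> \<Psi>
  proof -
    have "\<Phi> \<in> Fl c1 \<and> \<Psi> \<in> Fl c2 \<or> \<Phi> \<in> Fl c2 \<and> \<Psi> \<in> Fl c1"
      using that unfolding flags Fl_def adj_flag_def by auto
    then show ?thesis using orb1 orb2 disj by blast
  qed
  show ?thesis unfolding class_2_01_def
    using card same diff by (auto simp: adj_flag_def)
qed


section \<open>Explicit automorphisms\<close>

text \<open>Evaluation takes place at the stored residue; for n-periodic f and g the formulas hold
  at all integers, see \<open>lift_simps\<close>.\<close>

definition lift :: "(int \<Rightarrow> vertex) \<Rightarrow> (int \<Rightarrow> vertex) \<Rightarrow> vertex \<Rightarrow> vertex" where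
  "lift f g v = (if fst v then g (int (snd v)) else f (int (snd v)))"

lemma periodic_mod:
  fixes f :: "int \<Rightarrow> 'a"
  assumes "\<And>k. f (k + n) = f k"
  shows "f (k mod n) = f k"
proof -
  have "f (k + n * j) = f k" for j k
  proof (induction j rule: int_induct[where k = 0])
    case (step1 i)
    then show ?case using assms[of "k + n * i"] by (simp add: algebra_simps)
  next
    case (step2 i)
    then show ?case using assms[of "k + n * (i - 1)"] by (simp add: algebra_simps)
  qed simp
  from this[of k "- (k div n)"] show ?thesis
    by (simp add: minus_mult_div_eq_mod)
qed

lemma lift_simps:
  assumes "\<And>k. f (k + n) = f k" "\<And>k. g (k + n) = g k"
  shows "lift f g (X k) = f k" "lift f g (Y k) = g k"
  using periodic_mod[of f, OF assms(1)] periodic_mod[of g, OF assms(2)] by (simp_all add: lift_def)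

lemma X_eq_tI: "a - b = e * t \<Longrightarrow> 4 dvd e \<Longrightarrow> X a = X b"
  and Y_eq_tI: "a - b = e * t \<Longrightarrow> 4 dvd e \<Longrightarrow> Y a = Y b"
  by (simp_all add: X_eq_iff Y_eq_iff n_dvd_t_iff)

lemma X_add_n [simp]: "X (k + n) = X k" and Y_add_n [simp]: "Y (k + n) = Y k"
  by (simp_all add: X_eq_iff Y_eq_iff)

definition rot :: "int \<Rightarrow> vertex \<Rightarrow> vertex" where
  "rot a = lift (\<lambda>k. X (k + a)) (\<lambda>k. Y (k + a))"

lemma rot_simps [simp]: "rot a (X k) = X (k + a)" "rot a (Y k) = Y (k + a)"
proof -
  have "X (k + n + a) = X (k + a)" "Y (k + n + a) = Y (k + a)" for k
    using X_add_n[of "k + a"] Y_add_n[of "k + a"] by (simp_all add: ac_simps)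
  then show "rot a (X k) = X (k + a)" "rot a (Y k) = Y (k + a)"
    unfolding rot_def by (simp_all add: lift_simps)
qed

lemma T_rot: "T False (rot a)"
  unfolding T_def
proof (intro conjI ballI)
  show "bij_betw (rot a) V V"
    by (intro bij_betw_byWitness[of _ "rot (- a)"]) (auto elim!: V_cases)
  fix v assume v: "v \<in> V"
  have "rot a (nbr v D l) = nbr (rot a v) D l" for D l
    using v by (cases D; cases l; elim V_cases) (simp_all add: nbr_simps algebra_simps)
  then show "\<exists>s1 s2. \<forall>D l. rot a (nbr v D l) = nbr (rot a v) (D \<noteq> s1) (l \<noteq> (s2 \<noteq> (False \<and> D)))"
    by (intro exI[of _ False]) simp
qed

text \<open>The image is closed under taking neighbours, so it is all of V; finiteness then gives
  injectivity.\<close>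

lemma T_I:
  assumes V: "\<And>v. v \<in> V \<Longrightarrow> \<sigma> v \<in> V" and X: "X 0 \<in> \<sigma> ` V"
    and nbr: "\<And>v. v \<in> V \<Longrightarrow> \<exists>s1 s2. \<forall>D l. \<sigma> (nbr v D l) = nbr (\<sigma> v) (D \<noteq> s1) (l \<noteq> (s2 \<noteq> (k \<and> D)))"
  shows "T k \<sigma>"
proof -
  have "v \<in> \<sigma> ` V" if "v \<in> V" for v
  proof (rule connected_induct[of "\<lambda>v. v \<in> \<sigma> ` V", OF X _ that])
    fix v D l assume "v \<in> \<sigma> ` V"
    then obtain u where u: "u \<in> V" "v = \<sigma> u" by blast
    obtain s1 s2 where s: "\<And>D l. \<sigma> (nbr u D l) = nbr v (D \<noteq> s1) (l \<noteq> (s2 \<noteq> (k \<and> D)))"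
      using nbr[OF u(1)] u(2) by blast
    have "\<sigma> (nbr u (D \<noteq> s1) (l \<noteq> (s2 \<noteq> (k \<and> (D \<noteq> s1))))) = nbr v D l"
      unfolding s by (intro arg_cong2[of _ _ _ _ "nbr v"]) blast+
    then show "nbr v D l \<in> \<sigma> ` V" by (metis imageI nbr_in)
  qed
  then have "V \<subseteq> \<sigma> ` V" by blast
  then have "bij_betw \<sigma> V V"
    using finite_surj_inj[OF finite_V] V by (auto simp: bij_betw_def)
  then show ?thesis unfolding T_def using nbr by simp
qed

text \<open>The image of y_k is forced: y_k is the upper neighbour of x_k with flag
  \<open>True\<close>, and its image is the lower neighbour with flag \<open>True\<close> of x_(-k),
  whose index is -k - 2 - t.\<close>

definition refl :: "vertex \<Rightarrow> vertex" where
  "refl = lift (\<lambda>k. X (- k)) (\<lambda>k. Y (- k - 2 - t))"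

lemma refl_simps [simp]: "refl (X k) = X (- k)" "refl (Y k) = Y (- k - 2 - t)"
proof -
  have "X (- (k + n)) = X (- k)" "Y (- (k + n) - 2 - t) = Y (- k - 2 - t)" for k
    by (simp_all add: X_eq_iff Y_eq_iff)
  then show "refl (X k) = X (- k)" "refl (Y k) = Y (- k - 2 - t)"
    unfolding refl_def by (simp_all add: lift_simps)
qed

lemma T_refl: "T False refl"
proof (rule T_I)
  show "refl v \<in> V" if "v \<in> V" for v using that by (elim V_cases) simp_all
  show "X 0 \<in> refl ` V" by (rule image_eqI[of _ _ "X 0"]) simp_all
  fix v assume v: "v \<in> V"
  then show "\<exists>s1 s2. \<forall>D l. refl (nbr v D l) = nbr (refl v) (D \<noteq> s1) (l \<noteq> (s2 \<noteq> (False \<and> D)))"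
  proof (cases rule: V_cases)
    case (1 k)
    have "refl (nbr v D l) = nbr (refl v) (\<not> D) l" for D l
      using 1 by (cases D; cases l) (simp_all add: nbr_simps X_eq_iff Y_eq_iff)
    then show ?thesis by (intro exI[of _ True] exI[of _ False]) simp
  next
    case (2 k)
    have "refl (nbr v D l) = nbr (refl v) (\<not> D) (\<not> l)" for D l
      using 2 by (cases D; cases l) (simp_all add: nbr_simps X_eq_iff Y_eq_iff)
    then show ?thesis by (intro exI[of _ True]) simp
  qed
qed

text \<open>Fixes x_0 and swaps its two upper as well as its two lower neighbours. Well-defined because
  3 divides n.\<close>

definition theta :: "vertex \<Rightarrow> vertex" where
  "theta = lift
     (\<lambda>k. if k mod 3 = 0 then X k else if k mod 3 = 1 then Y (k - 1) else Y (k - 1 - t))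
     (\<lambda>k. if k mod 3 = 0 then X (k + 1) else if k mod 3 = 1 then X (k + 1 + t) else Y (k + 2 * t))"

lemma theta_eq:
  "theta (X k) = (if k mod 3 = 0 then X k else if k mod 3 = 1 then Y (k - 1) else Y (k - 1 - t))"
  "theta (Y k) = (if k mod 3 = 0 then X (k + 1) else if k mod 3 = 1 then X (k + 1 + t) else Y (k + 2 * t))"
proof -
  have m: "(k + n) mod 3 = k mod 3" for k
    using three_dvd by (simp add: mod_add_eq[symmetric])
  have e: "Y (k + n - 1) = Y (k - 1)" "Y (k + n - 1 - t) = Y (k - 1 - t)" "X (k + n + 1) = X (k + 1)"
    "X (k + n + 1 + t) = X (k + 1 + t)" "Y (k + n + 2 * t) = Y (k + 2 * t)" for k
    by (simp_all add: X_eq_iff Y_eq_iff)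
  show "theta (X k) = (if k mod 3 = 0 then X k else if k mod 3 = 1 then Y (k - 1) else Y (k - 1 - t))"
    "theta (Y k) = (if k mod 3 = 0 then X (k + 1) else if k mod 3 = 1 then X (k + 1 + t) else Y (k + 2 * t))"
    unfolding theta_def by (subst lift_simps; simp add: m e)+
qed

lemma mod3:
  fixes q :: int
  shows "(3 * q) mod 3 = 0" "(3 * q + 1) mod 3 = 1" "(3 * q + 2) mod 3 = 2"
  by presburger+

lemma theta_simps:
  "e = 3 * q \<Longrightarrow> theta (X e) = X e" "e = 3 * q + 1 \<Longrightarrow> theta (X e) = Y (e - 1)"
  "e = 3 * q + 2 \<Longrightarrow> theta (X e) = Y (e - 1 - t)"
  "e = 3 * q \<Longrightarrow> theta (Y e) = X (e + 1)" "e = 3 * q + 1 \<Longrightarrow> theta (Y e) = X (e + 1 + t)"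
  "e = 3 * q + 2 \<Longrightarrow> theta (Y e) = Y (e + 2 * t)"
  by (simp_all add: theta_eq mod3)

lemma theta_into:
  "e = 3 * q \<Longrightarrow> e - b = c * t \<Longrightarrow> 4 dvd c \<Longrightarrow> theta (X e) = X b"
  "e = 3 * q + 1 \<Longrightarrow> e - 1 - b = c * t \<Longrightarrow> 4 dvd c \<Longrightarrow> theta (X e) = Y b"
  "e = 3 * q + 2 \<Longrightarrow> e - 1 - t - b = c * t \<Longrightarrow> 4 dvd c \<Longrightarrow> theta (X e) = Y b"
  "e = 3 * q \<Longrightarrow> e + 1 - b = c * t \<Longrightarrow> 4 dvd c \<Longrightarrow> theta (Y e) = X b"
  "e = 3 * q + 1 \<Longrightarrow> e + 1 + t - b = c * t \<Longrightarrow> 4 dvd c \<Longrightarrow> theta (Y e) = X b"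
  "e = 3 * q + 2 \<Longrightarrow> e + 2 * t - b = c * t \<Longrightarrow> 4 dvd c \<Longrightarrow> theta (Y e) = Y b"
  by (simp_all only: theta_simps) (rule X_eq_tI Y_eq_tI; assumption)+

lemma int_mod3_cases:
  fixes k :: int
  obtains q where "k = 3 * q" | q where "k = 3 * q + 1" | q where "k = 3 * q + 2"
proof -
  have "k = 3 * (k div 3) + k mod 3" by simp
  moreover have "k mod 3 = 0 \<or> k mod 3 = 1 \<or> k mod 3 = 2" by presburger
  ultimately show ?thesis using that by (metis add.right_neutral)
qed

text \<open>One lemma for each of the six residue classes. The four rules treat the neighbours with
  flags TT, TF, FT, FF in this order; they are instantiated with the quotient by 3 of the
  neighbour's index and with the multiple of \<open>t\<close> between the two image indices, which
  is nonzero only where 4t = 0 modulo n is used. The flags on the right stay unsimplified to match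
  the form required by \<open>T\<close>.\<close>

lemma theta_nbr_X0:
  "theta (nbr (X (3 * q)) D l) = nbr (theta (X (3 * q))) (D \<noteq> False) (l \<noteq> (True \<noteq> (False \<and> D)))"
  by (cases D; cases l; simp only: simp_thms theta_simps(1)[OF refl, of q] nbr_simps)
    ((rule theta_into(4)[of _ "q" _ "0"]; simp add: t_def algebra_simps),
     (rule theta_into(2)[of _ "q" _ "0"]; simp add: t_def algebra_simps),
     (rule theta_into(5)[of _ "q - 1 - int d" _ "0"]; simp add: t_def algebra_simps),
     (rule theta_into(3)[of _ "q - 1" _ "0"]; simp add: t_def algebra_simps))

lemma theta_nbr_X1:
  "theta (nbr (X (3 * q + 1)) D l) = nbr (theta (X (3 * q + 1))) (D \<noteq> False) (l \<noteq> (False \<noteq> (False \<and> D)))"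
  by (cases D; cases l; simp only: simp_thms theta_simps(2)[OF refl, of q] nbr_simps)
    ((rule theta_into(5)[of _ "q" _ "0"]; simp add: t_def algebra_simps),
     (rule theta_into(3)[of _ "q" _ "0"]; simp add: t_def algebra_simps),
     (rule theta_into(6)[of _ "q - 1 - int d" _ "0"]; simp add: t_def algebra_simps),
     (rule theta_into(1)[of _ "q" _ "0"]; simp add: t_def algebra_simps))

lemma theta_nbr_X2:
  "theta (nbr (X (3 * q + 2)) D l) = nbr (theta (X (3 * q + 2))) (D \<noteq> False) (l \<noteq> (True \<noteq> (False \<and> D)))"
  by (cases D; cases l; simp only: simp_thms theta_simps(3)[OF refl, of q] nbr_simps)
    ((rule theta_into(6)[of _ "q" _ "4"]; simp add: t_def algebra_simps),
     (rule theta_into(1)[of _ "q + 1" _ "0"]; simp add: t_def algebra_simps),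
     (rule theta_into(4)[of _ "q - int d" _ "0"]; simp add: t_def algebra_simps),
     (rule theta_into(2)[of _ "q" _ "0"]; simp add: t_def algebra_simps))

lemma theta_nbr_Y0:
  "theta (nbr (Y (3 * q)) D l) = nbr (theta (Y (3 * q))) (D \<noteq> False) (l \<noteq> (False \<noteq> (False \<and> D)))"
  by (cases D; cases l; simp only: simp_thms theta_simps(4)[OF refl, of q] nbr_simps)
    ((rule theta_into(3)[of _ "q + int d" _ "0"]; simp add: t_def algebra_simps),
     (rule theta_into(5)[of _ "q - int d" _ "0"]; simp add: t_def algebra_simps),
     (rule theta_into(6)[of _ "q - 1 + int d" _ "4"]; simp add: t_def algebra_simps),
     (rule theta_into(1)[of _ "q" _ "0"]; simp add: t_def algebra_simps))

lemma theta_nbr_Y1: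
  "theta (nbr (Y (3 * q + 1)) D l) = nbr (theta (Y (3 * q + 1))) (D \<noteq> False) (l \<noteq> (True \<noteq> (False \<and> D)))"
  by (cases D; cases l; simp only: simp_thms theta_simps(5)[OF refl, of q] nbr_simps)
    ((rule theta_into(1)[of _ "q + 1 + int d" _ "0"]; simp add: t_def algebra_simps),
     (rule theta_into(6)[of _ "q - int d" _ "0"]; simp add: t_def algebra_simps),
     (rule theta_into(4)[of _ "q + int d" _ "0"]; simp add: t_def algebra_simps),
     (rule theta_into(2)[of _ "q" _ "0"]; simp add: t_def algebra_simps))

lemma theta_nbr_Y2:
  "theta (nbr (Y (3 * q + 2)) D l) = nbr (theta (Y (3 * q + 2))) (D \<noteq> False) (l \<noteq> (True \<noteq> (False \<and> D)))"
  by (cases D; cases l; simp only: simp_thms theta_simps(6)[OF refl, of q] nbr_simps)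
    ((rule theta_into(2)[of _ "q + 1 + int d" _ "0"]; simp add: t_def algebra_simps),
     (rule theta_into(4)[of _ "q + 1 - int d" _ "-4"]; simp add: t_def algebra_simps),
     (rule theta_into(5)[of _ "q + int d" _ "0"]; simp add: t_def algebra_simps),
     (rule theta_into(3)[of _ "q" _ "-4"]; simp add: t_def algebra_simps))

lemma T_theta:
  "T False theta"
proof (rule T_I)
  show "theta v \<in> V" if "v \<in> V" for v
    using that by (elim V_cases) (simp_all add: theta_eq)
  show "X 0 \<in> theta ` V" by (rule image_eqI[of _ _ "X 0"]) (simp_all add: theta_eq)
  fix v assume "v \<in> V"
  then show "\<exists>s1 s2. \<forall>D l. theta (nbr v D l) = nbr (theta v) (D \<noteq> s1) (l \<noteq> (s2 \<noteq> (False \<and> D)))"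
  proof (cases rule: V_cases)
    case (1 k)
    show ?thesis
      unfolding 1 by (cases k rule: int_mod3_cases; hypsubst; intro exI allI)
        (rule theta_nbr_X0 theta_nbr_X1 theta_nbr_X2)+
  next
    case (2 k)
    show ?thesis
      unfolding 2 by (cases k rule: int_mod3_cases; hypsubst; intro exI allI)
        (rule theta_nbr_Y0 theta_nbr_Y1 theta_nbr_Y2)+
  qed
qed


text \<open>Fixes x_0 and its upper neighbours but swaps its lower ones. It is an automorphism only if
  d mod 4 = 2, since passing from k to k + t changes the shift by d * t, which has to agree
  with 2 * t modulo n.\<close>

definition zeta :: "vertex \<Rightarrow> vertex" where
  "zeta = lift
     (\<lambda>k. if k mod 3 = 2 then Y (k - 1 + k div 3 * t) else X (k + k div 3 * t))
     (\<lambda>k. if k mod 3 = 0 then Y (k + k div 3 * t) else if k mod 3 = 1 then X (k + 1 + k div 3 * t)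
        else Y (k + (k div 3 + 3) * t))"

text \<open>Replacing k by k + n raises k div 3 by 4m and thus the shift by 4mt, which vanishes
  modulo n. The formula is therefore well defined for every m.\<close>

lemma zeta_eq:
  "zeta (X k) = (if k mod 3 = 2 then Y (k - 1 + k div 3 * t) else X (k + k div 3 * t))"
  "zeta (Y k) = (if k mod 3 = 0 then Y (k + k div 3 * t) else if k mod 3 = 1 then X (k + 1 + k div 3 * t)
        else Y (k + (k div 3 + 3) * t))"
proof -
  have m: "(k + n) mod 3 = k mod 3" for k
    using three_dvd by (simp add: mod_add_eq[symmetric])
  have q: "(k + n) div 3 = k div 3 + 4 * int m" for k
    unfolding n_def by simp
  have d: "n dvd j \<Longrightarrow> n dvd j + 4 * int m * t" for j
    using n_dvd_t_iff[of "4 * int m"] by simp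
  have e: "Y (k + n - 1 + (k div 3 + 4 * int m) * t) = Y (k - 1 + k div 3 * t)"
    "X (k + n + (k div 3 + 4 * int m) * t) = X (k + k div 3 * t)"
    "Y (k + n + (k div 3 + 4 * int m) * t) = Y (k + k div 3 * t)"
    "X (k + n + 1 + (k div 3 + 4 * int m) * t) = X (k + 1 + k div 3 * t)"
    "Y (k + n + (k div 3 + 4 * int m + 3) * t) = Y (k + (k div 3 + 3) * t)" for k
    using d[of n] by (simp_all add: X_eq_iff Y_eq_iff algebra_simps)
  show "zeta (X k) = (if k mod 3 = 2 then Y (k - 1 + k div 3 * t) else X (k + k div 3 * t))"
    "zeta (Y k) = (if k mod 3 = 0 then Y (k + k div 3 * t) else if k mod 3 = 1 then X (k + 1 + k div 3 * t)
        else Y (k + (k div 3 + 3) * t))"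
    unfolding zeta_def by (subst lift_simps; simp add: m q e)+
qed

lemma div3:
  fixes q :: int
  shows "(3 * q) div 3 = q" "(3 * q + 1) div 3 = q" "(3 * q + 2) div 3 = q"
  by presburger+

lemma zeta_simps:
  "e = 3 * q \<Longrightarrow> zeta (X e) = X (e + q * t)" "e = 3 * q + 1 \<Longrightarrow> zeta (X e) = X (e + q * t)"
  "e = 3 * q + 2 \<Longrightarrow> zeta (X e) = Y (e - 1 + q * t)"
  "e = 3 * q \<Longrightarrow> zeta (Y e) = Y (e + q * t)" "e = 3 * q + 1 \<Longrightarrow> zeta (Y e) = X (e + 1 + q * t)"
  "e = 3 * q + 2 \<Longrightarrow> zeta (Y e) = Y (e + (q + 3) * t)"
  by (simp_all add: zeta_eq mod3 div3)

lemma zeta_into: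
  "e = 3 * q \<Longrightarrow> e + q * t - b = c * t \<Longrightarrow> 4 dvd c \<Longrightarrow> zeta (X e) = X b"
  "e = 3 * q + 1 \<Longrightarrow> e + q * t - b = c * t \<Longrightarrow> 4 dvd c \<Longrightarrow> zeta (X e) = X b"
  "e = 3 * q + 2 \<Longrightarrow> e - 1 + q * t - b = c * t \<Longrightarrow> 4 dvd c \<Longrightarrow> zeta (X e) = Y b"
  "e = 3 * q \<Longrightarrow> e + q * t - b = c * t \<Longrightarrow> 4 dvd c \<Longrightarrow> zeta (Y e) = Y b"
  "e = 3 * q + 1 \<Longrightarrow> e + 1 + q * t - b = c * t \<Longrightarrow> 4 dvd c \<Longrightarrow> zeta (Y e) = X b"
  "e = 3 * q + 2 \<Longrightarrow> e + (q + 3) * t - b = c * t \<Longrightarrow> 4 dvd c \<Longrightarrow> zeta (Y e) = Y b"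
  by (simp_all only: zeta_simps) (rule X_eq_tI Y_eq_tI; assumption)+

text \<open>In this group of lemmas the multiples of \<open>t\<close> contain d: 4 + 4c is d + 2,
  and 4c is d - 2. They are divisible by four because d = 4c + 2.\<close>

lemma zeta_nbr_X0:
  assumes "int d = 4 * c + 2"
  shows "zeta (nbr (X (3 * q)) D l) = nbr (zeta (X (3 * q))) (D \<noteq> False) (l \<noteq> (True \<noteq> (True \<and> D)))"
  by (cases D; cases l; simp only: simp_thms zeta_simps(1)[OF refl, of q] nbr_simps)
    ((rule zeta_into(4)[of _ "q" _ "0"]; simp add: assms t_def algebra_simps),
     (rule zeta_into(2)[of _ "q" _ "0"]; simp add: assms t_def algebra_simps),
     (rule zeta_into(5)[of _ "q - 1 - int d" _ "-4 - 4 * c"]; simp add: assms t_def algebra_simps),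
     (rule zeta_into(3)[of _ "q - 1" _ "0"]; simp add: assms t_def algebra_simps))

lemma zeta_nbr_X1:
  assumes "int d = 4 * c + 2"
  shows "zeta (nbr (X (3 * q + 1)) D l) = nbr (zeta (X (3 * q + 1))) (D \<noteq> False) (l \<noteq> (False \<noteq> (True \<and> D)))"
  by (cases D; cases l; simp only: simp_thms zeta_simps(2)[OF refl, of q] nbr_simps)
    ((rule zeta_into(5)[of _ "q" _ "0"]; simp add: assms t_def algebra_simps),
     (rule zeta_into(3)[of _ "q" _ "0"]; simp add: assms t_def algebra_simps),
     (rule zeta_into(6)[of _ "q - 1 - int d" _ "0 - 4 * c"]; simp add: assms t_def algebra_simps),
     (rule zeta_into(1)[of _ "q" _ "0"]; simp add: assms t_def algebra_simps))

lemma zeta_nbr_X2: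
  assumes "int d = 4 * c + 2"
  shows "zeta (nbr (X (3 * q + 2)) D l) = nbr (zeta (X (3 * q + 2))) (D \<noteq> False) (l \<noteq> (False \<noteq> (True \<and> D)))"
  by (cases D; cases l; simp only: simp_thms zeta_simps(3)[OF refl, of q] nbr_simps)
    ((rule zeta_into(6)[of _ "q" _ "4"]; simp add: assms t_def algebra_simps),
     (rule zeta_into(1)[of _ "q + 1" _ "0"]; simp add: assms t_def algebra_simps),
     (rule zeta_into(4)[of _ "q - int d" _ "-4 - 4 * c"]; simp add: assms t_def algebra_simps),
     (rule zeta_into(2)[of _ "q" _ "0"]; simp add: assms t_def algebra_simps))

lemma zeta_nbr_Y0:
  assumes "int d = 4 * c + 2"
  shows "zeta (nbr (Y (3 * q)) D l) = nbr (zeta (Y (3 * q))) (D \<noteq> False) (l \<noteq> (False \<noteq> (True \<and> D)))"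
  by (cases D; cases l; simp only: simp_thms zeta_simps(4)[OF refl, of q] nbr_simps)
    ((rule zeta_into(3)[of _ "q + int d" _ "4 + 4 * c"]; simp add: assms t_def algebra_simps),
     (rule zeta_into(5)[of _ "q - int d" _ "-4 - 4 * c"]; simp add: assms t_def algebra_simps),
     (rule zeta_into(6)[of _ "q - 1 + int d" _ "4 + 4 * c"]; simp add: assms t_def algebra_simps),
     (rule zeta_into(1)[of _ "q" _ "0"]; simp add: assms t_def algebra_simps))

lemma zeta_nbr_Y1:
  assumes "int d = 4 * c + 2"
  shows "zeta (nbr (Y (3 * q + 1)) D l) = nbr (zeta (Y (3 * q + 1))) (D \<noteq> False) (l \<noteq> (False \<noteq> (True \<and> D)))"
  by (cases D; cases l; simp only: simp_thms zeta_simps(5)[OF refl, of q] nbr_simps)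
    ((rule zeta_into(1)[of _ "q + 1 + int d" _ "4 + 4 * c"]; simp add: assms t_def algebra_simps),
     (rule zeta_into(6)[of _ "q - int d" _ "0 - 4 * c"]; simp add: assms t_def algebra_simps),
     (rule zeta_into(4)[of _ "q + int d" _ "4 + 4 * c"]; simp add: assms t_def algebra_simps),
     (rule zeta_into(2)[of _ "q" _ "0"]; simp add: assms t_def algebra_simps))

lemma zeta_nbr_Y2:
  assumes "int d = 4 * c + 2"
  shows "zeta (nbr (Y (3 * q + 2)) D l) = nbr (zeta (Y (3 * q + 2))) (D \<noteq> False) (l \<noteq> (True \<noteq> (True \<and> D)))"
  by (cases D; cases l; simp only: simp_thms zeta_simps(6)[OF refl, of q] nbr_simps)
    ((rule zeta_into(2)[of _ "q + 1 + int d" _ "0 + 4 * c"]; simp add: assms t_def algebra_simps),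
     (rule zeta_into(4)[of _ "q + 1 - int d" _ "-4 - 4 * c"]; simp add: assms t_def algebra_simps),
     (rule zeta_into(5)[of _ "q + int d" _ "0 + 4 * c"]; simp add: assms t_def algebra_simps),
     (rule zeta_into(3)[of _ "q" _ "-4"]; simp add: assms t_def algebra_simps))

lemma T_zeta:
  assumes c: "int d = 4 * c + 2"
  shows "T True zeta"
proof (rule T_I)
  show "zeta v \<in> V" if "v \<in> V" for v
    using that by (elim V_cases) (simp_all add: zeta_eq)
  show "X 0 \<in> zeta ` V" by (rule image_eqI[of _ _ "X 0"]) (simp_all add: zeta_eq)
  fix v assume "v \<in> V"
  then show "\<exists>s1 s2. \<forall>D l. zeta (nbr v D l) = nbr (zeta v) (D \<noteq> s1) (l \<noteq> (s2 \<noteq> (True \<and> D)))"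
  proof (cases rule: V_cases)
    case (1 k)
    show ?thesis
      unfolding 1 by (cases k rule: int_mod3_cases; hypsubst; intro exI allI)
        (rule zeta_nbr_X0[OF c] zeta_nbr_X1[OF c] zeta_nbr_X2[OF c])+
  next
    case (2 k)
    show ?thesis
      unfolding 2 by (cases k rule: int_mod3_cases; hypsubst; intro exI allI)
        (rule zeta_nbr_Y0[OF c] zeta_nbr_Y1[OF c] zeta_nbr_Y2[OF c])+
  qed
qed



section \<open>Transitivity on arcs\<close>

lemma T_id: "T False id"
  unfolding T_def by (intro conjI ballI exI[of _ False]) simp_all

lemma T_FF: "T False \<sigma> \<Longrightarrow> T k \<tau> \<Longrightarrow> T k (\<tau> \<circ> \<sigma>)" "T k \<sigma> \<Longrightarrow> T False \<tau> \<Longrightarrow> T k (\<tau> \<circ> \<sigma>)"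
  using T_comp[of False \<sigma> k \<tau>] T_comp[of k \<sigma> False \<tau>] by simp_all

lemma theta_01: "theta (X 0) = X 0" "theta (X 1) = Y 0"
  by (simp_all add: theta_eq)

text \<open>Rotations have two orbits, all x and all y; \<open>theta\<close> joins them, as it sends
  x_1 to y_0.\<close>

lemma vertex_orbit:
  assumes "v \<in> V"
  obtains \<sigma> where "T False \<sigma>" "\<sigma> (X 0) = v"
  using assms
proof (cases rule: V_cases)
  case (1 k)
  then show ?thesis using that[of "rot k"] T_rot by simp
next
  case (2 k)
  show ?thesis
    by (rule that[of "rot k \<circ> (theta \<circ> rot 1)"])
      (use 2 T_FF(1)[OF T_FF(1)[OF T_rot T_theta] T_rot] in \<open>simp_all add: theta_01\<close>)
qed

text \<open>At x_0, \<open>theta\<close> exchanges the two upper neighbours and \<open>refl\<close>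
  sends upper to lower ones, so together they reach all four arcs, without interchanging the
  monotone matchings.\<close>

lemma arc_orbit:
  assumes "v \<in> V"
  obtains \<sigma> where "T False \<sigma>" "\<sigma> (X 0) = v" "\<sigma> (X 1) = nbr v D l"
proof -
  obtain \<sigma> where s: "T False \<sigma>" "\<sigma> (X 0) = v" using vertex_orbit[OF assms] .
  obtain s1 s2 where n: "\<And>D l. \<sigma> (nbr (X 0) D l) = nbr v (D \<noteq> s1) (l \<noteq> (s2 \<noteq> (False \<and> D)))"
    using TD[OF s(1) X_in, of 0] s(2) by metis
  have nn: "\<sigma> (nbr (X 0) (D \<noteq> s1) (l \<noteq> s2)) = nbr v D l"
    unfolding n by (intro arg_cong2[of _ _ _ _ "nbr v"]) auto
  have "\<exists>\<tau>. T False \<tau> \<and> \<tau> (X 0) = X 0 \<and> \<tau> (X 1) = nbr (X 0) D' l'" for D' l'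
  proof (cases D'; cases l')
    assume "D'" "l'"
    then show ?thesis using T_theta by (intro exI[of _ theta]) (simp add: nbr_simps theta_01)
  next
    assume "D'" "\<not> l'"
    then show ?thesis using T_id by (intro exI[of _ id]) (simp add: nbr_simps)
  next
    assume "\<not> D'" "l'"
    then show ?thesis using T_FF(1)[OF T_theta T_refl]
      by (intro exI[of _ "refl \<circ> theta"]) (simp add: nbr_simps theta_01)
  next
    assume "\<not> D'" "\<not> l'"
    then show ?thesis using T_refl by (intro exI[of _ refl]) (simp add: nbr_simps)
  qed
  then obtain \<tau> where t: "T False \<tau>" "\<tau> (X 0) = X 0" "\<tau> (X 1) = nbr (X 0) (D \<noteq> s1) (l \<noteq> s2)"
    by blast
  show ?thesis
    by (rule that[of "\<sigma> \<circ> \<tau>"]) (use T_FF(1)[OF t(1) s(1)] t s nn in simp_all)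
qed

text \<open>Alternates along edges only if m is even, because levels are taken modulo 3m.\<close>

definition par :: "vertex \<Rightarrow> bool" where
  "par v \<longleftrightarrow> odd (lev v)"

lemma par_mod:
  assumes "even m"
  shows "odd (a mod (3 * int m)) \<longleftrightarrow> odd a"
proof -
  have "even (3 * int m)" using assms by simp
  then show ?thesis by (rule dvd_mod_iff[THEN arg_cong[of _ _ Not]])
qed

lemma par_simps [simp]:
  assumes "even m"
  shows "par (X k) \<longleftrightarrow> odd k" "par (Y k) \<longleftrightarrow> even k"
  using par_mod[OF assms] by (simp_all add: par_def)

lemma par_nbr:
  assumes "even m" "v \<in> V"
  shows "par (nbr v D l) \<longleftrightarrow> \<not> par v"
  unfolding par_def lev_nbr[OF assms(2)] par_mod[OF assms(1)] by simp

text \<open>Parity alternates along every edge and along its image, so it is preserved everywhere or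
  reversed everywhere; the image of x_0 decides.\<close>

lemma T_par:
  assumes "even m" "T k \<sigma>" "v \<in> V"
  shows "par (\<sigma> v) = (par v \<noteq> par (\<sigma> (X 0)))"
proof (rule connected_induct[of "\<lambda>v. par (\<sigma> v) = (par v \<noteq> par (\<sigma> (X 0)))", OF _ _ assms(3)])
  show "par (\<sigma> (X 0)) = (par (X 0) \<noteq> par (\<sigma> (X 0)))" using assms(1) by simp
  fix v D l assume v: "v \<in> V" "par (\<sigma> v) = (par v \<noteq> par (\<sigma> (X 0)))"
  obtain s1 s2 where n: "\<And>D l. \<sigma> (nbr v D l) = nbr (\<sigma> v) (D \<noteq> s1) (l \<noteq> (s2 \<noteq> (k \<and> D)))"
    using TD[OF assms(2) v(1)] by blast
  show "par (\<sigma> (nbr v D l)) = (par (nbr v D l) \<noteq> par (\<sigma> (X 0)))"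
    unfolding n par_nbr[OF assms(1) v(1)] par_nbr[OF assms(1) T_in[OF assms(2) v(1)]] using v(2) by blast
qed

abbreviation cO :: "vertex \<Rightarrow> kind" where "cO \<equiv> \<lambda>_. (False, True)"
abbreviation cM :: "(vertex \<Rightarrow> bool) \<Rightarrow> vertex \<Rightarrow> kind" where
  "cM \<phi> \<equiv> \<lambda>v. (True, \<phi> v)"

lemma pres_cO: "T k \<sigma> \<Longrightarrow> pres k \<sigma> cO cO"
  by (simp add: pres_def twist_def)

lemma pres_const: "T False \<sigma> \<Longrightarrow> pres False \<sigma> (\<lambda>_. j) (\<lambda>_. j)"
  by (simp add: pres_def twist_def)

lemma arc_transitive_const: "arc_transitive (\<lambda>_. j) (\<lambda>_. j')"
  unfolding arc_transitive_def
proof (intro ballI allI)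
  fix v D l assume "v \<in> V"
  then obtain \<sigma> where "T False \<sigma>" "\<sigma> (X 0) = v" "\<sigma> (X 1) = nbr v D l" by (rule arc_orbit)
  then show "\<exists>k \<sigma>. pres k \<sigma> (\<lambda>_. j) (\<lambda>_. j) \<and> pres k \<sigma> (\<lambda>_. j') (\<lambda>_. j') \<and> \<sigma> (X 0) = v \<and> \<sigma> (X 1) = nbr v D l"
    using pres_const by blast
qed

lemma d_mod_4:
  assumes "m mod 4 = 2"
  obtains c where "int d = 4 * c + 2"
proof -
  have "d mod 4 = 2" using d_cases assms by presburger
  then have "int d = 4 * int (d div 4) + 2" by presburger
  then show ?thesis by (rule that)
qed

lemma zeta_01: "zeta (X 0) = X 0" "zeta (X 1) = X 1"
  by (simp_all add: zeta_eq)

text \<open>An untwisted automorphism that reverses the parity of levels turns the alternating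
  choice into its opposite. Precomposing with \<open>zeta\<close> corrects this by interchanging the
  monotone matchings and leaves the base arc in place.\<close>

lemma arc_transitive_par:
  assumes "m mod 4 = 2"
  shows "arc_transitive cO (cM par)"
  unfolding arc_transitive_def
proof (intro ballI allI)
  fix v D l assume "v \<in> V"
  then obtain \<sigma> where s: "T False \<sigma>" "\<sigma> (X 0) = v" "\<sigma> (X 1) = nbr v D l" by (rule arc_orbit)
  have ev: "even m" using assms by presburger
  obtain c where c: "int d = 4 * c + 2" using d_mod_4[OF assms] .
  show "\<exists>k \<sigma>. pres k \<sigma> cO cO \<and> pres k \<sigma> (cM par) (cM par) \<and> \<sigma> (X 0) = v \<and> \<sigma> (X 1) = nbr v D l"
  proof (cases "par v")
    case False
    then have "pres False \<sigma> (cM par) (cM par)"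
      using s(1) T_par[OF ev s(1)] s(2) by (auto simp: pres_def twist_def)
    then show ?thesis using s pres_cO by blast
  next
    case True
    let ?\<tau> = "\<sigma> \<circ> zeta"
    have t: "T True ?\<tau>" using T_FF(2)[OF T_zeta[OF c] s(1)] .
    have "?\<tau> (X 0) = v" "?\<tau> (X 1) = nbr v D l" using s by (simp_all add: zeta_01)
    moreover have "pres True ?\<tau> (cM par) (cM par)"
      using t T_par[OF ev t] True \<open>?\<tau> (X 0) = v\<close> by (auto simp: pres_def twist_def)
    ultimately show ?thesis using pres_cO[OF t] by blast
  qed
qed

section \<open>Cyclic families\<close>

text \<open>Links from an edge of f stay in f, since a matching determines the partner of an edge;
  conversely f is connected, so one component exhausts it.\<close>

lemma face_comp:
  assumes "is_face_cycle E f" "e \<in> f"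
    and "\<And>v a b. {v, a} \<in> f \<Longrightarrow> {v, b} \<in> f \<Longrightarrow> a \<noteq> b \<Longrightarrow> v \<in> V \<and> S (c v) v a b"
  shows "f = comp c e"
proof
  have fE: "f \<subseteq> E" using assms(1) by (auto simp: is_face_cycle_def)
  show "f \<subseteq> comp c e"
  proof (rule face_connected[OF assms(1,2) comp_refl])
    fix v x y assume h: "x \<in> comp c e" "x \<in> f" "y \<in> f" "v \<in> x" "v \<in> y" "x \<noteq> y"
    then have "x \<in> E" "y \<in> E" using fE by auto
    obtain D l where x: "v \<in> V" "x = {v, nbr v D l}" using E_cases[OF \<open>x \<in> E\<close> h(4)] .
    obtain D' l' where y: "y = {v, nbr v D' l'}" using E_cases[OF \<open>y \<in> E\<close> h(5)] .
    have "S (c v) v (nbr v D l) (nbr v D' l')"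
      using assms(3)[of v "nbr v D l" "nbr v D' l'"] h x y by auto
    then show "y \<in> comp c e" using comp_step[of v "nbr v D l" c e] h(1) x y by blast
  qed
  show "comp c e \<subseteq> f"
  proof
    fix x assume "x \<in> comp c e"
    then have "(link c)\<^sup>*\<^sup>* e x" by (simp add: comp_def)
    then show "x \<in> f"
    proof (induction rule: rtranclp_induct)
      case base then show ?case by (rule assms(2))
    next
      case (step y z)
      obtain v a b where l: "v \<in> V" "S (c v) v a b" "y = {v, a}" "z = {v, b}"
        using step(2) unfolding link_def by blast
      have "v \<in> y" using l by simp
      obtain p q where pq: "p \<noteq> q" "{e \<in> f. v \<in> e} = {{v, p}, {v, q}}"
        by (rule face_star[OF assms(1) \<open>v \<in> y\<close> step(3)])
      have "y \<in> {{v, p}, {v, q}}" using step(3) \<open>v \<in> y\<close> pq(2) by blast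
      then obtain a' b' where ab: "y = {v, a'}" "{v, b'} \<in> f" "a' \<noteq> b'" "{v, a'} \<in> f"
        using pq step(3) by blast
      have "a' = a" using ab(1) l(3) by (auto simp: doubleton_eq_iff)
      then have "S (c v) v a b'" using assms(3)[OF ab(4,2,3)] by simp
      then have "b' = b" using S_unique[OF l(1) _ l(2)] by blast
      then show ?case using ab(2) l(4) by simp
    qed
  qed
qed

lemma closed_walk_comp:
  assumes w: "closed_walk w L f"
    and S: "\<And>i. w i \<in> V \<and> S (c (w (Suc i))) (w (Suc i)) (w i) (w (Suc (Suc i)))"
  shows "is_face_cycle E (comp c {w 0, w 1})"
proof -
  have f: "f = range (\<lambda>i. {w i, w (Suc i)})" using w by (simp add: closed_walk_def)
  have "{w i, w (Suc i)} \<in> E" for i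
  proof -
    have "{w (Suc i), w i} \<in> E" using S_edges[of "w (Suc i)"] S by blast
    then show ?thesis by (simp add: insert_commute)
  qed
  then have fE: "f \<subseteq> E" unfolding f by blast
  have fc: "is_face_cycle E f" using face_cycleI[OF w fE] .
  have "f = comp c {w 0, w 1}"
  proof (rule face_comp[OF fc])
    show "{w 0, w 1} \<in> f" unfolding f by (rule range_eqI[of _ _ 0]) simp
    fix v a b assume h: "{v, a} \<in> f" "{v, b} \<in> f" "a \<noteq> b"
    obtain i where i: "v = w (Suc i)" "w i \<noteq> w (Suc (Suc i))" "w i \<noteq> w (Suc i)"
      "w (Suc i) \<noteq> w (Suc (Suc i))"
      "{e \<in> f. v \<in> e} = {{v, w i}, {v, w (Suc (Suc i))}}"
      by (rule walk_star[OF w _ h(1), of v]) simp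
    have "{v, a} \<in> {{v, w i}, {v, w (Suc (Suc i))}}" "{v, b} \<in> {{v, w i}, {v, w (Suc (Suc i))}}"
      using h(1,2) unfolding i(5)[symmetric] by simp_all
    then have "a = w i \<and> b = w (Suc (Suc i)) \<or> b = w i \<and> a = w (Suc (Suc i))"
      using h(3) by (auto simp: doubleton_eq_iff)
    then show "v \<in> V \<and> S (c v) v a b" using S[of i] S[of "Suc i"] S_sym i(1) by blast
  qed
  then show ?thesis using fc by simp
qed

lemma valid_cM: "valid (cM \<phi>)" "valid cO"
  by (simp_all add: valid_def)

text \<open>Arc-transitivity carries one face of the family onto all others.\<close>

lemma cyclic_from_one:
  assumes "valid c" "arc_transitive c' c" "e0 \<in> E" "is_face_cycle E (comp c e0)"
  shows "cyclic c"
  unfolding cyclic_def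
proof (intro conjI ballI assms(1))
  fix e assume e: "e \<in> E"
  obtain v where v: "v \<in> e" using e unfolding E_eq by blast
  obtain v0 where v0: "v0 \<in> e0" using assms(3) unfolding E_eq by blast
  obtain k \<sigma> where s: "pres k \<sigma> c' c'" "pres k \<sigma> c c" "\<sigma> ` e0 = e"
    using arc_transitiveD[OF assms(2) v0 assms(3) v e] by metis
  have "is_face_cycle E (face_img \<sigma> (comp c e0))"
    using is_face_cycle_img[OF _ assms(4)] s(2) by (auto simp: pres_def)
  then show "is_face_cycle E (comp c e)" using face_img_comp[OF s(2) assms(3)] s(3) by simp
qed

text \<open>In a finite graph some vertex repeats, and \<open>step\<close> moves a coincidence along
  the walk in both directions. So the walk is periodic from its start, with the least return time as
  period and no further coincidences; loops and backtracking are impossible, which makes the period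
  at least three.\<close>

lemma closed_walk_exists:
  fixes w :: "nat \<Rightarrow> vertex"
  assumes S: "\<And>i. w i \<in> V \<and> S (c (w (Suc i))) (w (Suc i)) (w i) (w (Suc (Suc i)))"
    and "valid c"
    and step: "\<And>i j. w i = w j \<longleftrightarrow> w (Suc i) = w (Suc j)"
  obtains L f where "closed_walk w L f"
proof -
  have shift: "w i = w j \<longleftrightarrow> w (i + k) = w (j + k)" for i j k
    by (induction k) (use step in auto)
  have "\<not> inj w"
    using finite_subset[of "range w" V] S finite_V by (auto dest: finite_imageD)
  then obtain i j where "w i = w j" "i < j" unfolding inj_def by (metis linorder_neqE_nat)
  then have "w (j - i) = w 0" using shift[of 0 "j - i" i] by simp
  then have ex: "\<exists>L. L > 0 \<and> w L = w 0" using \<open>i < j\<close> by (intro exI[of _ "j - i"]) simp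
  define L where "L = (LEAST L. L > 0 \<and> w L = w 0)"
  have L: "L > 0" "w L = w 0" using LeastI_ex[OF ex] by (auto simp: L_def)
  have least: "L \<le> k" if "k > 0" "w k = w 0" for k
    using that by (auto simp: L_def intro: Least_le)
  have per: "w (i + q * L) = w i" for i q
  proof (induction q)
    case (Suc q)
    have "w (L + (i + q * L)) = w (0 + (i + q * L))" using shift[of L 0] L(2) by blast
    then show ?case using Suc by (simp add: algebra_simps)
  qed simp
  have red: "w i = w (i mod L)" for i
    using per[of "i mod L" "i div L"] by simp
  have small: "i = j" if "w i = w j" "i \<le> j" "j < L" for i j
  proof (rule ccontr)
    assume "i \<noteq> j"
    then have "w (j - i) = w 0" using shift[of 0 "j - i" i] that by simp
    then show False using least[of "j - i"] that \<open>i \<noteq> j\<close> by simp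
  qed
  have iff: "w i = w j \<longleftrightarrow> i mod L = j mod L" for i j
  proof
    assume "w i = w j"
    then have e: "w (i mod L) = w (j mod L)" using red by metis
    have "i mod L < L" "j mod L < L" using L(1) by simp_all
    then show "i mod L = j mod L" using small[OF e] small[OF e[symmetric]] by (metis nat_le_linear)
  next
    assume "i mod L = j mod L"
    then show "w i = w j" using red by metis
  qed
  have "w 0 \<noteq> w 1"
  proof
    assume "w 0 = w 1"
    moreover have "w 1 \<in> V" using S by blast
    moreover obtain D l where "w 0 = nbr (w 1) D l" using S[of 0] unfolding S_def by auto
    ultimately show False using nbr_neq[of "w 1" D l] by simp
  qed
  moreover have "w 0 \<noteq> w 2"
  proof
    assume "w 0 = w 2"
    then have "S (c (w 1)) (w 1) (w 0) (w 0)" using S[of 0] by (simp add: numeral_2_eq_2)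
    moreover have "w 1 \<in> V" using S by blast
    ultimately show False using S_irrefl assms(2) unfolding valid_def by metis
  qed
  ultimately have "L \<noteq> 1" "L \<noteq> 2" using L(2) by metis+
  then have "L \<ge> 3" using L(1) by linarith
  then show ?thesis using that[of L "range (\<lambda>i. {w i, w (Suc i)})"] iff by (simp add: closed_walk_def)
qed

lemma cyclic_walk:
  fixes w :: "nat \<Rightarrow> vertex"
  assumes "valid c" "arc_transitive c' c"
    and S: "\<And>i. w i \<in> V \<and> S (c (w (Suc i))) (w (Suc i)) (w i) (w (Suc (Suc i)))"
    and "\<And>i j. w i = w j \<longleftrightarrow> w (Suc i) = w (Suc j)"
  shows "cyclic c"
proof -
  obtain L f where w: "closed_walk w L f" by (rule closed_walk_exists[of w c, OF S assms(1,4)])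
  have "{w 1, w 0} \<in> E" using S_edges[of "w 1" "c (w 1)" "w 0" "w 2"] S[of 0] S[of 1]
    by (simp add: numeral_2_eq_2)
  then have "{w 0, w 1} \<in> E" by (simp add: insert_commute)
  then show ?thesis using cyclic_from_one[OF assms(1,2)] closed_walk_comp[of w L f c, OF w S] by blast
qed

text \<open>The rim x_0, x_1, x_2, ... is a face: \<open>(True, False)\<close> pairs x_(k-1) with
  x_(k+1) at x_k.\<close>

lemma cyclic_M0: "cyclic (cM (\<lambda>_. False))"
proof (rule cyclic_walk[OF valid_cM(1) arc_transitive_const, where w = "\<lambda>i. X (int i)"])
  fix i :: nat
  have "S (True, False) (X (int i + 1)) (nbr (X (int i + 1)) False False) (nbr (X (int i + 1)) True False)"
    by (simp add: S_nbr_nbr)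
  then show "X (int i) \<in> V \<and> S (True, False) (X (int (Suc i))) (X (int i)) (X (int (Suc (Suc i))))"
    by (simp add: nbr_simps algebra_simps)
qed (simp add: X_eq_iff)

text \<open>The walk through the y with step 1 - t is a face: at a y, \<open>(True, True)\<close>
  pairs its two neighbours among the y.\<close>

lemma cyclic_M1: "cyclic (cM (\<lambda>_. True))"
proof (rule cyclic_walk[OF valid_cM(1) arc_transitive_const, where w = "\<lambda>i. Y (int i * (1 - t))"])
  fix i :: nat
  let ?k = "(int i + 1) * (1 - t)"
  have "S (True, True) (Y ?k) (nbr (Y ?k) False True) (nbr (Y ?k) True False)"
    by (simp add: S_nbr_nbr)
  then show "Y (int i * (1 - t)) \<in> V \<and>
     S (True, True) (Y (int (Suc i) * (1 - t))) (Y (int i * (1 - t))) (Y (int (Suc (Suc i)) * (1 - t)))"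
    by (simp add: nbr_simps algebra_simps)
qed (simp add: Y_eq_iff algebra_simps)

text \<open>With indices split as a + b * t, equality of vertices is read off from a and from b modulo 4.\<close>

definition Xp :: "int \<Rightarrow> int \<Rightarrow> vertex" where "Xp a b = X (a + b * t)"
definition Yp :: "int \<Rightarrow> int \<Rightarrow> vertex" where "Yp a b = Y (a + b * t)"

lemma nbr_p:
  "nbr (Xp a b) True False = Xp (a + 1) b" "nbr (Xp a b) True True = Yp a b"
  "nbr (Xp a b) False False = Xp (a - 1) b" "nbr (Xp a b) False True = Yp (a - 2) (b - 1)"
  "nbr (Yp a b) True False = Yp (a + 1) (b - 1)" "nbr (Yp a b) True True = Xp (a + 2) (b + 1)"
  "nbr (Yp a b) False False = Xp a b" "nbr (Yp a b) False True = Yp (a - 1) (b + 1)"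
  by (simp_all add: Xp_def Yp_def nbr_simps algebra_simps)

lemma p_in [simp]: "Xp a b \<in> V" "Yp a b \<in> V"
  by (simp_all add: Xp_def Yp_def)

lemma p_distinct [simp]: "Xp a b \<noteq> Yp a' b'" "Yp a' b' \<noteq> Xp a b"
  by (simp_all add: Xp_def Yp_def)

text \<open>3 divides the number 3m of levels, so positions that differ modulo 3 give different
  vertices whatever m is. This makes the finite computations below uniform in m, including m =
  1.\<close>

lemma p_eq_iff:
  assumes "a = a' \<or> \<not> 3 dvd a - a'"
  shows "Xp a b = Xp a' b' \<longleftrightarrow> a = a' \<and> 4 dvd b - b'" "Yp a b = Yp a' b' \<longleftrightarrow> a = a' \<and> 4 dvd b - b'"
proof -
  have "3 dvd a - a'" if "n dvd (a - a') + (b - b') * t"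
    using level_dvd[OF that] by (rule dvd_mult_left)
  then have "n dvd (a - a') + (b - b') * t \<longleftrightarrow> a = a' \<and> 4 dvd b - b'"
    using assms n_dvd_t_iff[of "b - b'"] by auto
  moreover have "a + b * t - (a' + b' * t) = (a - a') + (b - b') * t" by (simp add: algebra_simps)
  ultimately show "Xp a b = Xp a' b' \<longleftrightarrow> a = a' \<and> 4 dvd b - b'" "Yp a b = Yp a' b' \<longleftrightarrow> a = a' \<and> 4 dvd b - b'"
    unfolding Xp_def Yp_def X_eq_iff Y_eq_iff by (simp_all only:)
qed

text \<open>A flat walk zigzags between two consecutive levels. Four steps shift the index by 2t,
  and eight steps close up because 4t vanishes modulo n.\<close>

definition oct_cycle :: "vertex list" where
  "oct_cycle = [Xp 0 0, Xp 1 0, Yp (-1) (-1), Yp 0 2, Xp 0 2, Xp 1 2, Yp (-1) 1, Yp 0 0]"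

lemma oct_cycle_S:
  "oct_cycle ! (i mod 8) \<in> V \<and>
   S (False, True) (oct_cycle ! (Suc i mod 8)) (oct_cycle ! (i mod 8)) (oct_cycle ! (Suc (Suc i) mod 8))"
proof -
  have "i mod 8 < 8" by simp
  then have "i mod 8 \<in> {0,1,2,3,4,5,6,7}" by auto
  moreover have "Suc i mod 8 = Suc (i mod 8) mod 8" "Suc (Suc i) mod 8 = Suc (Suc (i mod 8)) mod 8"
    by (simp_all add: mod_Suc_eq mod_Suc_Suc_eq)
  ultimately show ?thesis
    by (auto simp: oct_cycle_def S_def ex_bool_eq nbr_p p_eq_iff)
qed

lemma cyclic_O: "cyclic cO"
proof -
  have dist: "distinct oct_cycle" and len: "length oct_cycle = 8"
    by (simp_all add: oct_cycle_def p_eq_iff)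
  let ?w = "\<lambda>i. oct_cycle ! (i mod 8)"
  have w: "closed_walk ?w 8 (range (\<lambda>i. {?w i, ?w (Suc i)}))"
    unfolding closed_walk_def using dist by (simp add: nth_eq_iff_index_eq len)
  have "is_face_cycle E (comp cO {?w 0, ?w 1})"
    by (rule closed_walk_comp[of ?w, OF w oct_cycle_S])
  moreover have "{?w 0, ?w 1} \<in> E" using edge_01 by (simp add: oct_cycle_def Xp_def)
  ultimately show ?thesis using cyclic_from_one[OF valid_cM(2) arc_transitive_const] by blast
qed

text \<open>Six steps along the alternating family amount to the rotation by 6 - t, and the six steps
  are told apart by the index modulo 6.\<close>

lemma cyclic_par:
  assumes "m mod 4 = 2"
  shows "cyclic (cM par)"
proof -
  have ev: "even m" using assms by presburger
  have six: "6 dvd n" "6 dvd t" using ev d_cases by (auto simp: n_def t_def)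
  \<comment> \<open>The first six vertices of the walk along x_0, x_1 that turns by
    \<open>(True, True)\<close> on odd levels and by \<open>(True, False)\<close> on even
    ones.\<close>
  define b where "b r = (if r = 0 then Xp 0 0 else if r = 1 then Xp 1 0 else if r = 2 then Yp 1 0 else
    if r = 3 then Yp 2 (-1) else if r = 4 then Yp 3 (-2) else Xp 5 (-1))" for r :: nat
  define w where "w i = rot (int (i div 6) * (6 - t)) (b (i mod 6))" for i
  have bV: "b r \<in> V" for r by (simp add: b_def)
  have evt: "even t" using six(2) by (meson dvd_trans even_numeral)
  have lt6: "i mod 6 \<in> {0,1,2,3,4,5}" for i :: nat
  proof -
    have "i mod 6 < 6" by simp
    then show ?thesis by auto
  qed
  have S: "w i \<in> V \<and> S (cM par (w (Suc i))) (w (Suc i)) (w i) (w (Suc (Suc i)))" for i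
  proof -
    define q r where "q = i div 6" and "r = i mod 6"
    have i: "i = 6 * q + r" by (simp add: q_def r_def)
    have r: "r \<in> {0,1,2,3,4,5}" using lt6 by (simp add: r_def)
    \<comment> \<open>A corner involves the next two vertices, so the list is continued into the
      following period.\<close>
    define b' where "b' s = (if s < 6 then b s else rot (6 - t) (b (s - 6)))" for s
    have w: "w (6 * q + s) = rot (int q * (6 - t)) (b' s)" if "s < 8" for s
    proof (cases "s < 6")
      case True then show ?thesis by (simp add: w_def b'_def)
    next
      case False
      then have "(6 * q + s) div 6 = q + 1" "(6 * q + s) mod 6 = s - 6"
        using that by presburger+
      moreover have "rot a (rot a' v) = rot (a + a') v" if "v \<in> V" for a a' v
        using that by (elim V_cases) (simp_all add: algebra_simps)
      ultimately show ?thesis using False bV by (simp add: w_def b'_def distrib_right add.commute)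
    qed
    have base: "b' s \<in> V \<and> S (True, par (b' (Suc s))) (b' (Suc s)) (b' s) (b' (Suc (Suc s)))" if "s \<in> {0,1,2,3,4,5}" for s
    proof -
      have "S (True, True) (Xp 1 0) (Xp 0 0) (Yp 1 0)" "S (True, False) (Yp 1 0) (Xp 1 0) (Yp 2 (-1))"
        "S (True, True) (Yp 2 (-1)) (Yp 1 0) (Yp 3 (-2))" "S (True, False) (Yp 3 (-2)) (Yp 2 (-1)) (Xp 5 (-1))"
        "S (True, True) (Xp 5 (-1)) (Yp 3 (-2)) (Xp 6 (-1))" "S (True, False) (Xp 6 (-1)) (Xp 5 (-1)) (Xp 7 (-1))"
        by (simp_all add: S_def ex_bool_eq nbr_p p_eq_iff)
      moreover have "b' 0 = Xp 0 0" "b' (Suc 0) = Xp 1 0" "b' (Suc (Suc 0)) = Yp 1 0" "b' 2 = Yp 1 0"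
        "b' (Suc (Suc (Suc 0))) = Yp 2 (-1)" "b' 3 = Yp 2 (-1)" "b' 4 = Yp 3 (-2)" "b' 5 = Xp 5 (-1)"
        "b' 6 = Xp 6 (-1)" "b' 7 = Xp 7 (-1)"
        by (simp_all add: b'_def b_def, simp_all add: Xp_def)
      moreover have "par (Xp 1 0)" "\<not> par (Yp 1 0)" "par (Yp 2 (-1))" "\<not> par (Yp 3 (-2))"
        "par (Xp 5 (-1))" "\<not> par (Xp 6 (-1))"
        using evt by (simp_all add: Xp_def Yp_def par_simps[OF ev])
      ultimately show ?thesis using that by (elim insertE emptyE) simp_all
    qed
    let ?\<rho> = "rot (int q * (6 - t))"
    have T: "T False ?\<rho>" by (rule T_rot)
    have b'V: "b' s \<in> V" for s using bV T_in[OF T_rot] by (simp add: b'_def)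
    have parw: "par (?\<rho> v) = par v" if "v \<in> V" for v
      using T_par[OF ev T that] evt par_simps[OF ev] by simp
    have "S (True, par (b' (Suc r))) (?\<rho> (b' (Suc r))) (?\<rho> (b' r)) (?\<rho> (b' (Suc (Suc r))))"
      using T_S[OF T b'V conjunct2[OF base[OF r]]] by (simp add: twist_def)
    then have "w (6 * q + r) \<in> V \<and> S (True, par (w (6 * q + Suc r))) (w (6 * q + Suc r))
        (w (6 * q + r)) (w (6 * q + Suc (Suc r)))"
      using r w[of r] w[of "Suc r"] w[of "Suc (Suc r)"] T_in[OF T b'V] parw[OF b'V] by auto
    then show ?thesis by (simp add: i)
  qed
  have inj: "w i = w j \<longleftrightarrow> i mod 6 = j mod 6 \<and> n dvd (int (i div 6) - int (j div 6)) * (6 - t)" for i j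
  proof -
    \<comment> \<open>Rotations by multiples of 6 - t keep the key, because 6 divides n and t, and
      the six vertices of \<open>b\<close> have different keys.\<close>
    define key where "key v = (fst v, int (snd v) mod 6)" for v :: "vertex"
    have key_XY: "key (X k) = (False, k mod 6)" "key (Y k) = (True, k mod 6)" for k
      by (simp_all add: key_def mod_mod_cancel[OF six(1)])
    have key_rot: "key (rot (q * (6 - t)) v) = key v" if "v \<in> V" for q v
    proof -
      have "6 dvd q * (6 - t)" using six(2) by simp
      then show ?thesis using that
        by (elim V_cases) (auto simp: key_XY mod_add_eq[symmetric] elim!: dvdE)
    qed
    obtain t6 where t6: "t = 6 * t6" using six(2) by (elim dvdE)
    have key_b: "key (b r) = key (b s) \<Longrightarrow> r = s" if "r \<in> {0,1,2,3,4,5}" "s \<in> {0,1,2,3,4,5}" for r s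
    proof -
      have m: "(2 - t) mod 6 = 2" "(3 - 2 * t) mod 6 = 3" "(5 - t) mod 6 = 5"
        unfolding t6 by presburger+
      show "key (b r) = key (b s) \<Longrightarrow> r = s"
        using that by (auto simp: b_def Xp_def Yp_def key_XY m)
    qed
    have rot_eq: "rot a v = rot a' v \<longleftrightarrow> n dvd a - a'" if "v \<in> V" for a a' v
      using that by (elim V_cases) (simp_all add: X_eq_iff Y_eq_iff)
    have "i mod 6 = j mod 6" if "w i = w j"
      using arg_cong[OF that, of key] key_b[OF lt6 lt6] by (simp add: w_def key_rot[OF bV])
    then show ?thesis
      using rot_eq[OF bV] by (auto simp: w_def left_diff_distrib)
  qed
  have step: "w i = w j \<longleftrightarrow> w (Suc i) = w (Suc j)" for i j
  proof -
    have m: "i mod 6 = j mod 6 \<longleftrightarrow> Suc i mod 6 = Suc j mod 6" by (auto simp: mod_Suc)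
    have "i mod 6 = j mod 6 \<Longrightarrow> int (i div 6) - int (j div 6) = int (Suc i div 6) - int (Suc j div 6)"
      by (simp add: div_Suc mod_Suc)
    then show ?thesis unfolding inj using m by metis
  qed
  show ?thesis
    by (rule cyclic_walk[of _ _ w, OF valid_cM(1) arc_transitive_par[OF assms] S step])
qed


section \<open>All automorphisms\<close>

text \<open>Rigidity: k, the image of a vertex and the image of one neighbour determine the images
  of all its neighbours.\<close>

lemma T_step:
  assumes "T k \<sigma>" "v \<in> V" "\<sigma> v = v'" "\<sigma> (nbr v D1 l1) = nbr v' E1 r1"
  shows "\<sigma> (nbr v D2 l2) = nbr v' (E1 \<noteq> (D1 \<noteq> D2)) (r1 \<noteq> ((l1 \<noteq> l2) \<noteq> (k \<and> (D1 \<noteq> D2))))"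
proof -
  obtain s1 s2 where n: "\<And>D l. \<sigma> (nbr v D l) = nbr v' (D \<noteq> s1) (l \<noteq> (s2 \<noteq> (k \<and> D)))"
    using TD[OF assms(1,2)] assms(3) by metis
  have "v' \<in> V" using T_in[OF assms(1,2)] assms(3) by simp
  then have "(D1 \<noteq> s1) = E1" "(l1 \<noteq> (s2 \<noteq> (k \<and> D1))) = r1"
    using assms(4) unfolding n by (simp_all add: nbr_eq_iff)
  then show ?thesis unfolding n by (intro arg_cong2[of _ _ _ _ "nbr v'"]) blast+
qed

text \<open>The path x_0, x_1, ..., x_t leads to the image x_{t + dt} of x_t, and the short walk
  x_0, x_{-1}, y_{-1}, x_{1+t}, x_t leads to the image x_{-t}.\<close>

lemma twisted_fixing_arc:
  assumes T: "T True \<sigma>" and 0: "\<sigma> (X 0) = X 0" and 1: "\<sigma> (X 1) = X 1"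
  shows "m mod 4 = 2"
proof -
  note step = T_step[OF T]
  \<comment> \<open>After three steps the image path is back on the x-rim, shifted by
    \<open>t\<close>; the same recursion is behind the term \<open>k div 3 * t\<close> of
    \<open>zeta\<close>.\<close>
  have far: "\<sigma> (X (3 * int q)) = X (int q * (3 + t)) \<and> \<sigma> (X (3 * int q + 1)) = X (int q * (3 + t) + 1)" for q
  proof (induction q)
    case 0 then show ?case using assms by simp
  next
    case (Suc q)
    let ?k = "3 * int q" and ?b = "int q * (3 + t)"
    have 0: "\<sigma> (X ?k) = X ?b" and 1: "\<sigma> (X (?k + 1)) = X (?b + 1)" using Suc by auto
    have 2: "\<sigma> (X (?k + 2)) = Y (?b + 1)"
      using step[OF X_in 1, of False False False False True False] 0
      by (simp add: nbr_simps add.commute add.left_commute)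
    have 3: "\<sigma> (X (?k + 3)) = X (?b + 3 + t)"
      using step[OF X_in 2, of False False False False True False] 1
      by (simp add: nbr_simps add.commute add.left_commute)
    have 4: "\<sigma> (X (?k + 4)) = X (?b + 4 + t)"
      using step[OF X_in 3, of False False False True True False] 2
      by (simp add: nbr_simps add.commute add.left_commute)
    have e: "3 * int (Suc q) = ?k + 3" "?k + 3 + 1 = ?k + 4"
      "int (Suc q) * (3 + t) = ?b + 3 + t" "?b + 3 + t + 1 = ?b + 4 + t"
      by (simp_all add: algebra_simps)
    show ?case unfolding e using 3 4 by simp
  qed
  have "\<sigma> (X (3 * int d)) = X (int d * (3 + t))" using far by blast
  then have "\<sigma> (X t) = X (t + int d * t)" by (simp add: t_def algebra_simps)
  moreover have "\<sigma> (X t) = X (- t)"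
  proof -
    have a: "\<sigma> (X (- 1)) = Y (- 2 - t)"
      using step[OF X_in 0, of True False True False False False] 1 by (simp add: nbr_simps)
    have b: "\<sigma> (Y (- 1)) = Y (- 1 - 2 * t)"
      using step[OF X_in a, of True False True True True True] 0
      by (simp add: nbr_simps Y_eq_iff)
    have c: "\<sigma> (X (1 + t)) = X (1 - t)"
      using step[OF Y_in b, of False False False True True True] a
      by (simp add: nbr_simps Y_eq_iff X_eq_iff)
    show ?thesis
      using step[OF X_in c, of False True False True False False] b
      by (simp add: nbr_simps Y_eq_iff)
  qed
  ultimately have "X (t + int d * t) = X (- t)" by simp
  then have "n dvd (t + int d * t) - (- t)" by (simp only: X_eq_iff)
  then have "n dvd (int d + 2) * t" by (simp add: algebra_simps)
  then have "4 dvd int d + 2" by (simp only: n_dvd_t_iff)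
  then have "(int d + 2) mod 4 = 0" by simp
  moreover have "int d = int m \<or> int d = 11 * int m" using d_cases by auto
  moreover have "y mod 4 = 2" if "(y + 2) mod 4 = 0 \<or> (11 * y + 2) mod 4 = 0" for y :: int
    using that by presburger
  ultimately have "int m mod 4 = 2" by metis
  then show ?thesis by (simp add: zmod_int[of _ 4, symmetric, simplified] flip: of_nat_eq_iff)
qed

text \<open>Dividing by an untwisted automorphism with the same effect on the base arc leaves a
  twisted one that fixes this arc.\<close>

lemma T_True_mod4:
  assumes "T True \<sigma>"
  shows "m mod 4 = 2"
proof -
  obtain s1 s2 where n: "\<And>D l. \<sigma> (nbr (X 0) D l) = nbr (\<sigma> (X 0)) (D \<noteq> s1) (l \<noteq> (s2 \<noteq> (True \<and> D)))"
    using TD[OF assms X_in] by blast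
  obtain \<tau> where t: "T False \<tau>" "\<tau> (X 0) = \<sigma> (X 0)" "\<tau> (X 1) = \<sigma> (nbr (X 0) True False)"
    unfolding n using arc_orbit[OF T_in[OF assms X_in]] by metis
  have b: "bij_betw \<tau> V V" using T_bij[OF t(1)] .
  let ?\<rho> = "inv_into V \<tau> \<circ> \<sigma>"
  have "T True ?\<rho>" using T_FF(2)[OF assms T_inv[OF t(1)]] .
  moreover have "?\<rho> (X 0) = X 0" "?\<rho> (X 1) = X 1"
    using t b bij_betw_inv_into_left[OF b X_in] by (simp_all add: nbr_simps) (metis+)
  ultimately show ?thesis by (rule twisted_fixing_arc)
qed

section \<open>Closed walks of length six and eight as invariants\<close>

definition hex :: "vertex \<Rightarrow> vertex \<Rightarrow> vertex \<Rightarrow> vertex \<Rightarrow> bool" where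
  "hex a b c z \<longleftrightarrow> (\<exists>e f. {z, e} \<in> E \<and> {e, f} \<in> E \<and> {f, a} \<in> E \<and>
     e \<noteq> c \<and> f \<noteq> z \<and> a \<noteq> e \<and> b \<noteq> f)"

text \<open>\<open>hex\<close> continues the path a, b, c, z by two vertices to a closed walk of
  length six that does not turn back at z, e, f and a. In terms of flags its existence is a finite
  search that \<open>simp\<close> can carry out.\<close>

lemma hex_nbr:
  assumes "a \<in> V" "z \<in> V"
  shows "hex a b c z \<longleftrightarrow> (\<exists>D l D' l' D'' l''. nbr (nbr z D l) D'' l'' = nbr a D' l' \<and>
     nbr z D l \<noteq> c \<and> nbr a D' l' \<noteq> z \<and> a \<noteq> nbr z D l \<and> b \<noteq> nbr a D' l')"
proof
  assume "hex a b c z"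
  then obtain e f where h: "{z, e} \<in> E" "{e, f} \<in> E" "{a, f} \<in> E"
     "e \<noteq> c" "f \<noteq> z" "a \<noteq> e" "b \<noteq> f" unfolding hex_def by (auto simp: insert_commute)
  then show "\<exists>D l D' l' D'' l''. nbr (nbr z D l) D'' l'' = nbr a D' l' \<and>
     nbr z D l \<noteq> c \<and> nbr a D' l' \<noteq> z \<and> a \<noteq> nbr z D l \<and> b \<noteq> nbr a D' l'"
    unfolding edge_iff by metis
next
  assume "\<exists>D l D' l' D'' l''. nbr (nbr z D l) D'' l'' = nbr a D' l' \<and>
     nbr z D l \<noteq> c \<and> nbr a D' l' \<noteq> z \<and> a \<noteq> nbr z D l \<and> b \<noteq> nbr a D' l'"
  then obtain D l D' l' D'' l'' where h: "nbr (nbr z D l) D'' l'' = nbr a D' l'"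
     "nbr z D l \<noteq> c" "nbr a D' l' \<noteq> z" "a \<noteq> nbr z D l" "b \<noteq> nbr a D' l'" by blast
  have "{z, nbr z D l} \<in> E" "{a, nbr a D' l'} \<in> E" using edge_nbr assms by blast+
  moreover have "{nbr z D l, nbr a D' l'} \<in> E" using edge_nbr[of "nbr z D l" D'' l''] h(1) by simp
  moreover have "{nbr a D' l', a} \<in> E" using calculation(2) by (simp add: insert_commute)
  ultimately show "hex a b c z" unfolding hex_def using h(2-) by blast
qed

definition common_nbr :: "vertex \<Rightarrow> vertex \<Rightarrow> bool" where
  "common_nbr a e \<longleftrightarrow> (\<exists>f. {a, f} \<in> E \<and> {e, f} \<in> E)"

lemma common_nbr_iff_nbr:
  assumes "a \<in> V" "e \<in> V"
  shows "common_nbr a e \<longleftrightarrow> (\<exists>D l D' l'. nbr a D l = nbr e D' l')"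
  using assms unfolding common_nbr_def edge_iff by metis

text \<open>This and the next two computations concern paths around the base arc;
  \<open>two_path_base\<close> carries them to all others.\<close>

lemma hex_base_S2: "\<not> hex (nbr (Xp 0 0) True True) (Xp 0 0) (Xp 1 0) (nbr (Xp 1 0) False True)"
  by (simp add: hex_nbr nbr_p ex_bool_eq p_eq_iff)

lemma hex_base_mixed: "hex (nbr (Xp 0 0) False l) (Xp 0 0) (Xp 1 0) (nbr (Xp 1 0) False True)"
  by (cases l) (simp_all add: hex_nbr nbr_p ex_bool_eq p_eq_iff)

lemma common_nbr_base:
  "common_nbr (nbr (Xp 0 0) False l) (nbr (nbr (Xp 1 0) True l') False True) \<longleftrightarrow> l = l'"
  by (cases l; cases l') (simp_all add: common_nbr_iff_nbr nbr_p ex_bool_eq p_eq_iff)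


lemma graph_aut_edge:
  assumes "graph_aut V E \<sigma>" "e \<in> E"
  shows "\<sigma> ` e \<in> E"
  using assms unfolding graph_aut_def by blast

lemma graph_aut_in: "graph_aut V E \<sigma> \<Longrightarrow> v \<in> V \<Longrightarrow> \<sigma> v \<in> V"
  unfolding graph_aut_def by (blast dest: bij_betwE)

lemma graph_aut_eq_iff: "graph_aut V E \<sigma> \<Longrightarrow> v \<in> V \<Longrightarrow> w \<in> V \<Longrightarrow> \<sigma> v = \<sigma> w \<longleftrightarrow> v = w"
  unfolding graph_aut_def by (auto simp: bij_betw_def inj_on_def)

lemma graph_aut_inv:
  assumes "graph_aut V E \<sigma>"
  shows "graph_aut V E (inv_into V \<sigma>)"
proof -
  have b: "bij_betw \<sigma> V V" and e: "(`) \<sigma> ` E = E" using assms by (auto simp: graph_aut_def)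
  have i: "inv_into V \<sigma> ` \<sigma> ` x = x" if "x \<in> E" for x
    using bij_betw_inv_into_left[OF b] edge_subset[OF that] by (force simp: image_image subset_iff)
  have "(`) (inv_into V \<sigma>) ` E = (`) (inv_into V \<sigma>) ` (`) \<sigma> ` E" using e by simp
  also have "\<dots> = (\<lambda>x. x) ` E" unfolding image_image[of "(`) (inv_into V \<sigma>)"] using i by (intro image_cong) auto
  finally show ?thesis using bij_betw_inv_into[OF b] by (simp add: graph_aut_def)
qed

lemma edge_in: "{v, w} \<in> E \<Longrightarrow> v \<in> V" "{v, w} \<in> E \<Longrightarrow> w \<in> V"
  using edge_subset by blast+

lemma hex_aut_imp:
  assumes s: "graph_aut V E \<sigma>" and V: "b \<in> V" "c \<in> V" and h: "hex a b c z"
  shows "hex (\<sigma> a) (\<sigma> b) (\<sigma> c) (\<sigma> z)"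
proof -
  obtain e f where ef: "{z, e} \<in> E" "{e, f} \<in> E" "{f, a} \<in> E" "e \<noteq> c" "f \<noteq> z" "a \<noteq> e" "b \<noteq> f"
    using h unfolding hex_def by blast
  have i: "e \<in> V" "f \<in> V" "z \<in> V" "a \<in> V" using ef edge_in by blast+
  have "{\<sigma> z, \<sigma> e} \<in> E" "{\<sigma> e, \<sigma> f} \<in> E" "{\<sigma> f, \<sigma> a} \<in> E"
    using ef(1-3)[THEN graph_aut_edge[OF s]] by simp_all
  moreover have "\<sigma> e \<noteq> \<sigma> c" "\<sigma> f \<noteq> \<sigma> z" "\<sigma> a \<noteq> \<sigma> e" "\<sigma> b \<noteq> \<sigma> f"
    using ef(4-7) graph_aut_eq_iff[OF s] i V by simp_all
  ultimately show ?thesis unfolding hex_def by blast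
qed

lemma hex_aut:
  assumes s: "graph_aut V E \<sigma>" and V: "a \<in> V" "b \<in> V" "c \<in> V" "z \<in> V"
  shows "hex (\<sigma> a) (\<sigma> b) (\<sigma> c) (\<sigma> z) \<longleftrightarrow> hex a b c z"
proof
  have b: "bij_betw \<sigma> V V" using s by (simp add: graph_aut_def)
  assume "hex (\<sigma> a) (\<sigma> b) (\<sigma> c) (\<sigma> z)"
  from hex_aut_imp[OF graph_aut_inv[OF s] _ _ this] V graph_aut_in[OF s]
  show "hex a b c z" by (simp add: bij_betw_inv_into_left[OF b])
qed (rule hex_aut_imp[OF s V(2,3)])

text \<open>A path of three edges is given by its middle arc and the matchings of its two turns.
  Untwisted automorphisms preserve matchings, so one that moves the base arc to the middle arc moves
  the whole path.\<close>

lemma two_path_base: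
  assumes b: "b \<in> V" and S: "S j b a c" "S j' c b z"
  obtains \<tau> where "T False \<tau>" "\<tau> (Xp 0 0) = b" "\<tau> (Xp 1 0) = c"
    "\<tau> (nbr (Xp 0 0) (True \<noteq> fst j) (snd j)) = a" "\<tau> (nbr (Xp 1 0) (fst j') (snd j')) = z"
proof -
  obtain D l where c: "c = nbr b D l" using S(1) unfolding S_def by blast
  obtain \<tau> where t: "T False \<tau>" "\<tau> (X 0) = b" "\<tau> (X 1) = c" using arc_orbit[OF b] c by metis
  have p: "X 0 = Xp 0 0" "X 1 = Xp 1 0" by (simp_all add: Xp_def)
  define a0 z0 where "a0 = nbr (X 0) (True \<noteq> fst j) (snd j)" and "z0 = nbr (X 1) (fst j') (snd j')"
  have twist: "twist False i = i" for i by (simp add: twist_def)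
  have "S j (X 0) (X 1) a0" using S_nbr[OF X_in, of j 0 True False a0] by (simp add: a0_def nbr_simps)
  then have "S j b c (\<tau> a0)" using T_S[OF t(1) X_in, of j 0 "X 1" a0] t by (simp add: twist)
  then have a: "\<tau> a0 = a" using S_unique[OF b _ S_sym[OF S(1)]] by blast
  have "S j' (X 1) (X 0) z0" using S_nbr[OF X_in, of j' 1 False False z0] by (simp add: z0_def nbr_simps)
  then have "S j' c b (\<tau> z0)" using T_S[OF t(1) X_in, of j' 1 "X 0" z0] t by (simp add: twist)
  moreover have "c \<in> V" using c by simp
  ultimately have z: "\<tau> z0 = z" using S_unique[OF _ _ S(2)] by blast
  show ?thesis using that[OF t(1)] t(2,3) a z unfolding a0_def z0_def p by simp
qed

lemma hex_S2:
  assumes "b \<in> V" "S (False, True) b a c" "S (False, True) c b z"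
  shows "\<not> hex a b c z"
proof -
  obtain \<tau> where t: "T False \<tau>" "\<tau> (Xp 0 0) = b" "\<tau> (Xp 1 0) = c"
    "\<tau> (nbr (Xp 0 0) True True) = a" "\<tau> (nbr (Xp 1 0) False True) = z"
    by (rule two_path_base[OF assms]) (rule that, assumption, simp_all)
  show ?thesis
    using hex_aut[OF T_graph_aut[OF t(1)] nbr_in p_in(1) p_in(1) nbr_in] hex_base_S2 t(2-) by metis
qed

lemma hex_mixed:
  assumes "b \<in> V" "S j b a c" "S (False, True) c b z" "fst j"
  shows "hex a b c z"
proof -
  obtain \<tau> where t: "T False \<tau>" "\<tau> (Xp 0 0) = b" "\<tau> (Xp 1 0) = c"
    "\<tau> (nbr (Xp 0 0) False (snd j)) = a" "\<tau> (nbr (Xp 1 0) False True) = z"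
    by (rule two_path_base[OF assms(1-3)]) (rule that, assumption, simp_all add: assms(4))
  show ?thesis
    using hex_aut[OF T_graph_aut[OF t(1)] nbr_in p_in(1) p_in(1) nbr_in] hex_base_mixed t(2-) by metis
qed

lemma common_nbr_aut_imp:
  assumes "graph_aut V E \<sigma>" "common_nbr a e"
  shows "common_nbr (\<sigma> a) (\<sigma> e)"
proof -
  obtain f where "{a, f} \<in> E" "{e, f} \<in> E" using assms(2) unfolding common_nbr_def by blast
  then have "{\<sigma> a, \<sigma> f} \<in> E" "{\<sigma> e, \<sigma> f} \<in> E" using graph_aut_edge[OF assms(1)] by force+
  then show ?thesis unfolding common_nbr_def by blast
qed

lemma common_nbr_aut:
  assumes s: "graph_aut V E \<sigma>" and V: "a \<in> V" "e \<in> V"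
  shows "common_nbr (\<sigma> a) (\<sigma> e) \<longleftrightarrow> common_nbr a e"
proof
  have b: "bij_betw \<sigma> V V" using s by (simp add: graph_aut_def)
  assume "common_nbr (\<sigma> a) (\<sigma> e)"
  from common_nbr_aut_imp[OF graph_aut_inv[OF s] this] V
  show "common_nbr a e" by (simp add: bij_betw_inv_into_left[OF b])
qed (rule common_nbr_aut_imp[OF s])

text \<open>Recognises whether two consecutive monotone turns use the same matching.\<close>

lemma common_nbr_iff:
  assumes b: "b \<in> V" and S: "S j b a c" "S j' c b z" "S (False, True) z c e" and j: "fst j" "fst j'"
  shows "common_nbr a e \<longleftrightarrow> j = j'"
proof -
  obtain \<tau> where t: "T False \<tau>" "\<tau> (Xp 0 0) = b" "\<tau> (Xp 1 0) = c"
    "\<tau> (nbr (Xp 0 0) False (snd j)) = a" "\<tau> (nbr (Xp 1 0) True (snd j')) = z"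
    by (rule two_path_base[OF b S(1,2)]) (rule that, assumption, simp_all add: j)
  let ?z = "nbr (Xp 1 0) True (snd j')"
  have "nbr ?z False False = Xp 1 0" by (cases "snd j'") (simp_all add: nbr_p)
  then have "S (False, True) ?z (Xp 1 0) (nbr ?z False True)"
    using S_nbr_nbr[of ?z "(False, True)" False False False True] by simp
  then have "S (False, True) z c (\<tau> (nbr ?z False True))"
    using T_S[OF t(1) nbr_in] t(3,5) by (fastforce simp: twist_def)
  moreover have "z \<in> V" using T_in[OF t(1) nbr_in] t(5) by metis
  ultimately have e: "\<tau> (nbr ?z False True) = e" using S_unique S(3) by blast
  have "common_nbr a e \<longleftrightarrow> common_nbr (nbr (Xp 0 0) False (snd j)) (nbr ?z False True)"
    using common_nbr_aut[OF T_graph_aut[OF t(1)] nbr_in nbr_in] t(4) e by metis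
  then show ?thesis using j unfolding common_nbr_base by (simp add: prod_eq_iff)
qed

text \<open>A closed 8-walk without three consecutive edges on a hexagon. By hex_S2 and hex_mixed, such a
  walk turns by (False, True) everywhere or nowhere, and in the second case it is monotone and
  cannot close up. Hence automorphisms preserve this matching.\<close>

definition oct :: "vertex \<Rightarrow> vertex \<Rightarrow> vertex \<Rightarrow> bool" where
  "oct a b c \<longleftrightarrow> (\<exists>w :: nat \<Rightarrow> vertex. w 0 = a \<and> w 1 = b \<and> w 2 = c \<and> w 8 = w 0 \<and>
     (\<forall>i. {w i, w (Suc i)} \<in> E \<and> w i \<noteq> w (Suc (Suc i)) \<and>
        \<not> hex (w i) (w (Suc i)) (w (Suc (Suc i))) (w (Suc (Suc (Suc i))))))"

lemma oct_aut:
  assumes s: "graph_aut V E \<sigma>" and "oct a b c"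
  shows "oct (\<sigma> a) (\<sigma> b) (\<sigma> c)"
proof -
  obtain w where w: "w 0 = a" "w 1 = b" "w 2 = c" "w 8 = w (0::nat)"
    and e: "\<And>i. {w i, w (Suc i)} \<in> E" and ne: "\<And>i. w i \<noteq> w (Suc (Suc i))"
    and h: "\<And>i. \<not> hex (w i) (w (Suc i)) (w (Suc (Suc i))) (w (Suc (Suc (Suc i))))"
    using assms(2) unfolding oct_def by blast
  have V: "w i \<in> V" for i using edge_in(1)[OF e] .
  have "{\<sigma> (w i), \<sigma> (w (Suc i))} \<in> E" for i using graph_aut_edge[OF s e[of i]] by simp
  moreover have "\<sigma> (w i) \<noteq> \<sigma> (w (Suc (Suc i)))" for i using graph_aut_eq_iff[OF s V V] ne by blast
  moreover have "\<not> hex (\<sigma> (w i)) (\<sigma> (w (Suc i))) (\<sigma> (w (Suc (Suc i)))) (\<sigma> (w (Suc (Suc (Suc i)))))" for i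
    using hex_aut[OF s V V V V] h by blast
  ultimately show ?thesis unfolding oct_def using w by (intro exI[of _ "\<sigma> \<circ> w"]) simp
qed

lemma S_level:
  assumes "v \<in> V" "S j v a b" "fst j"
  shows "(lev b - lev v) mod (3 * int m) = (lev v - lev a) mod (3 * int m)"
proof -
  obtain D l l' where "a = nbr v D l" "b = nbr v (\<not> D) l'" using assms(2,3) unfolding S_def by auto
  then show ?thesis by (cases D) (simp_all add: lev_nbr[OF assms(1)] mod_simps)
qed

lemma S_exists:
  assumes "{v, a} \<in> E" "{v, b} \<in> E" "a \<noteq> b"
  obtains j where "S j v a b" "j \<noteq> (False, False)"
proof -
  obtain D l D' l' where v: "v \<in> V" "a = nbr v D l" "b = nbr v D' l'" using assms edge_iff by blast
  have "S (D \<noteq> D', l \<noteq> l') v a b" using v S_nbr_nbr by simp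
  moreover have "(D \<noteq> D', l \<noteq> l') \<noteq> (False, False)"
  proof
    assume "(D \<noteq> D', l \<noteq> l') = (False, False)"
    then have "D = D'" "l = l'" by simp_all
    then show False using assms(3) v(2,3) by simp
  qed
  ultimately show ?thesis by (rule that)
qed

lemma oct_S:
  assumes b: "b \<in> V" and S: "S j b a c" and j: "j \<noteq> (False, False)"
  shows "oct a b c \<longleftrightarrow> j = (False, True)"
proof
  assume "oct a b c"
  then obtain w where w: "w 0 = a" "w 1 = b" "w 2 = c" "w 8 = w (0::nat)"
    and e: "\<And>i. {w i, w (Suc i)} \<in> E" and ne: "\<And>i. w i \<noteq> w (Suc (Suc i))"
    and h: "\<And>i. \<not> hex (w i) (w (Suc i)) (w (Suc (Suc i))) (w (Suc (Suc (Suc i))))"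
    unfolding oct_def by blast
  have V: "w i \<in> V" for i using edge_in(1)[OF e] .
  show "j = (False, True)"
  proof (rule ccontr)
    assume "j \<noteq> (False, True)"
    then have fj: "fst j" using j by (cases j) auto
    \<comment> \<open>A flat turn after a monotone one would put three consecutive edges on a
      hexagon, by \<open>hex_mixed\<close>; so monotone turns spread along the walk.\<close>
    have ty: "\<exists>j. S j (w (Suc i)) (w i) (w (Suc (Suc i))) \<and> fst j" for i
    proof (induction i)
      case 0
      have "S j (w (Suc 0)) (w 0) (w (Suc (Suc 0)))" using S w by (simp add: numeral_2_eq_2)
      then show ?case using fj by blast
    next
      case (Suc i)
      then obtain j1 where j1: "S j1 (w (Suc i)) (w i) (w (Suc (Suc i)))" "fst j1" by blast
      have "{w (Suc (Suc i)), w (Suc i)} \<in> E" using e[of "Suc i"] by (simp add: insert_commute)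
      then obtain j2 where j2: "S j2 (w (Suc (Suc i))) (w (Suc i)) (w (Suc (Suc (Suc i))))" "j2 \<noteq> (False, False)"
        using S_exists[OF _ e ne] by blast
      have "j2 \<noteq> (False, True)" using hex_mixed[OF V j1(1) _ j1(2)] j2(1) h by blast
      then have "fst j2" using j2(2) by (cases j2) auto
      then show ?case using j2(1) by blast
    qed
    let ?M = "3 * int m"
    have step: "(lev (w (Suc i)) - lev (w i)) mod ?M = (lev (w 1) - lev (w 0)) mod ?M" for i
    proof (induction i)
      case (Suc i)
      obtain j where "S j (w (Suc i)) (w i) (w (Suc (Suc i)))" "fst j" using ty by blast
      from S_level[OF V this] Suc show ?case by simp
    qed simp
    have tot: "(lev (w i) - lev (w 0)) mod ?M = (int i * (lev (w 1) - lev (w 0))) mod ?M" for i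
    proof (induction i)
      case (Suc i)
      have "(lev (w (Suc i)) - lev (w 0)) mod ?M
        = ((lev (w (Suc i)) - lev (w i)) mod ?M + (lev (w i) - lev (w 0)) mod ?M) mod ?M"
        by (simp add: mod_simps)
      also have "\<dots> = (int (Suc i) * (lev (w 1) - lev (w 0))) mod ?M"
        unfolding Suc step by (simp only: mod_add_eq) (simp add: algebra_simps)
      finally show ?case .
    qed simp
    obtain D l where "w 1 = nbr (w 0) D l" using e[of 0] edge_iff by auto
    then have "(lev (w 1) - lev (w 0)) mod ?M = (if D then 1 else -1) mod ?M"
      using V by (simp add: lev_nbr mod_simps)
    then have "(8 * (lev (w 1) - lev (w 0))) mod ?M = (8 * (if D then 1 else -1)) mod ?M"
      by (metis mod_mult_right_eq)
    moreover have "(8 * (lev (w 1) - lev (w 0))) mod ?M = 0"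
      using tot[of 8] unfolding w(4) by simp
    \<comment> \<open>Eight monotone steps change the level by 8 or -8, and 3 divides the number of
      levels but not 8.\<close>
    ultimately have "?M dvd 8 * (if D then 1 else -1)" by (simp only: mod_0_imp_dvd)
    then have "3 dvd (8 * (if D then 1 else -1) :: int)" by (rule dvd_mult_left)
    then show False by (cases D) simp_all
  qed
next
  assume j: "j = (False, True)"
  have "{b, a} \<in> E" using S_edges[OF b S] by blast
  then obtain D' l' where a: "a \<in> V" "b = nbr a D' l'" using edge_iff[of a b] by (auto simp: insert_commute)
  obtain \<tau> where t: "T False \<tau>" "\<tau> (X 0) = a" "\<tau> (X 1) = b" using arc_orbit[OF a(1)] a(2) by metis
  let ?w = "\<lambda>i. \<tau> (oct_cycle ! (i mod 8))"
  note c = oct_cycle_S[THEN conjunct1] oct_cycle_S[THEN conjunct2]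
  have V: "?w i \<in> V" for i using T_in[OF t(1) c(1)] .
  have S': "S (False, True) (?w (Suc i)) (?w i) (?w (Suc (Suc i)))" for i
    using T_S[OF t(1) c(1) c(2)] by (simp add: twist_def)
  have w: "?w 0 = a" "?w 1 = b" using t by (simp_all add: oct_cycle_def Xp_def)
  have w2: "?w 2 = c"
    using S_unique[OF b, of j a] S j S'[of 0] w by (simp add: numeral_2_eq_2)
  have e: "{?w i, ?w (Suc i)} \<in> E" for i
    using S_edges[OF V S', of i] by (simp add: insert_commute)
  have ne: "?w i \<noteq> ?w (Suc (Suc i))" for i
  proof
    assume "?w i = ?w (Suc (Suc i))"
    then show False using S_irrefl[OF V[of "Suc i"], of "(False, True)" "?w i"] S'[of i] by simp
  qed
  have h: "\<not> hex (?w i) (?w (Suc i)) (?w (Suc (Suc i))) (?w (Suc (Suc (Suc i))))" for i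
    using hex_S2[OF V S' S'] .
  show "oct a b c"
    unfolding oct_def using w w2 e ne h by (intro exI[of _ ?w]) simp
qed

lemma aut_S:
  assumes s: "graph_aut V E \<sigma>" and v: "v \<in> V" and S: "S j v a b" "j \<noteq> (False, False)"
  obtains j' where "S j' (\<sigma> v) (\<sigma> a) (\<sigma> b)" "j' \<noteq> (False, False)"
proof -
  have e: "{v, a} \<in> E" "{v, b} \<in> E" using S_edges[OF v S(1)] by auto
  have "a \<noteq> b" using S_irrefl[OF v] S by metis
  then have "\<sigma> a \<noteq> \<sigma> b" using graph_aut_eq_iff[OF s] edge_in(2) e by blast
  moreover have "{\<sigma> v, \<sigma> a} \<in> E" "{\<sigma> v, \<sigma> b} \<in> E"
    using e[THEN graph_aut_edge[OF s]] by simp_all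
  ultimately show ?thesis using that by (metis S_exists)
qed

text \<open>Since the flat matching is preserved, the two neighbours on one side go to two
  neighbours on one side; injectivity makes the effect on D a shift. At this point k may still
  depend on v.\<close>

lemma aut_local:
  assumes s: "graph_aut V E \<sigma>" and v: "v \<in> V"
  shows "\<exists>k s1 s2. \<forall>D l. \<sigma> (nbr v D l) = nbr (\<sigma> v) (D \<noteq> s1) (l \<noteq> (s2 \<noteq> (k \<and> D)))"
proof -
  have sv: "\<sigma> v \<in> V" using graph_aut_in[OF s v] .
  have "\<exists>D' l'. \<sigma> (nbr v D l) = nbr (\<sigma> v) D' l'" for D l
    using graph_aut_edge[OF s edge_nbr[OF v]] edge_iff[of "\<sigma> v" "\<sigma> (nbr v D l)"] by simp
  then obtain f g where fg: "\<And>D l. \<sigma> (nbr v D l) = nbr (\<sigma> v) (f D l) (g D l)" by metis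
  have inj: "D = D' \<and> l = l'" if "f D l = f D' l'" "g D l = g D' l'" for D l D' l'
  proof -
    have "\<sigma> (nbr v D l) = \<sigma> (nbr v D' l')" unfolding fg using that by simp
    then have "nbr v D l = nbr v D' l'" using graph_aut_eq_iff[OF s nbr_in nbr_in] by blast
    then show ?thesis unfolding nbr_eq_iff[OF v] .
  qed
  have swap: "f D (\<not> l) = f D l \<and> g D (\<not> l) = (\<not> g D l)" for D l
  proof -
    have S: "S (False, True) v (nbr v D l) (nbr v D (\<not> l))" by (simp add: S_nbr_nbr[OF v])
    obtain j' where j': "S j' (\<sigma> v) (\<sigma> (nbr v D l)) (\<sigma> (nbr v D (\<not> l)))" "j' \<noteq> (False, False)"
      using aut_S[OF s v S] by auto
    have "oct (nbr v D l) v (nbr v D (\<not> l))" using oct_S[OF v S] by simp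
    from oct_aut[OF s this] have "j' = (False, True)" using oct_S[OF sv j'] by simp
    then show ?thesis using j'(1) unfolding fg S_nbr_nbr[OF sv] by auto
  qed
  have f: "f D l = f D False" for D l using swap[of D False] by (cases l) auto
  have g: "g D l = (g D False \<noteq> l)" for D l using swap[of D False] by (cases l) auto
  have "f True False \<noteq> f False False"
  proof
    assume eq: "f True False = f False False"
    have "g True False = g False False \<or> g True False = g False True" using g[of False True] by auto
    then show False using inj[of True False False False] inj[of True False False True] eq f[of False True] by auto
  qed
  then have fD: "f D False = (D \<noteq> f False False)" for D by (cases D) auto
  have "\<sigma> (nbr v D l) = nbr (\<sigma> v) (D \<noteq> f False False)
      (l \<noteq> (g False False \<noteq> ((g True False \<noteq> g False False) \<and> D)))" for D l
    unfolding fg using f[of D l] g[of D l] fD[of D] by (cases D) auto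
  then show ?thesis by blast
qed

lemma aut_S2:
  assumes s: "graph_aut V E \<sigma>" and v: "v \<in> V" and "S (False, True) v a b"
  shows "S (False, True) (\<sigma> v) (\<sigma> a) (\<sigma> b)"
proof -
  obtain D l where ab: "a = nbr v D l" "b = nbr v D (\<not> l)" using assms(3) unfolding S_def by auto
  obtain k s1 s2 where n: "\<And>D l. \<sigma> (nbr v D l) = nbr (\<sigma> v) (D \<noteq> s1) (l \<noteq> (s2 \<noteq> (k \<and> D)))"
    using aut_local[OF s v] by blast
  show ?thesis unfolding ab n S_nbr_nbr[OF graph_aut_in[OF s v]] by auto
qed

text \<open>The local parameters at both ends of an edge agree: a path that turns by
  \<open>(True, False)\<close> at v and at u passes the test of \<open>common_nbr_iff\<close>, which
  automorphisms preserve, and its image turns by \<open>(True, k)\<close> and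
  \<open>(True, k')\<close>.\<close>

lemma aut_T:
  assumes s: "graph_aut V E \<sigma>"
  shows "\<exists>k. T k \<sigma>"
proof -
  obtain k where k: "\<exists>s1 s2. \<forall>D l. \<sigma> (nbr (X 0) D l) = nbr (\<sigma> (X 0)) (D \<noteq> s1) (l \<noteq> (s2 \<noteq> (k \<and> D)))"
    using aut_local[OF s X_in] by blast
  let ?P = "\<lambda>v. \<exists>s1 s2. \<forall>D l. \<sigma> (nbr v D l) = nbr (\<sigma> v) (D \<noteq> s1) (l \<noteq> (s2 \<noteq> (k \<and> D)))"
  have "?P v" if "v \<in> V" for v
  proof (rule connected_induct[of ?P, OF k _ that])
    fix v D l assume v: "v \<in> V" "?P v"
    let ?u = "nbr v D l"
    have sv: "\<sigma> v \<in> V" "\<sigma> ?u \<in> V" using graph_aut_in[OF s] v(1) by simp_all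
    obtain s1 s2 where n: "\<And>D l. \<sigma> (nbr v D l) = nbr (\<sigma> v) (D \<noteq> s1) (l \<noteq> (s2 \<noteq> (k \<and> D)))" using v(2) by blast
    obtain k' r1 r2 where n': "\<And>D l. \<sigma> (nbr ?u D l) = nbr (\<sigma> ?u) (D \<noteq> r1) (l \<noteq> (r2 \<noteq> (k' \<and> D)))"
      using aut_local[OF s nbr_in] by metis
    obtain r where r: "nbr ?u (\<not> D) r = v" using nbr_back[OF v(1)] .
    let ?a = "nbr v (\<not> D) l" and ?z = "nbr ?u D r"
    have "S (True, False) v ?a ?u" using S_nbr_nbr[OF v(1)] by simp
    moreover have Su: "S (True, False) ?u v ?z" using S_nbr_nbr[of ?u "(True, False)" "\<not> D" r D r] r by simp
    moreover obtain e where e: "S (False, True) ?z ?u e"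
    proof -
      obtain r' where "nbr ?z (\<not> D) r' = ?u" using nbr_back[OF nbr_in] .
      then show ?thesis using that S_ex by metis
    qed
    ultimately have "common_nbr ?a e" using common_nbr_iff[OF v(1)] by simp
    then have h: "common_nbr (\<sigma> ?a) (\<sigma> e)" using common_nbr_aut_imp[OF s] by blast
    have Se: "S (False, True) (\<sigma> ?z) (\<sigma> ?u) (\<sigma> e)" using aut_S2[OF s nbr_in e] .
    have "S (True, k) (\<sigma> v) (\<sigma> ?a) (\<sigma> ?u)" unfolding n S_nbr_nbr[OF sv(1)] by (cases D; cases k) auto
    moreover have "S (True, k') (\<sigma> ?u) (\<sigma> v) (\<sigma> ?z)"
    proof -
      have "\<sigma> v = nbr (\<sigma> ?u) ((\<not> D) \<noteq> r1) (r \<noteq> (r2 \<noteq> (k' \<and> \<not> D)))" using n'[of "\<not> D" r] r by simp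
      then have "S (True, k') (\<sigma> ?u) (nbr (\<sigma> ?u) ((\<not> D) \<noteq> r1) (r \<noteq> (r2 \<noteq> (k' \<and> \<not> D)))) (\<sigma> ?z)"
        unfolding n'[of D r] S_nbr_nbr[OF sv(2)] by (cases D; cases k') auto
      then show ?thesis using \<open>\<sigma> v = _\<close> by simp
    qed
    ultimately have "(True, k) = (True, k')" using common_nbr_iff[OF sv(1) _ _ Se] h by simp
    then have "k' = k" by simp
    then show "?P ?u" using n' by blast
  qed
  then have "\<forall>v\<in>V. ?P v" ..
  moreover have "bij_betw \<sigma> V V" using s by (simp add: graph_aut_def)
  ultimately have "T k \<sigma>" unfolding T_def by (rule conjI[rotated])
  then show ?thesis ..
qed

end


section \<open>Classification\<close>

lemma face_vertex_induct:
  assumes f: "is_face_cycle E f" and e: "e0 \<in> f" "v0 \<in> e0" "P v0"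
    and step: "\<And>v u. {v, u} \<in> f \<Longrightarrow> P v \<Longrightarrow> P u"
    and v: "e \<in> f" "v \<in> e"
  shows "P v"
proof -
  obtain w L where w: "closed_walk w L f" using face_cycle_walk[OF f] .
  have two: "\<exists>u. x = {a, u}" if "x \<in> f" "a \<in> x" for x a
  proof -
    obtain i where "x = {w i, w (Suc i)}" using w \<open>x \<in> f\<close> unfolding closed_walk_def by blast
    then show ?thesis using \<open>a \<in> x\<close> by (metis insertE insert_commute singletonD)
  qed
  have all: "\<forall>u\<in>x. P u" if h: "x \<in> f" "a \<in> x" "P a" for x a
  proof -
    obtain u where u: "x = {a, u}" using two[OF h(1,2)] ..
    then have "P u" using step[of a u] h by simp
    then show ?thesis using u h(3) by simp
  qed
  have "f \<subseteq> {x. \<forall>u\<in>x. P u}"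
  proof (rule face_connected[OF f e(1)])
    show "e0 \<in> {x. \<forall>u\<in>x. P u}" using all[OF e] by blast
    fix a x y assume "x \<in> {x. \<forall>u\<in>x. P u}" "y \<in> f" "a \<in> x" "a \<in> y"
    then show "y \<in> {x. \<forall>u\<in>x. P u}" using all[of y a] by blast
  qed
  then show ?thesis using v by blast
qed

lemma face_nonempty:
  assumes "is_face_cycle E f"
  obtains v a where "{v, a} \<in> f"
proof -
  obtain w L where "closed_walk w L f" using face_cycle_walk[OF assms] .
  then have "f = range (\<lambda>i. {w i, w (Suc i)})" by (simp add: closed_walk_def)
  then have "{w 0, w (Suc 0)} \<in> f" by (simp only:) (rule rangeI)
  then show ?thesis by (rule that)
qed

context rose_window
begin

section \<open>Matchings at the corners of a face\<close>

definition Ty :: "vertex set set \<Rightarrow> vertex \<Rightarrow> kind \<Rightarrow> bool" where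
  "Ty f v j \<longleftrightarrow> (\<exists>a b. a \<noteq> b \<and> {v, a} \<in> f \<and> {v, b} \<in> f \<and> S j v a b)"

lemma face_edge_in:
  assumes "is_face_cycle E f" "{v, a} \<in> f"
  shows "v \<in> V" "a \<in> V" "a \<noteq> v" "{v, a} \<in> E"
proof -
  have "f \<subseteq> E" using assms(1) by (auto simp: is_face_cycle_def)
  then show e: "{v, a} \<in> E" using assms(2) by blast
  show "v \<in> V" "a \<in> V" using edge_in[OF e] by auto
  obtain D l where "a = nbr v D l" using e unfolding edge_iff by blast
  then show "a \<noteq> v" using nbr_neq[OF edge_in(1)[OF e]] by simp
qed

lemma face_corner:
  assumes "is_face_cycle E f" "{v, a} \<in> f"
  obtains b j where "b \<noteq> a" "{v, b} \<in> f" "S j v a b" "j \<noteq> (False, False)"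
    "\<And>c. {v, c} \<in> f \<Longrightarrow> c = a \<or> c = b"
proof -
  obtain p q where pq: "p \<noteq> q" "p \<noteq> v" "q \<noteq> v" "{e \<in> f. v \<in> e} = {{v, p}, {v, q}}"
    by (rule face_star[OF assms(1) _ assms(2), of v]) (rule insertI1)
  have mem: "{v, c} \<in> f \<longleftrightarrow> c = p \<or> c = q" for c
  proof -
    have "{v, c} \<in> f \<longleftrightarrow> {v, c} \<in> {{v, p}, {v, q}}" unfolding pq(4)[symmetric] by simp
    then show ?thesis using pq(2,3) by (auto simp: doubleton_eq_iff)
  qed
  define b where "b = (if a = p then q else p)"
  have b: "b \<noteq> a" "{v, b} \<in> f" "\<And>c. {v, c} \<in> f \<Longrightarrow> c = a \<or> c = b"
    using assms(2) pq(1) unfolding mem b_def by auto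
  obtain j where "S j v a b" "j \<noteq> (False, False)"
    by (rule S_exists[of v a b])
      (use face_edge_in(4)[OF assms] face_edge_in(4)[OF assms(1) b(2)] b(1) in auto)
  then show ?thesis using that b by blast
qed

lemma Ty_ex:
  assumes "is_face_cycle E f" "{v, a} \<in> f"
  obtains j where "Ty f v j" "j \<noteq> (False, False)"
proof -
  obtain b j where "b \<noteq> a" "{v, b} \<in> f" "S j v a b" "j \<noteq> (False, False)"
    using face_corner[OF assms] by metis
  then show ?thesis using that assms(2) unfolding Ty_def by metis
qed

lemma Ty_S:
  assumes "is_face_cycle E f" "Ty f v j" "{v, a} \<in> f" "{v, b} \<in> f" "a \<noteq> b"
  shows "S j v a b"
proof -
  obtain p q where pq: "p \<noteq> q" "{v, p} \<in> f" "{v, q} \<in> f" "S j v p q"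
    using assms(2) unfolding Ty_def by blast
  obtain r i where "\<And>c. {v, c} \<in> f \<Longrightarrow> c = p \<or> c = r"
    using face_corner[OF assms(1) pq(2)] by metis
  then have "a = p \<and> b = q \<or> a = q \<and> b = p" using pq(1,3) assms(3-5) by metis
  then show ?thesis using pq(4) S_sym by blast
qed

lemma Ty_unique:
  assumes "is_face_cycle E f" "Ty f v j" "Ty f v j'"
  shows "j = j'"
proof -
  obtain a b where ab: "a \<noteq> b" "{v, a} \<in> f" "{v, b} \<in> f" "S j v a b" using assms(2) unfolding Ty_def by blast
  then have "S j' v a b" using Ty_S[OF assms(1,3)] by blast
  then show ?thesis using S_type_unique face_edge_in(1)[OF assms(1) ab(2)] ab(4) by blast
qed

lemma face_comp_Ty:
  assumes "is_face_cycle E f" "e \<in> f" "\<And>v a. {v, a} \<in> f \<Longrightarrow> Ty f v (c v)"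
  shows "f = comp c e"
proof (rule face_comp[OF assms(1,2)])
  fix v a b assume "{v, a} \<in> f" "{v, b} \<in> f" "a \<noteq> b"
  then show "v \<in> V \<and> S (c v) v a b"
    using Ty_S[OF assms(1) assms(3)] face_edge_in(1)[OF assms(1)] by blast
qed

lemma Ty_img:
  assumes T: "T k \<sigma>" and f: "f \<subseteq> E" "Ty f v j"
  shows "Ty (face_img \<sigma> f) (\<sigma> v) (twist k j)"
proof -
  obtain a b where ab: "a \<noteq> b" "{v, a} \<in> f" "{v, b} \<in> f" "S j v a b" using f(2) unfolding Ty_def by blast
  have V: "v \<in> V" "a \<in> V" "b \<in> V" using ab f(1) edge_in by blast+
  have "\<sigma> a \<noteq> \<sigma> b" using T_bij[OF T] V ab(1) by (auto simp: bij_betw_def inj_on_def)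
  moreover have "{\<sigma> v, \<sigma> a} \<in> face_img \<sigma> f" "{\<sigma> v, \<sigma> b} \<in> face_img \<sigma> f"
    using imageI[OF ab(2), of "(`) \<sigma>"] imageI[OF ab(3), of "(`) \<sigma>"] by (simp_all add: face_img_def)
  ultimately show ?thesis using T_S[OF T V(1) ab(4)] unfolding Ty_def by blast
qed

section \<open>Structure of an arbitrary map of the class\<close>

context
  fixes F
  assumes poly: "polytopal_map V E F" and cls: "class_2_01 V E F"
begin

lemma F_face: "f \<in> F \<Longrightarrow> is_face_cycle E f"
  using poly unfolding polytopal_map_def by blast

lemma F_sub: "f \<in> F \<Longrightarrow> f \<subseteq> E"
  using F_face unfolding is_face_cycle_def by blast

definition C :: "vertex \<Rightarrow> vertex \<Rightarrow> vertex \<Rightarrow> bool" where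
  "C v a b \<longleftrightarrow> a \<noteq> b \<and> (\<exists>f\<in>F. {v, a} \<in> f \<and> {v, b} \<in> f)"

lemma C_sym: "C v a b \<Longrightarrow> C v b a"
  unfolding C_def by blast

text \<open>By the disc condition the four neighbours form a 4-cycle whose sides are the corners at
  v. Its two diagonals make up a perfect matching, the one that no face uses.\<close>

lemma corner_graph:
  assumes v: "v \<in> V"
  shows "\<exists>j. j \<noteq> (False, False) \<and>
    (\<forall>a b. {v, a} \<in> E \<longrightarrow> {v, b} \<in> E \<longrightarrow> a \<noteq> b \<longrightarrow> (C v a b \<longleftrightarrow> \<not> S j v a b))"
proof -
  have "vertex_disc E F v" using poly v unfolding polytopal_map_def by simp
  from this[unfolded vertex_disc_def] obtain es fs where es: "distinct es" "set es = {e \<in> E. v \<in> e}"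
    and fs: "length fs = length es" "set fs = {f \<in> F. \<exists>e\<in>f. v \<in> e}"
    "\<forall>i<length es. es ! i \<in> fs ! i \<and> es ! (Suc i mod length es) \<in> fs ! i"
    by (elim exE conjE) (rule that)
  have "inj (\<lambda>(D, l). {v, nbr v D l})"
    by (rule injI) (auto simp: nbr_edge_eq_iff[OF v])
  then have "card {e \<in> E. v \<in> e} = card (UNIV :: kind set)"
    unfolding star_eq[OF v] by (rule card_image)
  also have "\<dots> = 4" by (simp add: UNIV_Times_UNIV[symmetric] card_cartesian_product del: UNIV_Times_UNIV)
  finally have len: "length es = 4" using es distinct_card by metis
  have "\<exists>a. es ! i = {v, a} \<and> {v, a} \<in> E" if "i < 4" for i
  proof -
    have "es ! i \<in> E" "v \<in> es ! i" using es(2) len that nth_mem[of i es] by auto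
    then show ?thesis by (metis E_cases)
  qed
  then obtain a where a: "\<And>i. i < 4 \<Longrightarrow> es ! i = {v, a i} \<and> {v, a i} \<in> E" by metis
  have a_eq: "a i = a j \<longleftrightarrow> i = j" if "i < 4" "j < 4" for i j
    using nth_eq_iff_index_eq[OF es(1)] a that len by metis
  have all: "\<exists>i<4. b = a i" if bE: "{v, b} \<in> E" for b
  proof -
    have "{v, b} \<in> set es" using es(2) bE by simp
    then obtain i where i: "i < 4" "{v, b} = {v, a i}" using len a by (metis in_set_conv_nth)
    then have "b = a i" by (metis doubleton_eq_iff)
    then show ?thesis using i(1) by blast
  qed
  have fsF: "fs ! i \<in> F" if "i < 4" for i
    using fs(1,2) len that nth_mem[of i fs] by auto
  have mem: "{v, a i} \<in> fs ! i" "{v, a (Suc i mod 4)} \<in> fs ! i" if "i < 4" for i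
    using fs(3) a[of i] a[of "Suc i mod 4"] that len by auto
  have adj: "C v (a i) (a (Suc i mod 4))" if "i < 4" for i
  proof -
    have "i \<noteq> Suc i mod 4" using that by (auto simp: mod_Suc)
    then show ?thesis unfolding C_def using mem[OF that] fsF[OF that] a_eq that by auto
  qed
  have only: "\<exists>i<4. {b, c} = {a i, a (Suc i mod 4)}" if "C v b c" for b c
  proof -
    obtain f where f: "b \<noteq> c" "f \<in> F" "{v, b} \<in> f" "{v, c} \<in> f" using \<open>C v b c\<close> unfolding C_def by blast
    have "\<exists>e\<in>f. v \<in> e" using f(3) by (intro bexI[of _ "{v, b}"]) simp_all
    then have "f \<in> set fs" unfolding fs(2) using f(2) by simp
    then obtain i where i: "i < 4" "f = fs ! i" using fs(1) len by (metis in_set_conv_nth)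
    obtain r where r: "\<And>c. {v, c} \<in> f \<Longrightarrow> c = b \<or> c = r"
      using face_corner[OF F_face[OF f(2)] f(3)] by metis
    have "i \<noteq> Suc i mod 4" using i(1) by (auto simp: mod_Suc)
    then have "a i \<noteq> a (Suc i mod 4)" using a_eq i(1) by simp
    moreover have "c = r" using r[OF f(4)] f(1) by simp
    moreover have "a i = b \<or> a i = r" "a (Suc i mod 4) = b \<or> a (Suc i mod 4) = r"
      using r mem[OF i(1)] i(2) by simp_all
    ultimately have "{b, c} = {a i, a (Suc i mod 4)}"
      by (elim disjE) (simp_all add: insert_commute)
    then show ?thesis using i(1) by blast
  qed
  have e4: "{v, a 0} \<in> E" "{v, a 1} \<in> E" "{v, a 2} \<in> E" "{v, a 3} \<in> E" using a by simp_all
  have d4: "a 0 \<noteq> a 1" "a 0 \<noteq> a 2" "a 0 \<noteq> a 3" "a 1 \<noteq> a 2" "a 1 \<noteq> a 3" "a 2 \<noteq> a 3"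
    using a_eq by simp_all
  have all4: "b = a 0 \<or> b = a 1 \<or> b = a 2 \<or> b = a 3" if bE: "{v, b} \<in> E" for b
  proof -
    obtain i where "i < 4" "b = a i" using all[OF bE] by blast
    then have "i = 0 \<or> i = 1 \<or> i = 2 \<or> i = 3" by linarith
    then show ?thesis using \<open>b = a i\<close> by blast
  qed
  have m4: "Suc 0 mod 4 = 1" "Suc 1 mod 4 = 2" "Suc 2 mod 4 = 3" "Suc 3 mod 4 = (0 :: nat)" by simp_all
  have adj4: "C v (a 0) (a 1)" "C v (a 1) (a 2)" "C v (a 2) (a 3)" "C v (a 3) (a 0)"
    using adj[of 0, unfolded m4] adj[of 1, unfolded m4] adj[of 2, unfolded m4] adj[of 3, unfolded m4]
    by simp_all
  have only4: "{b, c} \<in> {{a 0, a 1}, {a 1, a 2}, {a 2, a 3}, {a 3, a 0}}" if bc: "C v b c" for b c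
  proof -
    obtain i where i: "i < 4" "{b, c} = {a i, a (Suc i mod 4)}" using only[OF bc] by blast
    then have "i = 0 \<or> i = 1 \<or> i = 2 \<or> i = 3" by linarith
    then show ?thesis using i(2) by (elim disjE) (simp_all only: m4 insert_iff simp_thms)
  qed
  obtain j where j: "S j v (a 0) (a 2)" "j \<noteq> (False, False)" using S_exists[OF e4(1,3) d4(2)] .
  \<comment> \<open>The partner of \<open>a 1\<close> under j cannot be \<open>a 0\<close> or
    \<open>a 2\<close>, which are partners of each other; so both diagonals belong to the same
    matching.\<close>
  have "S j v (a 1) (a 3)"
  proof -
    obtain D l where "a 1 = nbr v D l" using e4(2) edge_iff by blast
    then obtain b where b: "S j v (a 1) b" using S_ex by metis
    then have "{v, b} \<in> E" using S_edges[OF v] by blast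
    moreover have "b \<noteq> a 1" using b S_irrefl[OF v] j(2) by metis
    moreover have "b \<noteq> a 0" using S_unique[OF v S_sym[OF b], of "a 2"] j(1) d4(4) by metis
    moreover have "b \<noteq> a 2" using S_unique[OF v S_sym[OF b], of "a 0"] S_sym[OF j(1)] d4(1) by metis
    ultimately show ?thesis using all4[of b] b by blast
  qed
  note S13 = this
  have nC: "\<not> C v (a 0) (a 2)" "\<not> C v (a 1) (a 3)"
    using only4[of "a 0" "a 2"] only4[of "a 1" "a 3"] d4 by (auto simp: doubleton_eq_iff)
  have nS: "\<not> S j v (a 0) (a 1)" "\<not> S j v (a 0) (a 3)" "\<not> S j v (a 2) (a 1)" "\<not> S j v (a 2) (a 3)"
    using S_unique[OF v j(1)] S_unique[OF v S_sym[OF j(1)]] d4 by metis+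
  have "C v b c \<longleftrightarrow> \<not> S j v b c" if "{v, b} \<in> E" "{v, c} \<in> E" "b \<noteq> c" for b c
    using all4[OF that(1)] all4[OF that(2)] that(3) adj4 adj4[THEN C_sym] nC nC[unfolded C_def]
      j(1) S_sym[OF j(1)] S13 S_sym[OF S13] nS S_sym[of j v] C_sym[of v] by metis
  then show ?thesis using j(2) by blast
qed

text \<open>The faces use two of the three matchings at v; J v is the third one.\<close>

definition J :: "vertex \<Rightarrow> kind" where
  "J v = (SOME j. j \<noteq> (False, False) \<and>
    (\<forall>a b. {v, a} \<in> E \<longrightarrow> {v, b} \<in> E \<longrightarrow> a \<noteq> b \<longrightarrow> (C v a b \<longleftrightarrow> \<not> S j v a b)))"

lemma J:
  assumes "v \<in> V"
  shows "J v \<noteq> (False, False)"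
    "{v, a} \<in> E \<Longrightarrow> {v, b} \<in> E \<Longrightarrow> a \<noteq> b \<Longrightarrow> C v a b \<longleftrightarrow> \<not> S (J v) v a b"
  using someI_ex[OF corner_graph[OF assms], folded J_def] by blast+

lemma Ty_J:
  assumes "f \<in> F" "Ty f v j"
  shows "j \<noteq> J v"
proof
  assume "j = J v"
  then obtain a b where ab: "a \<noteq> b" "{v, a} \<in> f" "{v, b} \<in> f" "S (J v) v a b"
    using assms(2) unfolding Ty_def by blast
  then have "C v a b" unfolding C_def using assms(1) by blast
  moreover have "v \<in> V" "{v, a} \<in> E" "{v, b} \<in> E" using face_edge_in[OF F_face[OF assms(1)]] ab by blast+
  ultimately show False using J(2) ab(1,4) by blast
qed

lemma face_of_type:
  assumes "v \<in> V" "{v, a} \<in> E" "j \<noteq> J v" "j \<noteq> (False, False)"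
  obtains f where "f \<in> F" "{v, a} \<in> f" "Ty f v j"
proof -
  obtain D l where "a = nbr v D l" using assms(2) edge_iff by blast
  then obtain b where b: "S j v a b" using S_ex by metis
  have "{v, b} \<in> E" using S_edges[OF assms(1) b] by blast
  moreover have "a \<noteq> b" using S_irrefl[OF assms(1)] b assms(4) by metis
  moreover have "\<not> S (J v) v a b" using S_type_unique[OF assms(1) b] assms(3) by blast
  ultimately have "C v a b" using J(2)[OF assms(1,2)] by blast
  then show ?thesis using that b unfolding C_def Ty_def by blast
qed

lemma map_aut_T: "map_aut V E F \<sigma> \<Longrightarrow> \<exists>k. T k \<sigma>"
  by (rule aut_T) (simp add: map_aut_def)

text \<open>The orbit condition on 1-adjacent flags, read on vertices.\<close>

lemma flag_rotation:
  assumes "C v a b"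
  obtains k \<sigma> where "T k \<sigma>" "map_aut V E F \<sigma>" "\<sigma> v = v" "\<sigma> a = b"
proof -
  obtain f where f: "a \<noteq> b" "f \<in> F" "{v, a} \<in> f" "{v, b} \<in> f" using assms unfolding C_def by blast
  have ne: "a \<noteq> v" "b \<noteq> v" using face_edge_in(3)[OF F_face[OF f(2)]] f by blast+
  let ?\<Phi> = "(v, {v, a}, f)" and ?\<Psi> = "(v, {v, b}, f)"
  have "?\<Phi> \<in> flags F" "?\<Psi> \<in> flags F" using f by (simp_all add: flags_def)
  moreover have "adj_flag 1 ?\<Phi> ?\<Psi>" using f(1) ne by (simp add: adj_flag_def doubleton_eq_iff)
  ultimately have "?\<Psi> \<in> flag_orbit V E F ?\<Phi>" using cls unfolding class_2_01_def by blast
  then obtain \<sigma> where s: "map_aut V E F \<sigma>" "?\<Psi> = flag_img \<sigma> ?\<Phi>" unfolding flag_orbit_def by blast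
  then have "\<sigma> v = v" "{v, b} = {\<sigma> v, \<sigma> a}" by (simp_all add: flag_img_def)
  then have "\<sigma> v = v" "\<sigma> a = b" using ne by (auto simp: doubleton_eq_iff)
  moreover obtain k where "T k \<sigma>" using map_aut_T[OF s(1)] ..
  ultimately show ?thesis using that s(1) by blast
qed

text \<open>The orbit condition on 0-adjacent flags; the automorphism also preserves the
  face.\<close>

lemma flag_flip:
  assumes f: "f \<in> F" "{v, a} \<in> f"
  obtains k \<sigma> where "T k \<sigma>" "map_aut V E F \<sigma>" "\<sigma> v = a" "\<sigma> a = v" "face_img \<sigma> f = f"
proof -
  have ne: "a \<noteq> v" using face_edge_in(3)[OF F_face[OF f(1)]] f by blast
  let ?\<Phi> = "(v, {v, a}, f)" and ?\<Psi> = "(a, {v, a}, f)"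
  have "?\<Phi> \<in> flags F" "?\<Psi> \<in> flags F" using f by (simp_all add: flags_def)
  moreover have "adj_flag 0 ?\<Phi> ?\<Psi>" using ne by (simp add: adj_flag_def)
  ultimately have "?\<Psi> \<in> flag_orbit V E F ?\<Phi>" using cls unfolding class_2_01_def by blast
  then obtain \<sigma> where s: "map_aut V E F \<sigma>" "?\<Psi> = flag_img \<sigma> ?\<Phi>" unfolding flag_orbit_def by blast
  have p: "(a, {v, a}, f) = (\<sigma> v, \<sigma> ` {v, a}, face_img \<sigma> f)"
    using s(2) by (simp only: flag_img_def split)
  have e: "\<sigma> v = a" "{v, a} = {\<sigma> v, \<sigma> a}" "face_img \<sigma> f = f"
    using arg_cong[OF p, of fst] arg_cong[OF p, of "fst \<circ> snd"] arg_cong[OF p, of "snd \<circ> snd"]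
    by (simp_all only: fst_conv snd_conv o_apply image_insert image_empty)
  then have "\<sigma> a = v" using ne by (auto simp: doubleton_eq_iff)
  moreover obtain k where "T k \<sigma>" using map_aut_T[OF s(1)] ..
  ultimately show ?thesis using that s(1) e by blast
qed

lemma C_img:
  assumes "T k \<sigma>" "map_aut V E F \<sigma>" "v \<in> V" "a \<in> V" "b \<in> V" "C (\<sigma> v) (\<sigma> a) (\<sigma> b)"
  shows "C v a b"
proof -
  have inj: "inj_on \<sigma> V" using T_bij[OF assms(1)] by (simp add: bij_betw_def)
  obtain f' where f': "\<sigma> a \<noteq> \<sigma> b" "f' \<in> F" "{\<sigma> v, \<sigma> a} \<in> f'" "{\<sigma> v, \<sigma> b} \<in> f'"
    using assms(6) unfolding C_def by blast
  obtain f where f: "f \<in> F" "f' = face_img \<sigma> f" using assms(2) f'(2) unfolding map_aut_def by blast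
  have "{v, c} \<in> f" if h: "c \<in> V" "{\<sigma> v, \<sigma> c} \<in> f'" for c
  proof -
    obtain x where x: "x \<in> f" "{\<sigma> v, \<sigma> c} = \<sigma> ` x" using h(2) unfolding f(2) face_img_def by blast
    have "x \<subseteq> V" using x(1) F_sub[OF f(1)] edge_subset by blast
    then have "x = {v, c}"
      using x(2) inj_on_image_eq_iff[OF inj, of "{v, c}" x] assms(3) h(1) by auto
    then show ?thesis using x(1) by simp
  qed
  then show ?thesis unfolding C_def using f' f(1) assms(4,5) by blast
qed

text \<open>Automorphisms of the map preserve corners, hence also the pairs of edges at a vertex
  that form no corner.\<close>

lemma J_img:
  assumes "T k \<sigma>" "map_aut V E F \<sigma>" "v \<in> V"
  shows "J (\<sigma> v) = twist k (J v)"
proof -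
  let ?a = "nbr v True True"
  obtain b where b: "S (J v) v ?a b" using S_ex by blast
  have e: "{v, ?a} \<in> E" "{v, b} \<in> E" using S_edges[OF assms(3) b] by auto
  have V: "b \<in> V" using edge_in(2)[OF e(2)] .
  have ne: "?a \<noteq> b" using S_irrefl[OF assms(3)] b J(1)[OF assms(3)] by metis
  have "\<not> C v ?a b" using J(2)[OF assms(3) e ne] b by blast
  then have nC: "\<not> C (\<sigma> v) (\<sigma> ?a) (\<sigma> b)" using C_img[OF assms nbr_in V] by blast
  have "\<sigma> ?a \<noteq> \<sigma> b" using T_bij[OF assms(1)] V ne by (auto simp: bij_betw_def inj_on_def)
  moreover have "{\<sigma> v, \<sigma> ?a} \<in> E" "{\<sigma> v, \<sigma> b} \<in> E" using T_edge[OF assms(1)] e by force+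
  ultimately have "S (J (\<sigma> v)) (\<sigma> v) (\<sigma> ?a) (\<sigma> b)" using J(2)[OF T_in[OF assms(1,3)]] nC by blast
  then show ?thesis using T_S[OF assms(1,3) b] S_type_unique[OF T_in[OF assms(1,3)]] by blast
qed

lemma face_type_step:
  assumes f: "f \<in> F" "{v, u} \<in> f" and "Ty f v j" "Ty f u j'"
  obtains k \<sigma> where "T k \<sigma>" "j' = twist k j"
proof -
  obtain k \<sigma> where s: "T k \<sigma>" "\<sigma> v = u" "face_img \<sigma> f = f" using flag_flip[OF f] by metis
  have "Ty f u (twist k j)" using Ty_img[OF s(1) F_sub[OF f(1)] assms(3)] s by simp
  then have "j' = twist k j" using Ty_unique[OF F_face[OF f(1)] assms(4)] by blast
  then show ?thesis using that s(1) by blast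
qed

text \<open>A flip along an edge of the face relates the matchings at its ends by
  \<open>twist\<close>, which keeps the first flag: a face is flat throughout or monotone
  throughout.\<close>

lemma face_fst:
  assumes f: "f \<in> F" "{v, a} \<in> f" "Ty f v j" and u: "{u, b} \<in> f" "Ty f u j'"
  shows "fst j = fst j'"
proof -
  note fc = F_face[OF f(1)]
  have "\<exists>i. Ty f u i \<and> fst i = fst j"
  proof (rule face_vertex_induct[OF fc f(2), of v "\<lambda>u. \<exists>i. Ty f u i \<and> fst i = fst j"])
    show "\<exists>i. Ty f v i \<and> fst i = fst j" using f(3) by blast
    fix x y assume xy: "{x, y} \<in> f" "\<exists>i. Ty f x i \<and> fst i = fst j"
    then obtain i where i: "Ty f x i" "fst i = fst j" by blast
    have "{y, x} \<in> f" using xy(1) by (simp add: insert_commute)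
    then obtain i' where i': "Ty f y i'" using Ty_ex[OF fc] by blast
    obtain k \<sigma> where "i' = twist k i" using face_type_step[OF f(1) xy(1) i(1) i'] .
    then show "\<exists>i. Ty f y i \<and> fst i = fst j" using i' i(2) by (auto simp: twist_def)
  qed (use u in auto)
  then show ?thesis using Ty_unique[OF fc u(2)] by metis
qed

text \<open>Every edge is reversed by an automorphism of the map, and its twist fixes
  \<open>(False, True)\<close>.\<close>

lemma J_uniform:
  assumes "v \<in> V"
  shows "J v = (False, True) \<longleftrightarrow> J (X 0) = (False, True)"
proof (rule connected_induct[of "\<lambda>v. J v = (False, True) \<longleftrightarrow> J (X 0) = (False, True)", OF refl _ assms])
  fix v D l assume v: "v \<in> V" "J v = (False, True) \<longleftrightarrow> J (X 0) = (False, True)"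
  \<comment> \<open>Any matching used at v will do, in order to obtain a face through the
    edge.\<close>
  define j where "j = (if J v = (True, True) then (False, True) else (True, True))"
  have "j \<noteq> J v" "j \<noteq> (False, False)" by (auto simp: j_def)
  then obtain f where f: "f \<in> F" "{v, nbr v D l} \<in> f" by (rule face_of_type[OF v(1) edge_nbr[OF v(1)]])
  obtain k \<sigma> where s: "T k \<sigma>" "map_aut V E F \<sigma>" "\<sigma> v = nbr v D l" using flag_flip[OF f] by metis
  have "J (nbr v D l) = twist k (J v)" using J_img[OF s(1,2) v(1)] s(3) by simp
  then show "J (nbr v D l) = (False, True) \<longleftrightarrow> J (X 0) = (False, True)"
    using v(2) by (cases "J v") (auto simp: twist_def)
qed

lemma F_case_B:
  assumes "J (X 0) \<noteq> (False, True)"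
  shows "F = Fam cO \<union> Fam (\<lambda>v. (True, \<not> snd (J v)))"
proof -
  let ?c = "\<lambda>v. (True, \<not> snd (J v))"
  have fJ: "fst (J v)" if "v \<in> V" for v
    using J_uniform[OF that] J(1)[OF that] assms by (cases "J v") auto
  have ty: "Ty f v (if fst j then ?c v else (False, True))" if "f \<in> F" "Ty f v j" "j \<noteq> (False, False)" "{v, a} \<in> f" for f v j a
  proof -
    have "v \<in> V" using face_edge_in(1)[OF F_face] that by blast
    from fJ[OF this] have "j = (if fst j then ?c v else (False, True))"
      using Ty_J[OF that(1,2)] that(3) by (cases j; cases "J v") auto
    then show ?thesis using that(2) by metis
  qed
  have fam: "f = comp (if fst j then ?c else cO) e"
    if f: "f \<in> F" "e \<in> f" "v \<in> V" "{v, a} \<in> f" "Ty f v j" for f e v a j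
  proof (rule face_comp_Ty[OF F_face[OF f(1)] f(2)])
    fix u b assume u: "{u, b} \<in> f"
    obtain i where i: "Ty f u i" "i \<noteq> (False, False)" using Ty_ex[OF F_face[OF f(1)] u] .
    have "fst i = fst j" using face_fst[OF f(1) u i(1) f(4,5)] .
    then show "Ty f u ((if fst j then ?c else cO) u)" using ty[OF f(1) i u] by (cases "fst j") simp_all
  qed
  show ?thesis
  proof
    show "F \<subseteq> Fam cO \<union> Fam ?c"
    proof
      fix f assume f: "f \<in> F"
      obtain x y where e: "{x, y} \<in> f" using face_nonempty[OF F_face[OF f]] .
      obtain j where "Ty f x j" using Ty_ex[OF F_face[OF f] e] by blast
      then have "f = comp (if fst j then ?c else cO) {x, y}"
        using fam[OF f e face_edge_in(1)[OF F_face[OF f] e] e] by blast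
      moreover have "{x, y} \<in> E" using face_edge_in(4)[OF F_face[OF f] e] .
      ultimately show "f \<in> Fam cO \<union> Fam ?c" unfolding Fam_def by (cases "fst j") auto
    qed
    show "Fam cO \<union> Fam ?c \<subseteq> F"
    proof -
      have "comp cO e \<in> F \<and> comp ?c e \<in> F" if eE: "e \<in> E" for e
      proof -
        obtain v D l where v: "v \<in> V" "e = {v, nbr v D l}" using eE unfolding E_eq by blast
        have e: "{v, nbr v D l} \<in> E" using edge_nbr[OF v(1)] .
        have "(False, True) \<noteq> J v" using fJ[OF v(1)] by (cases "J v") auto
        then obtain f where f: "f \<in> F" "{v, nbr v D l} \<in> f" "Ty f v (False, True)"
          by (rule face_of_type[OF v(1) e]) auto
        have "?c v \<noteq> J v" by (cases "J v") auto
        then obtain g where g: "g \<in> F" "{v, nbr v D l} \<in> g" "Ty g v (?c v)"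
          by (rule face_of_type[OF v(1) e]) auto
        show ?thesis
          using fam[OF f(1,2) v(1) f(2,3)] fam[OF g(1,2) v(1) g(2,3)] f(1) g(1) v(2) by simp
      qed
      then show ?thesis unfolding Fam_def by blast
    qed
  qed
qed

text \<open>Both monotone matchings are used at each vertex. Measured against the labelling
  \<open>\<pi>\<close>, the matching does not change along a face, so each face follows
  \<open>\<pi>\<close> everywhere or its opposite everywhere.\<close>

lemma F_case_A:
  assumes J0: "J (X 0) = (False, True)"
    and \<pi>: "\<And>f v u s s'. f \<in> F \<Longrightarrow> {v, u} \<in> f \<Longrightarrow> Ty f v (True, s) \<Longrightarrow> Ty f u (True, s') \<Longrightarrow>
      (s \<noteq> \<pi> v) = (s' \<noteq> \<pi> u)"
  shows "F = Fam (cM \<pi>) \<union> Fam (cM (\<lambda>v. \<not> \<pi> v))"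
proof -
  have JV: "J v = (False, True)" if "v \<in> V" for v using J_uniform[OF that] J0 by blast
  have mono: "\<exists>s. Ty f v (True, s)" if f: "f \<in> F" "{v, a} \<in> f" for f v a
  proof -
    obtain j where j: "Ty f v j" "j \<noteq> (False, False)" using Ty_ex[OF F_face[OF f(1)] f(2)] .
    have "v \<in> V" using face_edge_in(1)[OF F_face[OF f(1)] f(2)] .
    then show ?thesis using Ty_J[OF f(1) j(1)] JV j by (cases j) auto
  qed
  have fam: "f = comp (cM (\<lambda>u. s \<noteq> (\<pi> v \<noteq> \<pi> u))) e"
    if f: "f \<in> F" "e \<in> f" "{v, a} \<in> f" "Ty f v (True, s)" for f e v a s
  proof (rule face_comp_Ty[OF F_face[OF f(1)] f(2)])
    fix u b assume u: "{u, b} \<in> f"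
    show "Ty f u (True, s \<noteq> (\<pi> v \<noteq> \<pi> u))"
    proof (rule face_vertex_induct[OF F_face[OF f(1)] f(3), of v "\<lambda>u. Ty f u (True, s \<noteq> (\<pi> v \<noteq> \<pi> u))"])
      show "Ty f v (True, s \<noteq> (\<pi> v \<noteq> \<pi> v))" using f(4) by simp
      fix x y assume xy: "{x, y} \<in> f" "Ty f x (True, s \<noteq> (\<pi> v \<noteq> \<pi> x))"
      have "{y, x} \<in> f" using xy(1) by (simp add: insert_commute)
      then obtain s' where s': "Ty f y (True, s')" using mono[OF f(1)] by blast
      have "s' = (s \<noteq> (\<pi> v \<noteq> \<pi> y))" using \<pi>[OF f(1) xy s'] by blast
      then show "Ty f y (True, s \<noteq> (\<pi> v \<noteq> \<pi> y))" using s' by simp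
    qed (use u in auto)
  qed
  have c: "cM (\<lambda>u. s \<noteq> (\<pi> v \<noteq> \<pi> u)) = (if s = \<pi> v then cM \<pi> else cM (\<lambda>v. \<not> \<pi> v))" for s v
    by (cases s; cases "\<pi> v") (simp_all add: fun_eq_iff)
  note fam = fam[unfolded c]
  show ?thesis
  proof
    show "F \<subseteq> Fam (cM \<pi>) \<union> Fam (cM (\<lambda>v. \<not> \<pi> v))"
    proof
      fix f assume f: "f \<in> F"
      obtain x y where e: "{x, y} \<in> f" using face_nonempty[OF F_face[OF f]] .
      obtain s where "Ty f x (True, s)" using mono[OF f e] by blast
      from fam[OF f e e this] face_edge_in(4)[OF F_face[OF f] e]
      show "f \<in> Fam (cM \<pi>) \<union> Fam (cM (\<lambda>v. \<not> \<pi> v))" unfolding Fam_def by (auto split: if_splits)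
    qed
    have "comp (cM \<pi>) e \<in> F \<and> comp (cM (\<lambda>v. \<not> \<pi> v)) e \<in> F" if eE: "e \<in> E" for e
    proof -
      obtain v D l where v: "v \<in> V" "e = {v, nbr v D l}" using eE unfolding E_eq by blast
      have e: "{v, nbr v D l} \<in> E" using edge_nbr[OF v(1)] .
      have "(True, s) \<noteq> J v" for s using JV[OF v(1)] by simp
      then have ex: "\<exists>f\<in>F. {v, nbr v D l} \<in> f \<and> Ty f v (True, s)" for s
        by (rule face_of_type[OF v(1) e]) auto
      obtain f where f: "f \<in> F" "{v, nbr v D l} \<in> f" "Ty f v (True, \<pi> v)" using ex by blast
      obtain g where g: "g \<in> F" "{v, nbr v D l} \<in> g" "Ty g v (True, \<not> \<pi> v)" using ex by blast
      show ?thesis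
        using fam[OF f(1,2,2,3)] fam[OF g(1,2,2,3)] f(1) g(1) v(2) by simp
    qed
    then show "Fam (cM \<pi>) \<union> Fam (cM (\<lambda>v. \<not> \<pi> v)) \<subseteq> F" unfolding Fam_def by blast
  qed
qed

text \<open>By edge-transitivity of the map this holds for all edges or for none; it decides between
  matchings constant over the graph and matchings alternating with the level.\<close>

definition eqtype :: "vertex \<Rightarrow> vertex \<Rightarrow> bool" where
  "eqtype v u \<longleftrightarrow> (\<exists>f\<in>F. \<exists>j. fst j \<and> {v, u} \<in> f \<and> Ty f v j \<and> Ty f u j)"

lemma eqtype_sym: "eqtype v u \<Longrightarrow> eqtype u v"
  unfolding eqtype_def by (metis insert_commute)

lemma eqtype_rotate:
  assumes "C v a b" "eqtype v a"
  shows "eqtype v b"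
proof -
  obtain k \<sigma> where s: "T k \<sigma>" "map_aut V E F \<sigma>" "\<sigma> v = v" "\<sigma> a = b" using flag_rotation[OF assms(1)] .
  obtain f j where f: "f \<in> F" "fst j" "{v, a} \<in> f" "Ty f v j" "Ty f a j"
    using assms(2) unfolding eqtype_def by blast
  have "face_img \<sigma> f \<in> F" using s(2) f(1) unfolding map_aut_def by blast
  moreover have "{v, b} \<in> face_img \<sigma> f"
    using imageI[OF f(3), of "(`) \<sigma>"] s(3,4) by (simp add: face_img_def)
  moreover have "Ty (face_img \<sigma> f) v (twist k j)" "Ty (face_img \<sigma> f) b (twist k j)"
    using Ty_img[OF s(1) F_sub[OF f(1)]] f(4,5) s(3,4) by metis+
  moreover have "fst (twist k j)" using f(2) by (simp add: twist_def)
  ultimately show ?thesis unfolding eqtype_def by blast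
qed

lemma third_type:
  obtains j' where "j' \<noteq> (False, False)" "j' \<noteq> i" "j' \<noteq> (j :: kind)"
proof -
  have "\<not> {(True, False), (True, True), (False, True)} \<subseteq> {i, j}" by auto
  then show ?thesis using that by blast
qed

text \<open>The corners at v form a 4-cycle on the neighbours, which is connected; opposite
  neighbours are joined by way of a third one.\<close>

lemma eqtype_star:
  assumes v: "v \<in> V" "{v, a} \<in> E" "{v, b} \<in> E" and "eqtype v a"
  shows "eqtype v b"
proof (cases "a = b \<or> C v a b")
  case True
  then show ?thesis using assms(4) eqtype_rotate by blast
next
  case False
  then have S: "S (J v) v a b" using J(2)[OF v] by blast
  obtain j where j: "j \<noteq> (False, False)" "j \<noteq> J v" using third_type by metis
  obtain D l where "a = nbr v D l" using v(2) edge_iff by blast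
  then obtain c where c: "S j v a c" using S_ex by metis
  have e: "{v, c} \<in> E" using S_edges[OF v(1) c] by blast
  have ac: "a \<noteq> c" using S_irrefl[OF v(1)] c j(1) by metis
  have "\<not> S (J v) v a c" using S_type_unique[OF v(1) c] j(2) by blast
  then have "C v a c" using J(2)[OF v(1,2) e ac] by blast
  then have "eqtype v c" using eqtype_rotate assms(4) by blast
  moreover have "c \<noteq> b" using S_type_unique[OF v(1) c] S j(2) by blast
  moreover have "\<not> S (J v) v c b" using S_unique[OF v(1) S_sym[OF S]] S_sym[of "J v" v c b] ac by blast
  then have "C v c b" using J(2)[OF v(1) e v(3)] \<open>c \<noteq> b\<close> by blast
  ultimately show ?thesis using eqtype_rotate by blast
qed

lemma eqtype_uniform:
  assumes "{v, a} \<in> E"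
  shows "eqtype v a \<longleftrightarrow> eqtype (X 0) (X 1)"
proof -
  let ?P = "\<lambda>v. \<forall>a. {v, a} \<in> E \<longrightarrow> (eqtype v a \<longleftrightarrow> eqtype (X 0) (X 1))"
  have "?P v"
  proof (rule connected_induct[of ?P])
    show "?P (X 0)" using eqtype_star[OF X_in _ edge_01] eqtype_star[OF X_in edge_01] by blast
    fix v D l assume v: "v \<in> V" "?P v"
    have e: "{v, nbr v D l} \<in> E" using edge_nbr[OF v(1)] .
    then have e': "{nbr v D l, v} \<in> E" by (simp add: insert_commute)
    have "eqtype (nbr v D l) v \<longleftrightarrow> eqtype (X 0) (X 1)" using v(2) e eqtype_sym by blast
    then show "?P (nbr v D l)" using eqtype_star[OF nbr_in _ e'] eqtype_star[OF nbr_in e'] by blast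
  qed (use edge_in(1)[OF assms] in blast)
  then show ?thesis using assms by blast
qed

text \<open>Otherwise these two faces and one of the other type used at v would be three faces along
  one edge.\<close>

lemma face_unique:
  assumes "f \<in> F" "g \<in> F" "{v, a} \<in> f" "{v, a} \<in> g" "Ty f v j" "Ty g v j"
  shows "f = g"
proof (rule ccontr)
  assume ne: "f \<noteq> g"
  have v: "v \<in> V" "{v, a} \<in> E" using face_edge_in[OF F_face[OF assms(1)] assms(3)] by auto
  obtain j' where j': "j' \<noteq> (False, False)" "j' \<noteq> J v" "j' \<noteq> j" by (rule third_type)
  obtain h where h: "h \<in> F" "{v, a} \<in> h" "Ty h v j'" by (rule face_of_type[OF v j'(2,1)])
  have "h \<noteq> f" "h \<noteq> g"
    using Ty_unique[OF F_face[OF h(1)] h(3)] assms(5,6) j'(3) by blast+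
  then have "card {f, g, h} = 3" using ne by simp
  moreover have c: "card {f \<in> F. {v, a} \<in> f} = 2" using poly v(2) unfolding polytopal_map_def by blast
  moreover have "finite {f \<in> F. {v, a} \<in> f}" using c by (intro card_ge_0_finite) simp
  moreover have "{f, g, h} \<subseteq> {f \<in> F. {v, a} \<in> f}" using assms h by blast
  ultimately show False using card_mono[of "{f \<in> F. {v, a} \<in> f}" "{f, g, h}"] by simp
qed

lemma Fam_cong:
  assumes "\<And>v. v \<in> V \<Longrightarrow> c v = c' v"
  shows "Fam c = Fam c'"
proof -
  have "link c = link c'" unfolding link_def fun_eq_iff using assms by metis
  then show ?thesis unfolding Fam_def comp_def by simp
qed

theorem classification:
  "(\<exists>b. F = Fam cO \<union> Fam (cM (\<lambda>_. b))) \<or> F = Fam (cM (\<lambda>_. False)) \<union> Fam (cM (\<lambda>_. True)) \<or>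
   m mod 4 = 2 \<and> ((\<exists>b. F = Fam cO \<union> Fam (cM (\<lambda>v. par v \<noteq> b))) \<or>
     F = Fam (cM par) \<union> Fam (cM (\<lambda>v. \<not> par v)))"
proof -
  let ?\<phi> = "\<lambda>v. \<not> snd (J v)"
  have fJ: "fst (J v)" if "v \<in> V" "J (X 0) \<noteq> (False, True)" for v
    using J_uniform[OF that(1)] J(1)[OF that(1)] that(2) by (cases "J v") auto
  have mono_J: "j = (True, ?\<phi> v)" if h: "f \<in> F" "Ty f v j" "fst j" "v \<in> V" "J (X 0) \<noteq> (False, True)" for f v j
    using Ty_J[OF h(1,2)] h(3) fJ[OF h(4,5)] by (cases j; cases "J v") auto
  show ?thesis
  proof (cases "eqtype (X 0) (X 1)")
    case True
    then have all: "eqtype v a" if "{v, a} \<in> E" for v a using eqtype_uniform[OF that] by blast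
    show ?thesis
    proof (cases "J (X 0) = (False, True)")
      case False
      have "?\<phi> v = ?\<phi> (X 0)" if "v \<in> V" for v
      proof (rule connected_induct[of "\<lambda>v. ?\<phi> v = ?\<phi> (X 0)", OF refl _ that])
        fix v D l assume v: "v \<in> V" "?\<phi> v = ?\<phi> (X 0)"
        obtain f j where f: "f \<in> F" "fst j" "Ty f v j" "Ty f (nbr v D l) j"
          using all[OF edge_nbr[OF v(1)]] unfolding eqtype_def by blast
        have "(True, ?\<phi> v) = (True, ?\<phi> (nbr v D l))"
          using mono_J[OF f(1,3,2) v(1) False] mono_J[OF f(1,4,2) nbr_in False] by simp
        then show "?\<phi> (nbr v D l) = ?\<phi> (X 0)" using v(2) by simp
      qed
      then have "Fam (cM ?\<phi>) = Fam (cM (\<lambda>_. ?\<phi> (X 0)))" by (rule Fam_cong[OF arg_cong[of _ _ "Pair True"]])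
      with F_case_B[OF False] have "F = Fam cO \<union> Fam (cM (\<lambda>_. ?\<phi> (X 0)))" by (rule trans[OF _ arg_cong[of _ _ "(\<union>) _"]])
      then show ?thesis by blast
    next
      case A: True
      have "F = Fam (cM (\<lambda>_. False)) \<union> Fam (cM (\<lambda>_. \<not> False))"
      proof (rule F_case_A[OF A])
        fix f v u s s' assume f: "f \<in> F" "{v, u} \<in> f" "Ty f v (True, s)" "Ty f u (True, s')"
        have uv: "{u, v} \<in> f" using f(2) by (simp add: insert_commute)
        have "{v, u} \<in> E" using F_sub[OF f(1)] f(2) by blast
        then obtain g j where g: "g \<in> F" "fst j" "{v, u} \<in> g" "Ty g v j" "Ty g u j"
          using all unfolding eqtype_def by blast
        obtain r where j: "j = (True, r)" using g(2) by (cases j) auto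
        have gu: "{u, v} \<in> g" using g(3) by (simp add: insert_commute)
        \<comment> \<open>The face g has the matching r at both ends of the edge. If f has it at one
          end, then f = g and f has it at the other end as well.\<close>
        have "s = r \<Longrightarrow> f = g" using face_unique[OF f(1) g(1) f(2) g(3) f(3)] g(4) j by simp
        moreover have "s' = r \<Longrightarrow> f = g" using face_unique[OF f(1) g(1) uv gu f(4)] g(5) j by simp
        moreover have "f = g \<Longrightarrow> s = r \<and> s' = r"
          using Ty_unique[OF F_face[OF f(1)] f(3)] Ty_unique[OF F_face[OF f(1)] f(4)] g(4,5) j by blast
        ultimately show "(s \<noteq> False) = (s' \<noteq> False)" by blast
      qed
      then show ?thesis by simp
    qed
  next
    case none: False
    then have none: "\<not> eqtype v a" if "{v, a} \<in> E" for v a using eqtype_uniform[OF that] by blast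
    \<comment> \<open>Some monotone face changes its matching between x_0 and x_1, so the flip of
      this edge is a twisted automorphism.\<close>
    have "m mod 4 = 2"
    proof -
      obtain j where j: "j \<noteq> (False, False)" "j \<noteq> J (X 0)" "j \<noteq> (False, True)" by (rule third_type)
      obtain f where f: "f \<in> F" "{X 0, X 1} \<in> f" "Ty f (X 0) j" by (rule face_of_type[OF X_in edge_01 j(2,1)])
      have "{X 1, X 0} \<in> f" using f(2) by (simp add: insert_commute)
      then obtain j' where j': "Ty f (X 1) j'" using Ty_ex[OF F_face[OF f(1)]] by blast
      obtain k \<sigma> where k: "T k \<sigma>" "j' = twist k j" using face_type_step[OF f j'] .
      have fj: "fst j" using j by (cases j) auto
      have "j' \<noteq> j" using none[OF edge_01] f j' fj unfolding eqtype_def by blast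
      then have "k" using k(2) by (cases j; cases k) (simp_all add: twist_def)
      then show ?thesis using T_True_mod4[of \<sigma>] k(1) by simp
    qed
    then have ev: "even m" by presburger
    have "(\<exists>b. F = Fam cO \<union> Fam (cM (\<lambda>v. par v \<noteq> b))) \<or> F = Fam (cM par) \<union> Fam (cM (\<lambda>v. \<not> par v))"
    proof (cases "J (X 0) = (False, True)")
      case False
      have "?\<phi> v = (par v \<noteq> ?\<phi> (X 0))" if "v \<in> V" for v
      proof (rule connected_induct[of "\<lambda>v. ?\<phi> v = (par v \<noteq> ?\<phi> (X 0))", OF _ _ that])
        show "?\<phi> (X 0) = (par (X 0) \<noteq> ?\<phi> (X 0))" using ev by simp
        fix v D l assume v: "v \<in> V" "?\<phi> v = (par v \<noteq> ?\<phi> (X 0))"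
        let ?u = "nbr v D l"
        have "(True, ?\<phi> v) \<noteq> J v" by (cases "J v") auto
        then obtain f where f: "f \<in> F" "{v, ?u} \<in> f" "Ty f v (True, ?\<phi> v)"
          by (rule face_of_type[OF v(1) edge_nbr[OF v(1)]]) auto
        have u: "{?u, v} \<in> f" using f(2) by (simp add: insert_commute)
        then obtain j' where j': "Ty f ?u j'" using Ty_ex[OF F_face[OF f(1)]] by blast
        have "fst j'" using face_fst[OF f u j'] by simp
        then have "Ty f ?u (True, ?\<phi> ?u)" using mono_J[OF f(1) j' _ nbr_in False] j' by simp
        then have "eqtype v ?u" if "?\<phi> ?u = ?\<phi> v"
          using f that unfolding eqtype_def by (intro bexI[of _ f] exI[of _ "(True, ?\<phi> v)"]) simp_all
        then have "?\<phi> ?u \<noteq> ?\<phi> v" using none[OF edge_nbr[OF v(1)]] by blast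
        then show "?\<phi> ?u = (par ?u \<noteq> ?\<phi> (X 0))" using v(2) par_nbr[OF ev v(1)] by blast
      qed
      then have "Fam (cM ?\<phi>) = Fam (cM (\<lambda>v. par v \<noteq> ?\<phi> (X 0)))" by (rule Fam_cong[OF arg_cong[of _ _ "Pair True"]])
      with F_case_B[OF False] have "F = Fam cO \<union> Fam (cM (\<lambda>v. par v \<noteq> ?\<phi> (X 0)))"
        by (rule trans[OF _ arg_cong[of _ _ "(\<union>) _"]])
      then show ?thesis by blast
    next
      case A: True
      have "F = Fam (cM par) \<union> Fam (cM (\<lambda>v. \<not> par v))"
      proof (rule F_case_A[OF A])
        fix f v u s s' assume f: "f \<in> F" "{v, u} \<in> f" "Ty f v (True, s)" "Ty f u (True, s')"
        have e: "{v, u} \<in> E" using F_sub[OF f(1)] f(2) by blast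
        then obtain D l where "u = nbr v D l" "v \<in> V" using edge_iff by blast
        then have "par u = (\<not> par v)" using par_nbr[OF ev] by simp
        moreover have "eqtype v u" if "s = s'"
          using f that unfolding eqtype_def by (intro bexI[of _ f] exI[of _ "(True, s)"]) simp_all
        then have "s \<noteq> s'" using none[OF e] by blast
        ultimately show "(s \<noteq> par v) = (s' \<noteq> par u)" by blast
      qed
      then show ?thesis ..
    qed
    then show ?thesis using \<open>m mod 4 = 2\<close> by blast
  qed
qed

text \<open>Such a map is preserved by zeta, which fixes an arc and swaps the two faces along it, so
  the map is regular.\<close>

lemma not_regular:
  assumes m4: "m mod 4 = 2" and \<pi>: "\<And>v. v \<in> V \<Longrightarrow> \<pi> (zeta v) = \<pi> v"
  shows "F \<noteq> Fam (cM \<pi>) \<union> Fam (cM (\<lambda>v. \<not> \<pi> v))"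
proof
  assume F: "F = Fam (cM \<pi>) \<union> Fam (cM (\<lambda>v. \<not> \<pi> v))"
  obtain c where c: "int d = 4 * c + 2" using d_mod_4[OF m4] .
  have T: "T True zeta" using T_zeta[OF c] .
  have p: "pres True zeta (cM \<pi>) (cM (\<lambda>v. \<not> \<pi> v))" "pres True zeta (cM (\<lambda>v. \<not> \<pi> v)) (cM \<pi>)"
    using T \<pi> by (simp_all add: pres_def twist_def)
  have "map_aut V E F zeta"
    unfolding map_aut_def F image_Un face_img_Fam[OF p(1)] face_img_Fam[OF p(2)]
    using T_graph_aut[OF T] by blast
  note aut = this
  let ?e = "{X 0, X 1}"
  note e = edge_01
  let ?f = "comp (cM \<pi>) ?e" and ?g = "comp (cM (\<lambda>v. \<not> \<pi> v)) ?e"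
  have img: "face_img zeta ?f = ?g" using face_img_comp[OF p(1) e] by (simp add: zeta_01)
  have at: "{f \<in> F. ?e \<in> f} = {?f, ?g}"
    using e comp_eq unfolding F Fam_def by auto
  have "card {f \<in> F. ?e \<in> f} = 2" using poly e unfolding polytopal_map_def by blast
  then have two: "card {?f, ?g} = 2" unfolding at .
  have "?f \<noteq> ?g"
  proof
    assume "?f = ?g"
    then have "card {?f, ?g} = card {?g}" by (simp only: insert_absorb2)
    then show False using two by simp
  qed
  then have "adj_flag 2 (X 0, ?e, ?f) (X 0, ?e, ?g)" by (simp add: adj_flag_def)
  moreover have "(X 0, ?e, ?f) \<in> flags F" "(X 0, ?e, ?g) \<in> flags F"
    using e unfolding flags_def F Fam_def by auto
  moreover have "flag_img zeta (X 0, ?e, ?f) \<in> flag_orbit V E F (X 0, ?e, ?f)"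
    unfolding flag_orbit_def using aut by blast
  then have "(X 0, ?e, ?g) \<in> flag_orbit V E F (X 0, ?e, ?f)"
    using img by (simp add: flag_img_def zeta_01)
  ultimately show False using cls unfolding class_2_01_def by blast
qed

end


section \<open>Isomorphism and counting\<close>

lemma Fam_types:
  assumes c: "cyclic c1" "cyclic c2" and f: "f \<in> Fam c1 \<union> Fam c2" and "Ty f v j"
  shows "j = c1 v \<or> j = c2 v"
proof -
  obtain c e where e: "c = c1 \<or> c = c2" "e \<in> E" "f = comp c e" using f unfolding Fam_def by blast
  obtain a b where ab: "a \<noteq> b" "{v, a} \<in> f" "{v, b} \<in> f" "S j v a b" using assms(4) unfolding Ty_def by blast
  have "cyclic c" using c e(1) by blast
  then have "v \<in> V \<and> S (c v) v a b" using corner_type[OF _ e(2)] ab(1-3) e(3) by blast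
  then have "j = c v" using S_type_unique ab(4) by blast
  then show ?thesis using e(1) by blast
qed

lemma Fam_has_type:
  assumes "cyclic c" "v \<in> V"
  obtains f where "f \<in> Fam c" "Ty f v (c v)"
proof -
  let ?a = "nbr v True True" and ?b = "nbr v (True \<noteq> fst (c v)) (True \<noteq> snd (c v))"
  have e: "{v, ?a} \<in> E" using edge_nbr[OF assms(2)] .
  have s: "S (c v) v ?a ?b" using S_nbr[OF assms(2)] by simp
  have "?a \<noteq> ?b" using S_irrefl[OF assms(2)] s assms unfolding cyclic_def valid_def by metis
  moreover have "{v, ?b} \<in> comp c {v, ?a}"
    using comp_step[of v ?a c "{v, ?a}" ?b] assms(2) s by simp
  ultimately have "Ty (comp c {v, ?a}) v (c v)" unfolding Ty_def using comp_refl s by blast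
  moreover have "comp c {v, ?a} \<in> Fam c" unfolding Fam_def using e by blast
  ultimately show ?thesis using that by blast
qed

text \<open>The matchings used at a vertex can be read off from the faces, so an isomorphism carries
  them, up to its twist, to those used at the image vertex.\<close>

lemma iso_types:
  assumes c: "cyclic c1" "cyclic c2" "cyclic c1'" "cyclic c2'"
    and iso: "maps_iso V E (Fam c1 \<union> Fam c2) (Fam c1' \<union> Fam c2')"
  obtains k \<sigma> where "T k \<sigma>"
    "\<And>v. v \<in> V \<Longrightarrow> twist k (c1 v) \<in> {c1' (\<sigma> v), c2' (\<sigma> v)}"
    "\<And>v. v \<in> V \<Longrightarrow> twist k (c2 v) \<in> {c1' (\<sigma> v), c2' (\<sigma> v)}"
proof -
  obtain \<sigma> where s: "graph_aut V E \<sigma>" "face_img \<sigma> ` (Fam c1 \<union> Fam c2) = Fam c1' \<union> Fam c2'"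
    using iso unfolding maps_iso_def by blast
  obtain k where T: "T k \<sigma>" using aut_T[OF s(1)] ..
  have "twist k (c v) \<in> {c1' (\<sigma> v), c2' (\<sigma> v)}" if "c = c1 \<or> c = c2" "v \<in> V" for c v
  proof -
    have cc: "cyclic c" using that(1) c by blast
    obtain f where f: "f \<in> Fam c" "Ty f v (c v)" using Fam_has_type[OF cc \<open>v \<in> V\<close>] .
    have "f \<subseteq> E" using f(1) comp_subset unfolding Fam_def by blast
    then have "Ty (face_img \<sigma> f) (\<sigma> v) (twist k (c v))" using Ty_img[OF T _ f(2)] by blast
    moreover have "face_img \<sigma> f \<in> Fam c1' \<union> Fam c2'" using s(2) f(1) that(1) by blast
    ultimately show ?thesis using Fam_types[OF c(3,4)] by blast
  qed
  then show ?thesis using that[OF T] by blast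
qed

abbreviation cM0 where "cM0 \<equiv> cM (\<lambda>_. False)"
abbreviation cM1 where "cM1 \<equiv> cM (\<lambda>_. True)"

lemma polytopal_O: "cyclic (cM \<phi>) \<Longrightarrow> polytopal_map V E (Fam cO \<union> Fam (cM \<phi>))"
  by (rule polytopal_Fam[OF cyclic_O]) simp_all

lemma class_O: "cyclic (cM \<phi>) \<Longrightarrow> arc_transitive cO (cM \<phi>) \<Longrightarrow> class_2_01 V E (Fam cO \<union> Fam (cM \<phi>))"
  by (rule class_Fam[OF cyclic_O]) (simp_all add: aut_T twist_def)

lemma polytopal_M: "polytopal_map V E (Fam cM0 \<union> Fam cM1)"
  by (rule polytopal_Fam[OF cyclic_M0 cyclic_M1]) simp

lemma T_untwisted: "m mod 4 \<noteq> 2 \<Longrightarrow> T k \<sigma> \<Longrightarrow> \<not> k"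
  using T_True_mod4 by (cases k) auto

lemma class_M:
  assumes "m mod 4 \<noteq> 2"
  shows "class_2_01 V E (Fam cM0 \<union> Fam cM1)"
  by (rule class_Fam[OF cyclic_M0 cyclic_M1 _ arc_transitive_const aut_T])
    (auto simp: twist_def dest: T_untwisted[OF assms])

lemma maps_iso_refl: "maps_iso V E F F"
proof -
  have "face_img id ` F = F" by (simp add: face_img_def)
  then show ?thesis unfolding maps_iso_def using T_graph_aut[OF T_id] by blast
qed

lemma exactly_kI:
  assumes "distinct Fs" "\<And>F. F \<in> set Fs \<Longrightarrow> polytopal_map V E F \<and> class_2_01 V E F"
    "\<And>F G. F \<in> set Fs \<Longrightarrow> G \<in> set Fs \<Longrightarrow> F \<noteq> G \<Longrightarrow> \<not> maps_iso V E F G"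
    "\<And>F. polytopal_map V E F \<Longrightarrow> class_2_01 V E F \<Longrightarrow> \<exists>G\<in>set Fs. maps_iso V E F G"
  shows "exactly_k_class_2_01_maps V E (length Fs)"
  unfolding exactly_k_class_2_01_maps_def
  by (intro exI[of _ "set Fs"]) (use assms in \<open>auto simp: distinct_card\<close>)

lemma three_maps:
  assumes m4: "m mod 4 \<noteq> 2"
  shows "exactly_k_class_2_01_maps V E 3"
proof -
  let ?O0 = "Fam cO \<union> Fam cM0" and ?O1 = "Fam cO \<union> Fam cM1" and ?M = "Fam cM0 \<union> Fam cM1"
  \<comment> \<open>Without twisted automorphisms the pair of matchings used at a vertex is an
    invariant, and the three maps have different pairs.\<close>
  have n: "\<not> maps_iso V E (Fam c1 \<union> Fam c2) (Fam c1' \<union> Fam c2')"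
    if c: "cyclic c1" "cyclic c2" "cyclic c1'" "cyclic c2'"
      and ne: "\<And>v w. \<not> {c1 v, c2 v} \<subseteq> {c1' w, c2' w}" for c1 c2 c1' c2'
  proof
    assume "maps_iso V E (Fam c1 \<union> Fam c2) (Fam c1' \<union> Fam c2')"
    then obtain k \<sigma> where s: "T k \<sigma>"
      "\<And>v. v \<in> V \<Longrightarrow> twist k (c1 v) \<in> {c1' (\<sigma> v), c2' (\<sigma> v)}"
      "\<And>v. v \<in> V \<Longrightarrow> twist k (c2 v) \<in> {c1' (\<sigma> v), c2' (\<sigma> v)}"
      using iso_types[OF c] by metis
    have "twist k j = j" for j using T_untwisted[OF m4 s(1)] by (simp add: twist_def)
    then show False using s(2,3)[OF X_in[of 0]] ne[of "X 0" "\<sigma> (X 0)"] by auto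
  qed
  note cyc = cyclic_O cyclic_M0 cyclic_M1
  have iso: "\<not> maps_iso V E ?O0 ?O1" "\<not> maps_iso V E ?O1 ?O0" "\<not> maps_iso V E ?O0 ?M"
    "\<not> maps_iso V E ?M ?O0" "\<not> maps_iso V E ?O1 ?M" "\<not> maps_iso V E ?M ?O1"
    by (rule n; (rule cyc)?; simp)+
  have "exactly_k_class_2_01_maps V E (length [?O0, ?O1, ?M])"
  proof (rule exactly_kI)
    show "distinct [?O0, ?O1, ?M]" using iso maps_iso_refl by (metis distinct_length_2_or_more distinct_singleton)
    show "polytopal_map V E F \<and> class_2_01 V E F" if "F \<in> set [?O0, ?O1, ?M]" for F
      using that polytopal_O[OF cyclic_M0] polytopal_O[OF cyclic_M1] polytopal_M
        class_O[OF cyclic_M0 arc_transitive_const] class_O[OF cyclic_M1 arc_transitive_const] class_M[OF m4]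
      by auto
    show "\<not> maps_iso V E F G" if "F \<in> set [?O0, ?O1, ?M]" "G \<in> set [?O0, ?O1, ?M]" "F \<noteq> G" for F G
      using that iso by auto
    show "\<exists>G\<in>set [?O0, ?O1, ?M]. maps_iso V E F G" if F: "polytopal_map V E F" "class_2_01 V E F" for F
    proof -
      have "F \<in> set [?O0, ?O1, ?M]"
      proof -
        consider b where "F = Fam cO \<union> Fam (cM (\<lambda>_. b))" | "F = ?M"
          using classification[OF F] m4 by blast
        then show ?thesis
        proof cases
          case (1 b) then show ?thesis by (cases b) simp_all
        qed simp
      qed
      then show ?thesis using maps_iso_refl by blast
    qed
  qed
  then show ?thesis by (simp add: numeral_eq_Suc)
qed

lemma two_maps:
  assumes m4: "m mod 4 = 2"
  shows "exactly_k_class_2_01_maps V E 2"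
proof -
  have ev: "even m" using m4 by presburger
  let ?O0 = "Fam cO \<union> Fam cM0" and ?P = "Fam cO \<union> Fam (cM par)"
  note cyc = cyclic_O cyclic_M0 cyclic_par[OF m4]
  have par1: "par (X 1)" "\<not> par (X 0)" using ev by simp_all
  have iso1: "\<not> maps_iso V E ?O0 ?P"
  proof
    assume "maps_iso V E ?O0 ?P"
    then obtain k \<sigma> where s: "T k \<sigma>" "\<And>v. v \<in> V \<Longrightarrow> twist k (cM0 v) \<in> {cO (\<sigma> v), cM par (\<sigma> v)}"
      using iso_types[OF cyc(1,2,1,3)] by metis
    \<comment> \<open>A constant matching can go to the alternating one only if k is the parity of
      every image vertex, but parity takes both values.\<close>
    have "k = par (\<sigma> v)" if "v \<in> V" for v using s(2)[OF that] by (simp add: twist_def)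
    then show False using T_par[OF ev s(1)] par1 X_in by metis
  qed
  have iso2: "\<not> maps_iso V E ?P ?O0"
  proof
    assume "maps_iso V E ?P ?O0"
    then obtain k \<sigma> where s: "T k \<sigma>" "\<And>v. v \<in> V \<Longrightarrow> twist k (cM par v) \<in> {cO (\<sigma> v), cM0 (\<sigma> v)}"
      using iso_types[OF cyc(1,3,1,2)] by metis
    have "k = par v" if "v \<in> V" for v using s(2)[OF that] by (simp add: twist_def)
    then show False using par1 X_in by metis
  qed
  obtain c where c: "int d = 4 * c + 2" using d_mod_4[OF m4] .
  have Tz: "T True zeta" using T_zeta[OF c] .
  have parz: "par (zeta v) = par v" if "v \<in> V" for v
    using T_par[OF ev Tz that] ev by (simp add: zeta_01)
  \<comment> \<open>\<open>zeta\<close> keeps the family of flat faces and replaces a monotone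
    choice by its opposite, read at the image vertex.\<close>
  have flip: "maps_iso V E (Fam cO \<union> Fam (cM \<phi>)) (Fam cO \<union> Fam (cM \<psi>))"
    if "\<And>v. v \<in> V \<Longrightarrow> \<psi> (zeta v) = (\<not> \<phi> v)" for \<phi> \<psi>
  proof -
    have "pres True zeta (cM \<phi>) (cM \<psi>)" using Tz that by (simp add: pres_def twist_def)
    then have "face_img zeta ` (Fam cO \<union> Fam (cM \<phi>)) = Fam cO \<union> Fam (cM \<psi>)"
      unfolding image_Un using face_img_Fam face_img_Fam[OF pres_cO[OF Tz]] by simp
    then show ?thesis unfolding maps_iso_def using T_graph_aut[OF Tz] by blast
  qed
  have "exactly_k_class_2_01_maps V E (length [?O0, ?P])"
  proof (rule exactly_kI)
    show "distinct [?O0, ?P]" using iso1 maps_iso_refl by (metis distinct_length_2_or_more distinct_singleton)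
    show "polytopal_map V E F \<and> class_2_01 V E F" if "F \<in> set [?O0, ?P]" for F
      using that polytopal_O[OF cyc(2)] polytopal_O[OF cyc(3)]
        class_O[OF cyc(2) arc_transitive_const] class_O[OF cyc(3) arc_transitive_par[OF m4]]
      by auto
    show "\<not> maps_iso V E F G" if "F \<in> set [?O0, ?P]" "G \<in> set [?O0, ?P]" "F \<noteq> G" for F G
      using that iso1 iso2 by auto
    show "\<exists>G\<in>set [?O0, ?P]. maps_iso V E F G" if F: "polytopal_map V E F" "class_2_01 V E F" for F
    proof -
      have "F \<noteq> Fam cM0 \<union> Fam cM1" using not_regular[OF F m4, of "\<lambda>_. False"] by simp
      moreover have "F \<noteq> Fam (cM par) \<union> Fam (cM (\<lambda>v. \<not> par v))" by (rule not_regular[OF F m4, of par]) (rule parz)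
      ultimately consider b where "F = Fam cO \<union> Fam (cM (\<lambda>_. b))"
        | b where "F = Fam cO \<union> Fam (cM (\<lambda>v. par v \<noteq> b))"
        using classification[OF F] by blast
      then show ?thesis
      proof cases
        case (1 b)
        have "maps_iso V E F ?O0"
          using 1 maps_iso_refl[of F] flip[of "\<lambda>_. False" "\<lambda>_. True"] by (cases b) simp_all
        then show ?thesis by simp
      next
        case (2 b)
        have "maps_iso V E F ?P"
          using 2 maps_iso_refl[of F] flip[of par "\<lambda>v. \<not> par v"] parz by (cases b) simp_all
        then show ?thesis by simp
      qed
    qed
  qed
  then show ?thesis by (simp add: numeral_eq_Suc)
qed

end

theorem theorem3p8:
  fixes m d :: nat
  assumes "m \<ge> 1" and "d = m \<or> d = 11 * m"
  shows "(m mod 4 \<noteq> 2 \<longrightarrow>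
            exactly_k_class_2_01_maps (rose_vertices (12 * m))
              (rose_edges (12 * m) ((3 * d + 2) mod (12 * m)) ((9 * d + 1) mod (12 * m))) 3) \<and>
         (m mod 4 = 2 \<longrightarrow>
            exactly_k_class_2_01_maps (rose_vertices (12 * m))
              (rose_edges (12 * m) ((3 * d + 2) mod (12 * m)) ((9 * d + 1) mod (12 * m))) 2)"
proof -
  interpret rose_window m d using assms by unfold_locales
  show ?thesis using three_maps two_maps unfolding V_def E_def by blast
qed

end
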